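(* If $w \in S_n$ is a vexillary permutation, then $$\operatorname{supp}(\mathfrak G_w) = \{\operatorname{wt}(\mathcal D)\colon \mathcal D \in \mathcal{BD}(w)\}.$$
   Context: Write $[n]=\{1,\dots,n\}$. The support $\operatorname{supp}(f)\subseteq\mathbb Z^n$ of a polynomial $f$ is the set of exponent vectors of monomials with nonzero coefficient in $f$. Permutations and Grothendieck polynomials. Permutations $w\in S_n$ are written in one-line notation $w(1)\cdots w(n)$; $ws_j$ is $w$ with the values in positions $j,j+1$ swapped; $w_0$ is the longest permutation. $w$ is vexillary if there are no $i<j<k<\ell$ with $w(j)<w(i)<w(\ell)<w(k)$. On $\mathbb Z[x_1,\dots,x_n]$ put $\partial_j(f)=\frac{f-s_j\cdot f}{x_j-x_{j+1}}$ ($s_j$ swaps $x_j,x_{j+1}$) and $\overline\partial_j(f)=\partial_j(f-x_{j+1}f)$. The Grothendieck polynomial is defined recursively by $\mathfrak G_{w_0}=x_1^{n-1}x_2^{n-2}\cdots x_{n-1}$ and $\mathfrak G_w=\overline\partial_j\mathfrak G_{ws_j}$ if $w(j)<w(j+1)$. Rothe diagram. A diagram is a subset $D\subseteq[n]\times[k]$, indexed as in a matrix (row, column; row 1 on top), and its elements are called squares. $D(w)=\{(i,j)\in[n]\times[n]\colon i<w^{-1}(j),\ j<w(i)\}$, with rank function $r_{D(w)}(i,j)=|\{p\colon p<i,\ w(p)<j\}|$. Bubbling diagrams. A bubbling diagram is a triple $\mathcal D=(D,r,F)$ with $D\subseteq[n]\times[k]$ a diagram, $r\colon D\to\mathbb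 Z_{\ge0}$, and $F\subseteq D$, such that: (i) if $(i,j)\in F$, then there is $(i',j)\in D\setminus F$ with $i'<i$, and for the maximal such $i'$ one has $r(i,j)-r(i',j)=i-i'$; (ii) if $(i,j),(i,k')\in F$ with $j\ne k'$, then $r(i,j)\neq r(i,k')$. Squares in $D\setminus F$ are live, squares in $F$ are dead, positions not in $D$ are empty. $\operatorname{wt}(\mathcal D)=\operatorname{wt}(D)\in\mathbb Z^n$ is the vector whose $i$-th entry is the number of squares of $D$ in row $i$. Moves. Let $(i,j)$ be live and $(i-1,j)$ empty (with $i\geq 2$). A bubbling move at $(i,j)$ replaces $(D,r,F)$ by $(D',r',F)$ with $D'=(D\setminus\{(i,j)\})\cup\{(i-1,j)\}$, $r'(i-1,j)=r(i,j)-1$ and $r'=r$ elsewhere. If moreover there is no dead square $(i,k')\in F$ with $r(i,k')=r(i,j)$, a K-bubbling move at $(i,j)$ replaces $(D,r,F)$ by $(D',r',F')$ with $D'=D\cup\{(i-1,j)\}$, $F'=F\cup\{(i,j)\}$, $r'(i-1,j)=r(i,j)-1$ and $r'=r$ elsewhere. $\mathcal{BD}(w)$ is the set of all bubbling diagrams obtained from $\mathcal D(w)=(D(w),r_{D(w)},\emptyset)$ by finite (possibly empty) sequences of bubbling and K-bubbling moves. *)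

theory Defs
  imports "HOL-Library.Poly_Mapping" "HOL-Combinatorics.Permutations"
begin

section \<open>Integer polynomials and their supports\<close>

text \<open>
  A polynomial maps monomials (finitely supported exponent functions on the variable
  indices) to coefficients; its product is the convolution product of \<^theory>\<open>HOL-Library.Poly_Mapping\<close>.
  The ring \<open>\<int>[x\<^sub>1, \<dots>, x\<^sub>n]\<close> is the subring of those polynomials that use only the
  variables \<open>1, \<dots>, n\<close>.
\<close>

type_synonym monomial = "nat \<Rightarrow>\<^sub>0 nat"
type_synonym int_mpoly = "monomial \<Rightarrow>\<^sub>0 int"

definition X :: "nat \<Rightarrow> int_mpoly" where
  "X i = Poly_Mapping.single (Poly_Mapping.single i 1) 1"

text \<open>
  Vectors in \<open>\<int>\<^sup>n\<close> are functions on \<open>nat\<close> with entries at \<open>1, \<dots>, n\<close> and value \<open>0\<close> elsewhere.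
\<close>

definition supp :: "int_mpoly \<Rightarrow> (nat \<Rightarrow> int) set" where
  "supp f = {(\<lambda>i. int (Poly_Mapping.lookup m i)) | m. m \<in> Poly_Mapping.keys f}"

text \<open>
  \<open>map_key\<close> precomposes with its first argument. As a transposition is its own inverse,
  precomposing the exponents with it swaps the two variables in a monomial, and precomposing
  the coefficient function with that swap moves each coefficient to the swapped monomial.
\<close>

definition swap_vars :: "nat \<Rightarrow> int_mpoly \<Rightarrow> int_mpoly" where
  "swap_vars j f = Poly_Mapping.map_key (Poly_Mapping.map_key (transpose j (j + 1))) f"

text \<open>
  The quotient is exact, and it is unique because polynomials form an integral domain.
\<close>

definition divided_diff :: "nat \<Rightarrow> int_mpoly \<Rightarrow> int_mpoly" where
  "divided_diff j f = (THE g. (X j - X (j + 1)) * g = f - swap_vars j f)"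

definition isobaric_divided_diff :: "nat \<Rightarrow> int_mpoly \<Rightarrow> int_mpoly" where
  "isobaric_divided_diff j f = divided_diff j (f - X (j + 1) * f)"

section \<open>Permutations and Grothendieck polynomials\<close>

text \<open>
  Elements of \<open>S\<^sub>n\<close> are functions \<open>w\<close> with \<open>w permutes {1..n}\<close>, hence the identity outside
  \<open>{1..n}\<close>.
\<close>

definition vexillary :: "nat \<Rightarrow> (nat \<Rightarrow> nat) \<Rightarrow> bool" where
  "vexillary n w \<longleftrightarrow>
     \<not> (\<exists>i j k l. 1 \<le> i \<and> i < j \<and> j < k \<and> k < l \<and> l \<le> n \<and>
          w j < w i \<and> w i < w l \<and> w l < w k)"

definition longest_perm :: "nat \<Rightarrow> nat \<Rightarrow> nat" where
  "longest_perm n i = (if i \<in> {1..n} then n + 1 - i else i)"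

text \<open>
  The recursion may use any ascent \<open>j\<close> of \<open>w\<close>. The result does not depend on these choices
  (the operators satisfy the braid relations), so the relation below is functional.
\<close>

inductive grothendieck_rec :: "nat \<Rightarrow> (nat \<Rightarrow> nat) \<Rightarrow> int_mpoly \<Rightarrow> bool" for n :: nat where
  longest: "grothendieck_rec n (longest_perm n) (\<Prod>i = 1..n. X i ^ (n - i))"
| ascent: "grothendieck_rec n w (isobaric_divided_diff j f)"
    if "w permutes {1..n}" and "1 \<le> j" and "j < n" and "w j < w (j + 1)"
      and "grothendieck_rec n (w \<circ> transpose j (j + 1)) f"

definition grothendieck :: "nat \<Rightarrow> (nat \<Rightarrow> nat) \<Rightarrow> int_mpoly" where
  "grothendieck n w = (THE f. grothendieck_rec n w f)"

section \<open>Bubbling diagrams\<close>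

type_synonym square = "nat \<times> nat"

text \<open>
  A triple \<open>(D, r, F)\<close> of squares, ranks and dead squares. Only the values of \<open>r\<close> on \<open>D\<close>
  matter. They are integers, required to be nonnegative, so that the subtractions below are
  not truncated.
\<close>

type_synonym ranked_diagram = "square set \<times> (square \<Rightarrow> int) \<times> square set"

definition is_bubbling_diagram :: "nat \<Rightarrow> nat \<Rightarrow> ranked_diagram \<Rightarrow> bool" where
  "is_bubbling_diagram n k \<D> \<longleftrightarrow> (case \<D> of (D, r, F) \<Rightarrow>
     D \<subseteq> {1..n} \<times> {1..k} \<and> (\<forall>s \<in> D. r s \<ge> 0) \<and> F \<subseteq> D \<and>
     (\<forall>(i, j) \<in> F.
        (\<exists>i' < i. (i', j) \<in> D - F) \<and>
        (let i' = Max {i'. i' < i \<and> (i', j) \<in> D - F}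
         in r (i, j) - r (i', j) = int i - int i')) \<and>
     (\<forall>i j k'. (i, j) \<in> F \<and> (i, k') \<in> F \<and> j \<noteq> k' \<longrightarrow> r (i, j) \<noteq> r (i, k')))"

definition wt :: "ranked_diagram \<Rightarrow> nat \<Rightarrow> int" where
  "wt \<D> i = (case \<D> of (D, r, F) \<Rightarrow> int (card {j. (i, j) \<in> D}))"

inductive bubbling_step :: "ranked_diagram \<Rightarrow> ranked_diagram \<Rightarrow> bool" where
  bubble: "bubbling_step (D, r, F)
      (insert (i - 1, j) (D - {(i, j)}), r((i - 1, j) := r (i, j) - 1), F)"
    if "i \<ge> 2" and "(i, j) \<in> D - F" and "(i - 1, j) \<notin> D"
| K_bubble: "bubbling_step (D, r, F)
      (insert (i - 1, j) D, r((i - 1, j) := r (i, j) - 1), insert (i, j) F)"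
    if "i \<ge> 2" and "(i, j) \<in> D - F" and "(i - 1, j) \<notin> D"
      and "\<not> (\<exists>k'. (i, k') \<in> F \<and> r (i, k') = r (i, j))"

definition rothe_diagram :: "nat \<Rightarrow> (nat \<Rightarrow> nat) \<Rightarrow> square set" where
  "rothe_diagram n w = {(i, j). i \<in> {1..n} \<and> j \<in> {1..n} \<and> i < inv w j \<and> j < w i}"

definition rothe_rank :: "nat \<Rightarrow> (nat \<Rightarrow> nat) \<Rightarrow> square \<Rightarrow> int" where
  "rothe_rank n w = (\<lambda>(i, j). int (card {p \<in> {1..n}. p < i \<and> w p < j}))"

definition rothe_bubbling :: "nat \<Rightarrow> (nat \<Rightarrow> nat) \<Rightarrow> ranked_diagram" where
  "rothe_bubbling n w = (rothe_diagram n w, rothe_rank n w, {})"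

definition BD :: "nat \<Rightarrow> (nat \<Rightarrow> nat) \<Rightarrow> ranked_diagram set" where
  "BD n w = {\<D>. is_bubbling_diagram n n \<D> \<and> bubbling_step\<^sup>*\<^sup>* (rothe_bubbling n w) \<D>}"

end

theory Submission
  imports Defs
begin

text \<open>
  The Grothendieck polynomial of a vexillary permutation is a signed sum over flagged set-valued
  tableaux. The sign of a tableau depends only on its number of entries, so nothing cancels, and the
  support is the set of weights of these tableaux. A bubbling diagram is the same object before
  sorting, since forgetting the order of the columns changes no weight.

  The tableaux are handled as chains of partitions \<open>\<Lambda> 0 \<subseteq> \<dots> \<subseteq> \<Lambda> n\<close>, where \<open>\<Lambda> m\<close> consists of the boxes
  whose smallest entry is at most \<open>m\<close>. Consecutive partitions differ by a horizontal strip; further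
  entries \<open>m + 1\<close> may be added to the last boxes of certain rows of \<open>\<Lambda> m\<close>, which is accounted for by a
  power of \<open>1 - x\<close>. The flags are lower bounds \<open>R m \<subseteq> \<Lambda> m\<close>. For a permutation, \<open>R m\<close> is given by the
  heights of the columns of the Rothe diagram within its first \<open>m\<close> rows (\<open>column_flag\<close>). Vexillarity
  enters through \<open>vexillary_nested_columns\<close>: these columns form a chain under inclusion.

  The algebraic half shows that the sums over flagged chains obey the recursion of the Grothendieck
  polynomials. If \<open>i\<close> is an ascent of \<open>w\<close> and both \<open>w\<close> and \<open>w s\<^sub>i\<close> have nested columns, then their flags
  differ by a single box, and its row is forced one step earlier for \<open>w s\<^sub>i\<close> than for \<open>w\<close>.
  Only the steps \<open>i\<close> and \<open>i + 1\<close> involve the variables on which the divided difference acts. For these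
  two steps the sum over the intermediate partition is a product over the rows, and all rows but
  one contribute symmetric factors (\<open>kernel_isobaric\<close>). As long as \<open>w\<close> is not the longest permutation,
  a suitable ascent exists (\<open>exists_nested_ascent\<close>), so an induction reaches every permutation with nested
  columns. That the recursion defines a polynomial at all rests on the braid relations
  (\<open>grothendieck_rec_unique\<close>).

  The combinatorial half rests on the invariant \<open>i - r (i, j)\<close> of a square under both kinds of moves. It tells from
  which square of column \<open>j\<close> of the Rothe diagram the square stems, so each column splits into threads.
  The locale \<open>threaded\<close> describes the reachable diagrams in these terms, and \<open>reachable_threaded\<close> confirms
  the description by undoing moves. Counting, for all \<open>m\<close> and \<open>k\<close>, the columns whose \<open>k\<close>-th thread has
  its live square in the first \<open>m\<close> rows turns a bubbling diagram into a flagged chain of the same weight.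
  Conversely, a chain is spread over the columns in the order given by inclusion (\<open>chain_filling\<close>).
\<close>

section \<open>Polynomials and divided differences\<close>

lemma int_mpoly_induct [case_names single add]:
  fixes f :: int_mpoly
  assumes single: "\<And>m c. P (Poly_Mapping.single m c)"
    and add: "\<And>f g. P f \<Longrightarrow> P g \<Longrightarrow> P (f + g)"
  shows "P f"
proof -
  have sums: "finite A \<Longrightarrow> P (\<Sum>m\<in>A. Poly_Mapping.single m (Poly_Mapping.lookup f m))" for A
  proof (induction A rule: finite_induct)
    case empty
    then show ?case using single[of 0 0] by simp
  next
    case (insert m A)
    then show ?case by (simp add: single add)
  qed
  have "f = (\<Sum>m\<in>Poly_Mapping.keys f. Poly_Mapping.single m (Poly_Mapping.lookup f m))"
    by (rule poly_mapping_eqI) (simp add: lookup_sum lookup_single when_def in_keys_iff)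
  then show ?thesis using sums[of "Poly_Mapping.keys f"] by simp
qed

abbreviation swap_exponents :: "nat \<Rightarrow> monomial \<Rightarrow> monomial" where
  "swap_exponents j \<equiv> Poly_Mapping.map_key (transpose j (Suc j))"

lemma swap_vars_eq: "swap_vars j f = Poly_Mapping.map_key (swap_exponents j) f"
  by (simp add: swap_vars_def)

lemma swap_exponents_invol [simp]: "swap_exponents j (swap_exponents j m) = m"
  by (simp add: map_key_compose inj_transpose map_key_id comp_def)

lemma inj_swap_exponents: "inj (swap_exponents j)"
  by (metis injI swap_exponents_invol)

lemma swap_exponents_add:
  "swap_exponents j (m + m') = swap_exponents j m + swap_exponents j m'"
  by (simp add: map_key_plus inj_transpose)

lemma swap_vars_add: "swap_vars j (f + g) = swap_vars j f + swap_vars j g"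
  by (simp add: swap_vars_eq map_key_plus inj_swap_exponents)

lemma swap_vars_0 [simp]: "swap_vars j 0 = 0"
  using swap_vars_add[of j 0 0] by simp

lemma swap_vars_uminus: "swap_vars j (- f) = - swap_vars j f"
  using swap_vars_add[of j f "- f"] by (simp add: eq_neg_iff_add_eq_0 add.commute)

lemma swap_vars_diff: "swap_vars j (f - g) = swap_vars j f - swap_vars j g"
  using swap_vars_add[of j f "- g"] by (simp add: swap_vars_uminus)

lemma swap_vars_single [simp]:
  "swap_vars j (Poly_Mapping.single m c) = Poly_Mapping.single (swap_exponents j m) c"
  using map_key_single[OF inj_swap_exponents, of j "swap_exponents j m" c]
  by (simp only: swap_vars_eq swap_exponents_invol)

lemma swap_vars_mult: "swap_vars j (f * g) = swap_vars j f * swap_vars j g"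
proof (induction f rule: int_mpoly_induct)
  case (single m c)
  show ?case
    by (induction g rule: int_mpoly_induct)
      (simp_all only: mult_single swap_exponents_add swap_vars_add distrib_left swap_vars_single)
next
  case (add f1 f2)
  then show ?case by (simp add: distrib_right swap_vars_add)
qed

lemma swap_vars_1 [simp]: "swap_vars j 1 = 1"
  unfolding single_one[symmetric] swap_vars_single by (simp add: map_key_zero inj_transpose)

lemma swap_vars_power: "swap_vars j (f ^ k) = swap_vars j f ^ k"
  by (induction k) (simp_all add: swap_vars_mult)

lemma swap_vars_prod: "swap_vars j (prod f A) = (\<Prod>a\<in>A. swap_vars j (f a))"
  by (induction A rule: infinite_finite_induct) (simp_all add: swap_vars_mult)

lemma swap_vars_sum: "swap_vars j (sum f A) = (\<Sum>a\<in>A. swap_vars j (f a))"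
  by (induction A rule: infinite_finite_induct) (simp_all add: swap_vars_add)

lemma swap_vars_X: "swap_vars j (X i) = X (transpose j (Suc j) i)"
  using map_key_single[OF inj_transpose, of j "Suc j" "transpose j (Suc j) i" "1::nat"]
  by (simp add: X_def del: map_key_single)

lemma swap_vars_invol [simp]: "swap_vars j (swap_vars j f) = f"
  by (induction f rule: int_mpoly_induct) (simp_all add: swap_vars_add)

lemmas swap_vars_hom =
  swap_vars_add swap_vars_diff swap_vars_mult swap_vars_power swap_vars_prod swap_vars_sum

lemma X_eq_iff [simp]: "X i = X j \<longleftrightarrow> i = j"
proof
  assume "X i = X j"
  then have "Poly_Mapping.lookup (X i) (Poly_Mapping.single i 1) = Poly_Mapping.lookup (X j) (Poly_Mapping.single i 1)"
    by simp
  then have "Poly_Mapping.single j (1::nat) = Poly_Mapping.single i 1"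
    by (simp add: X_def lookup_single when_def split: if_splits)
  then show "i = j"
    by (metis lookup_single_eq lookup_single_not_eq zero_neq_one)
qed simp

lemma X_diff_nonzero: "i \<noteq> j \<Longrightarrow> X i - X j \<noteq> 0"
  by simp

text \<open>
  The polynomials with an exact quotient form a subring, because the difference
  \<open>f - swap_vars j f\<close> obeys a twisted product rule, and this subring contains all constants and
  all variables.
\<close>

lemma divided_diff_exists: "\<exists>g. (X j - X (Suc j)) * g = f - swap_vars j f"
proof -
  define Q where "Q f \<longleftrightarrow> (\<exists>g. (X j - X (Suc j)) * g = f - swap_vars j f)" for f
  have Q_add: "Q (f + g)" if fg: "Q f" "Q g" for f g
  proof -
    obtain f' g' where "(X j - X (Suc j)) * f' = f - swap_vars j f"
      "(X j - X (Suc j)) * g' = g - swap_vars j g"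
      using fg unfolding Q_def by blast
    then have "(X j - X (Suc j)) * (f' + g') = (f + g) - swap_vars j (f + g)"
      by (simp add: distrib_left swap_vars_add)
    then show ?thesis unfolding Q_def by blast
  qed
  have Q_mult: "Q (f * g)" if fg: "Q f" "Q g" for f g
  proof -
    obtain f' g' where *: "(X j - X (Suc j)) * f' = f - swap_vars j f"
      "(X j - X (Suc j)) * g' = g - swap_vars j g"
      using fg unfolding Q_def by blast
    have "(X j - X (Suc j)) * (f' * g + swap_vars j f * g')
        = (X j - X (Suc j)) * f' * g + swap_vars j f * ((X j - X (Suc j)) * g')"
      by (simp add: algebra_simps)
    also have "\<dots> = f * g - swap_vars j (f * g)"
      unfolding * by (simp add: algebra_simps swap_vars_mult)
    finally show ?thesis unfolding Q_def by blast
  qed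
  have Q_X: "Q (X i)" for i
  proof -
    consider "i = j" | "i = Suc j" | "i \<noteq> j" "i \<noteq> Suc j" by blast
    then show ?thesis
    proof cases
      case 1 then show ?thesis
        unfolding Q_def by (intro exI[of _ 1]) (simp add: swap_vars_X)
    next
      case 2 then show ?thesis
        unfolding Q_def by (intro exI[of _ "-1"]) (simp add: swap_vars_X)
    next
      case 3 then show ?thesis
        unfolding Q_def by (intro exI[of _ 0]) (simp add: swap_vars_X transpose_def)
    qed
  qed
  have Q_const: "Q (Poly_Mapping.single 0 c)" for c
    unfolding Q_def by (intro exI[of _ 0]) (simp add: inj_transpose)
  have Q_power: "Q (X i ^ k)" for i k
    by (induction k) (use Q_const[of 1] Q_mult Q_X in auto)
  have single_power: "Poly_Mapping.single (Poly_Mapping.single i k) 1 = X i ^ k" for i k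
  proof (induction k)
    case (Suc k)
    have "Poly_Mapping.single i (Suc k) = Poly_Mapping.single i 1 + Poly_Mapping.single i k"
      by (simp add: single_add[symmetric])
    then have "Poly_Mapping.single (Poly_Mapping.single i (Suc k)) (1::int)
        = X i * Poly_Mapping.single (Poly_Mapping.single i k) 1"
      by (simp add: X_def mult_single)
    then show ?case using Suc by simp
  qed simp
  have Q_single: "Q (Poly_Mapping.single m 1)" for m :: monomial
  proof (induction m rule: update_induct)
    case const
    show ?case using Q_const[of 1] by simp
  next
    case (update m i k)
    have "Poly_Mapping.update i k m = m + Poly_Mapping.single i k"
      using update(1)
      by (intro poly_mapping_eqI) (auto simp: lookup_update lookup_add lookup_single when_def
          not_in_keys_iff_lookup_eq_zero)
    then have "Poly_Mapping.single (Poly_Mapping.update i k m) 1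
        = Poly_Mapping.single m 1 * (X i ^ k)"
      by (simp add: single_power[symmetric] mult_single)
    then show ?case using update Q_mult Q_power by simp
  qed
  have "Q f"
  proof (induction f rule: int_mpoly_induct)
    case (single m c)
    have "Poly_Mapping.single m c = Poly_Mapping.single 0 c * Poly_Mapping.single m 1"
      by (simp add: mult_single)
    then show ?case using Q_mult[OF Q_const Q_single] by simp
  qed (rule Q_add)
  then show ?thesis unfolding Q_def .
qed

lemma divided_diff_eqI:
  assumes "(X j - X (Suc j)) * g = f - swap_vars j f"
  shows "divided_diff j f = g"
  unfolding divided_diff_def Suc_eq_plus1[symmetric]
proof (rule the_equality)
  fix h
  assume "(X j - X (Suc j)) * h = f - swap_vars j f"
  then have "(X j - X (Suc j)) * h = (X j - X (Suc j)) * g" using assms by simp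
  then show "h = g" using X_diff_nonzero[of j "Suc j"] by simp
qed (rule assms)

text \<open>
  The graph of \<^const>\<open>isobaric_divided_diff\<close> with the denominator cleared, so that no quotient has
  to be computed.
\<close>

definition is_isobaric :: "nat \<Rightarrow> int_mpoly \<Rightarrow> int_mpoly \<Rightarrow> bool" where
  "is_isobaric j f g \<longleftrightarrow>
     (X j - X (Suc j)) * g = (1 - X (Suc j)) * f - (1 - X j) * swap_vars j f"

lemma is_isobaric_iff: "is_isobaric j f g \<longleftrightarrow> isobaric_divided_diff j f = g"
proof -
  have eq: "f - X (Suc j) * f - swap_vars j (f - X (Suc j) * f)
      = (1 - X (Suc j)) * f - (1 - X j) * swap_vars j f"
    by (simp add: swap_vars_diff swap_vars_mult swap_vars_X algebra_simps)
  obtain g' where g': "(X j - X (Suc j)) * g'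
      = f - X (Suc j) * f - swap_vars j (f - X (Suc j) * f)"
    using divided_diff_exists by blast
  have "isobaric_divided_diff j f = g'"
    using divided_diff_eqI[OF g'] by (simp add: isobaric_divided_diff_def)
  moreover have "is_isobaric j f g \<longleftrightarrow> g = g'"
    unfolding is_isobaric_def eq[symmetric] g'[symmetric] by simp
  ultimately show ?thesis by auto
qed

lemma swap_vars_commute:
  assumes "i + 1 < j"
  shows "swap_vars i (swap_vars j f) = swap_vars j (swap_vars i f)"
proof -
  have "transpose i (Suc i) \<circ> transpose j (Suc j) = transpose j (Suc j) \<circ> transpose i (Suc i)"
    using assms by (auto simp: fun_eq_iff transpose_def)
  then show ?thesis
    by (induction f rule: int_mpoly_induct)
      (simp_all add: swap_vars_add map_key_compose inj_transpose)
qed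

lemma swap_vars_braid:
  "swap_vars i (swap_vars (Suc i) (swap_vars i f))
   = swap_vars (Suc i) (swap_vars i (swap_vars (Suc i) f))"
proof -
  have "transpose i (Suc i) \<circ> (transpose (Suc i) (Suc (Suc i)) \<circ> transpose i (Suc i))
      = transpose (Suc i) (Suc (Suc i)) \<circ> (transpose i (Suc i) \<circ> transpose (Suc i) (Suc (Suc i)))"
    by (auto simp: fun_eq_iff transpose_def)
  then show ?thesis
    by (induction f rule: int_mpoly_induct)
      (simp_all add: swap_vars_add map_key_compose inj_transpose o_assoc inj_compose)
qed

lemma is_isobaric_symmetric:
  assumes "is_isobaric j f g"
  shows "swap_vars j g = g"
proof -
  have "swap_vars j ((X j - X (Suc j)) * g)
      = swap_vars j ((1 - X (Suc j)) * f - (1 - X j) * swap_vars j f)"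
    using assms by (simp add: is_isobaric_def)
  then have "(X (Suc j) - X j) * swap_vars j g
      = (1 - X j) * swap_vars j f - (1 - X (Suc j)) * f"
    by (simp add: swap_vars_hom swap_vars_X)
  moreover have "(X j - X (Suc j)) * swap_vars j g = - ((X (Suc j) - X j) * swap_vars j g)"
    by (simp add: algebra_simps)
  ultimately have "(X j - X (Suc j)) * swap_vars j g = (X j - X (Suc j)) * g"
    using assms by (simp add: is_isobaric_def)
  then show ?thesis by simp
qed

lemma isobaric_divided_diff_commute:
  assumes "Suc i < j"
  shows "isobaric_divided_diff i (isobaric_divided_diff j f)
    = isobaric_divided_diff j (isobaric_divided_diff i f)"
proof -
  define g h u where "g = isobaric_divided_diff i f" and "h = isobaric_divided_diff j f"
    and "u = isobaric_divided_diff j g"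
  have g: "is_isobaric i f g" and h: "is_isobaric j f h" and u: "is_isobaric j g u"
    by (simp_all add: g_def h_def u_def is_isobaric_iff)
  let ?a = "X i" and ?b = "X (Suc i)" and ?c = "X j" and ?d = "X (Suc j)"
  have g0: "(?a - ?b) * g = (1 - ?b) * f - (1 - ?a) * swap_vars i f"
    using g by (simp add: is_isobaric_def)
  have g1: "(?a - ?b) * swap_vars j g
      = (1 - ?b) * swap_vars j f - (1 - ?a) * swap_vars j (swap_vars i f)"
    using arg_cong[OF g0, of "swap_vars j"] assms
    by (simp add: swap_vars_hom swap_vars_X transpose_def)
  have h0: "(?c - ?d) * h = (1 - ?d) * f - (1 - ?c) * swap_vars j f"
    using h by (simp add: is_isobaric_def)
  have h1: "(?c - ?d) * swap_vars i h
      = (1 - ?d) * swap_vars i f - (1 - ?c) * swap_vars j (swap_vars i f)"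
    using arg_cong[OF h0, of "swap_vars i"] assms
    by (simp add: swap_vars_hom swap_vars_X transpose_def swap_vars_commute[of i j])
  have u0: "(?c - ?d) * u = (1 - ?d) * g - (1 - ?c) * swap_vars j g"
    using u by (simp add: is_isobaric_def)
  have "(?c - ?d) * ((?a - ?b) * u)
      = (1 - ?d) * ((?a - ?b) * g) - (1 - ?c) * ((?a - ?b) * swap_vars j g)"
    unfolding mult.left_commute[of "?c - ?d"] u0 by (simp add: algebra_simps)
  also have "\<dots> = (1 - ?b) * ((?c - ?d) * h) - (1 - ?a) * ((?c - ?d) * swap_vars i h)"
    unfolding g0 g1 h0 h1 by (simp add: algebra_simps)
  also have "\<dots> = (?c - ?d) * ((1 - ?b) * h - (1 - ?a) * swap_vars i h)"
    by (simp add: algebra_simps)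
  finally have "is_isobaric i h u" by (simp add: is_isobaric_def)
  then show ?thesis by (simp add: is_isobaric_iff g_def h_def u_def)
qed

lemma isobaric_divided_diff_braid:
  "isobaric_divided_diff i (isobaric_divided_diff (Suc i) (isobaric_divided_diff i f))
   = isobaric_divided_diff (Suc i) (isobaric_divided_diff i (isobaric_divided_diff (Suc i) f))"
proof -
  let ?s = "swap_vars i" and ?t = "swap_vars (Suc i)"
  define g1 g2 g3 where "g1 = isobaric_divided_diff i f"
    and "g2 = isobaric_divided_diff (Suc i) g1" and "g3 = isobaric_divided_diff i g2"
  define h1 h2 h3 where "h1 = isobaric_divided_diff (Suc i) f"
    and "h2 = isobaric_divided_diff i h1" and "h3 = isobaric_divided_diff (Suc i) h2"
  define x y z where "x = X i" and "y = X (Suc i)" and "z = X (Suc (Suc i))"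
  have swaps [simp]: "?s x = y" "?s y = x" "?s z = z" "?t x = x" "?t y = z" "?t z = y"
    by (simp_all add: x_def y_def z_def swap_vars_X transpose_def)
  have g: "is_isobaric i f g1" "is_isobaric (Suc i) g1 g2" "is_isobaric i g2 g3"
    by (simp_all add: g1_def g2_def g3_def is_isobaric_iff)
  have h: "is_isobaric (Suc i) f h1" "is_isobaric i h1 h2" "is_isobaric (Suc i) h2 h3"
    by (simp_all add: h1_def h2_def h3_def is_isobaric_iff)
  have ge: "(x - y) * g1 = (1 - y) * f - (1 - x) * ?s f"
     "(y - z) * g2 = (1 - z) * g1 - (1 - y) * ?t g1"
     "(x - y) * g3 = (1 - y) * g2 - (1 - x) * ?s g2"
    using g by (simp_all add: is_isobaric_def x_def y_def z_def)
  have he: "(y - z) * h1 = (1 - z) * f - (1 - y) * ?t f"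
     "(x - y) * h2 = (1 - y) * h1 - (1 - x) * ?s h1"
     "(y - z) * h3 = (1 - z) * h2 - (1 - y) * ?t h2"
    using h by (simp_all add: is_isobaric_def x_def y_def z_def)
  have A: "(x - z) * ?t g1 = (1 - z) * ?t f - (1 - x) * ?t (?s f)"
    using arg_cong[OF ge(1), of ?t] by (simp add: swap_vars_hom)
  have A1: "(y - z) * ?s (?t g1) = (1 - z) * ?s (?t f) - (1 - y) * ?s (?t (?s f))"
    using arg_cong[OF A, of ?s] by (simp add: swap_vars_hom)
  have B: "(x - z) * ?s g2 = (1 - z) * g1 - (1 - x) * ?s (?t g1)"
    using arg_cong[OF ge(2), of ?s] is_isobaric_symmetric[OF g(1)] by (simp add: swap_vars_hom)
  have A': "(x - z) * ?s h1 = (1 - z) * ?s f - (1 - x) * ?s (?t f)"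
    using arg_cong[OF he(1), of ?s] by (simp add: swap_vars_hom)
  have A1': "(x - y) * ?t (?s h1) = (1 - y) * ?t (?s f) - (1 - x) * ?s (?t (?s f))"
    using arg_cong[OF A', of ?t] by (simp add: swap_vars_hom swap_vars_braid)
  have B': "(x - z) * ?t h2 = (1 - z) * h1 - (1 - x) * ?t (?s h1)"
    using arg_cong[OF he(2), of ?t] is_isobaric_symmetric[OF h(1)] by (simp add: swap_vars_hom)
  \<comment> \<open>Both sides are the antisymmetrisation of \<open>(1 - y) (1 - z)\<^sup>2 f\<close> divided by the Vandermonde
      product.\<close>
  define E where "E = (1-z)^2*(1-y)*f - (1-z)^2*(1-x)*?s f - (1-y)^2*(1-z)*?t f
     + (1-y)^2*(1-x)*?t (?s f) + (1-x)^2*(1-z)*?s (?t f) - (1-x)^2*(1-y)*?s (?t (?s f))"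
  have "(y - z) * ((x - z) * ((x - y) * g3))
      = (1-y)*(x-z)*((y-z)*g2) - (1-x)*(y-z)*((x-z)*?s g2)"
    unfolding ge(3) by (simp add: algebra_simps)
  also have "\<dots> = (1-z)^2*((x-y)*g1) - (1-y)^2*((x-z)*?t g1) + (1-x)^2*((y-z)*?s (?t g1))"
    unfolding ge(2) B by (simp add: algebra_simps power2_eq_square)
  also have "\<dots> = E"
    unfolding ge(1) A A1 E_def by (simp add: algebra_simps power2_eq_square)
  finally have 1: "(y - z) * ((x - z) * ((x - y) * g3)) = E" .
  have "(x - y) * ((x - z) * ((y - z) * h3))
      = (1-z)*(x-z)*((x-y)*h2) - (1-y)*(x-y)*((x-z)*?t h2)"
    unfolding he(3) by (simp add: algebra_simps)
  also have "\<dots> = (1-y)*(1-z)*((y-z)*h1) - (1-z)*(1-x)*((x-z)*?s h1)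
      + (1-y)*(1-x)*((x-y)*?t (?s h1))"
    unfolding he(2) B' by (simp add: algebra_simps)
  also have "\<dots> = E"
    unfolding he(1) A' A1' E_def by (simp add: algebra_simps power2_eq_square)
  finally have "(y - z) * ((x - z) * ((x - y) * h3)) = E" by (simp add: ac_simps)
  with 1 have "(y - z) * ((x - z) * ((x - y) * g3)) = (y - z) * ((x - z) * ((x - y) * h3))"
    by simp
  then have "g3 = h3" by (simp add: x_def y_def z_def)
  then show ?thesis
    by (simp add: g1_def g2_def g3_def h1_def h2_def h3_def)
qed

section \<open>Independence of the recursion from the chosen ascents\<close>

definition noninversions :: "nat \<Rightarrow> (nat \<Rightarrow> nat) \<Rightarrow> (nat \<times> nat) set" where
  "noninversions n w = {(p, q). 1 \<le> p \<and> p < q \<and> q \<le> n \<and> w p < w q}"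

lemma finite_noninversions [simp]: "finite (noninversions n w)"
  by (rule finite_subset[of _ "{1..n} \<times> {1..n}"]) (auto simp: noninversions_def)

lemma card_noninversions_ascent:
  assumes "1 \<le> j" "j < n" "w j < w (Suc j)"
  shows "card (noninversions n (w \<circ> transpose j (Suc j))) < card (noninversions n w)"
proof -
  let ?t = "transpose j (Suc j)"
  have "(?t p, ?t q) \<in> noninversions n w - {(j, Suc j)}"
    if pq: "(p, q) \<in> noninversions n (w \<circ> ?t)" for p q
  proof -
    have pq': "1 \<le> p" "p < q" "q \<le> n" "w (?t p) < w (?t q)"
      using pq by (simp_all add: noninversions_def)
    have "\<not> (p = j \<and> q = Suc j)" using pq'(4) assms(3) by auto
    then have "?t p < ?t q" using pq'(2) by (auto simp: transpose_def)
    moreover have "?t p \<ge> 1" "?t q \<le> n" using pq' assms by (auto simp: transpose_def)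
    moreover have "(?t p, ?t q) \<noteq> (j, Suc j)" using pq'(2) by (auto simp: transpose_def)
    ultimately show ?thesis using pq'(4) by (simp add: noninversions_def)
  qed
  then have "map_prod ?t ?t ` noninversions n (w \<circ> ?t) \<subseteq> noninversions n w - {(j, Suc j)}"
    by auto
  then have "card (map_prod ?t ?t ` noninversions n (w \<circ> ?t))
      \<le> card (noninversions n w - {(j, Suc j)})"
    by (intro card_mono) auto
  moreover have "inj (map_prod ?t ?t)"
    using inj_transpose[of j "Suc j"] prod.inj_map by blast
  moreover have "(j, Suc j) \<in> noninversions n w"
    using assms by (auto simp: noninversions_def)
  ultimately show ?thesis
    by (metis card_Diff1_less card_image finite_noninversions inj_on_subset order_le_less_trans
        subset_UNIV)
qed

text \<open>
  Descents force \<open>w i \<le> n + 1 - i\<close> when counted from the left end and \<open>w i \<ge> n + 1 - i\<close> when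
  counted from the right end.
\<close>

lemma no_ascent_longest_perm:
  assumes w: "w permutes {1..n}" and no: "\<And>j. 1 \<le> j \<Longrightarrow> j < n \<Longrightarrow> \<not> w j < w (Suc j)"
  shows "w = longest_perm n"
proof -
  have desc: "w (Suc j) < w j" if "1 \<le> j" "j < n" for j
    using no[OF that] permutes_inj[OF w] by (metis inj_eq linorder_neqE_nat n_not_Suc_n)
  have up: "w i \<le> n + 1 - i" if "i \<in> {1..n}" for i
    using that
  proof (induction i)
    case (Suc i)
    then show ?case
      using desc[of i] permutes_in_image[OF w, of 1] by (cases "i = 0") auto
  qed simp
  have lo: "n + 1 - i \<le> w i" if "i \<in> {1..n}" for i
    using that
  proof (induction "n - i" arbitrary: i)
    case 0
    then show ?case using permutes_in_image[OF w, of i] by auto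
  next
    case (Suc k)
    then have "n + 1 - Suc i \<le> w (Suc i)" by (intro Suc.hyps(1)) auto
    moreover have "w (Suc i) < w i" using Suc by (intro desc) auto
    ultimately show ?case by linarith
  qed
  show ?thesis
  proof
    fix i
    show "w i = longest_perm n i"
      using up[of i] lo[of i] permutes_not_in[OF w, of i] by (auto simp: longest_perm_def)
  qed
qed

lemma longest_perm_descent:
  "1 \<le> j \<Longrightarrow> j < n \<Longrightarrow> longest_perm n (Suc j) < longest_perm n j"
  by (auto simp: longest_perm_def)

lemma permutes_swap_step:
  assumes "w permutes {1..n}" "1 \<le> j" "j < n"
  shows "w \<circ> transpose j (Suc j) permutes {1..n}"
  using assms by (intro permutes_compose[OF permutes_swap_id]) auto

lemma grothendieck_rec_ascentI:
  assumes "w permutes {1..n}" "1 \<le> j" "j < n" "w j < w (Suc j)"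
    "grothendieck_rec n (w \<circ> transpose j (Suc j)) f"
  shows "grothendieck_rec n w (isobaric_divided_diff j f)"
  using assms grothendieck_rec.ascent[of w n j f] by simp

lemma grothendieck_rec_exists:
  "w permutes {1..n} \<Longrightarrow> \<exists>f. grothendieck_rec n w f"
proof (induction "card (noninversions n w)" arbitrary: w rule: less_induct)
  case less
  show ?case
  proof (cases "w = longest_perm n")
    case True
    then show ?thesis using grothendieck_rec.longest by blast
  next
    case False
    then obtain j where j: "1 \<le> j" "j < n" "w j < w (Suc j)"
      using no_ascent_longest_perm[OF less.prems] by blast
    then obtain f where "grothendieck_rec n (w \<circ> transpose j (Suc j)) f"
      using less.hyps[OF card_noninversions_ascent[OF j]] permutes_swap_step[OF less.prems] by blast
    then show ?thesis using grothendieck_rec_ascentI[OF less.prems j] by blast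
  qed
qed

text \<open>
  By induction on the number of noninversions: two ascents of \<open>w\<close> lead to two shorter problems, and
  these meet again in a common permutation, over the commutation relation if the ascents are far
  apart and over the braid relation if they are adjacent.
\<close>

lemma grothendieck_rec_unique:
  "w permutes {1..n} \<Longrightarrow> grothendieck_rec n w f \<Longrightarrow> grothendieck_rec n w g \<Longrightarrow> f = g"
proof (induction "card (noninversions n w)" arbitrary: w f g rule: less_induct)
  case less
  note w = less.prems(1)
  have cases: "(w = longest_perm n \<and> h = (\<Prod>i = 1..n. X i ^ (n - i))) \<or>
      (\<exists>j h'. 1 \<le> j \<and> j < n \<and> w j < w (Suc j) \<and> h = isobaric_divided_diff j h' \<and>
        grothendieck_rec n (w \<circ> transpose j (Suc j)) h')" if "grothendieck_rec n w h" for h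
    using that by (cases rule: grothendieck_rec.cases) auto
  have longest: "h = (\<Prod>i = 1..n. X i ^ (n - i))"
    if "grothendieck_rec n w h" "w = longest_perm n" for h
    using cases[OF that(1)] that(2) longest_perm_descent by (metis order_less_asym)
  have confluent: "isobaric_divided_diff i f' = isobaric_divided_diff j g'"
    if i: "1 \<le> i" "w i < w (Suc i)" "grothendieck_rec n (w \<circ> transpose i (Suc i)) f'"
      and j: "j < n" "w j < w (Suc j)" "grothendieck_rec n (w \<circ> transpose j (Suc j)) g'"
      and le: "i \<le> j" for i j f' g'
  proof -
    let ?wi = "w \<circ> transpose i (Suc i)" and ?wj = "w \<circ> transpose j (Suc j)"
    have wi: "?wi permutes {1..n}" and wj: "?wj permutes {1..n}"
      using i j le permutes_swap_step[OF w] by auto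
    have smaller: "card (noninversions n ?wi) < card (noninversions n w)"
      "card (noninversions n ?wj) < card (noninversions n w)"
      using i j le by (auto intro: card_noninversions_ascent)
    consider "i = j" | "Suc i = j" | "Suc i < j" using le by linarith
    then show ?thesis
    proof cases
      case 1
      then show ?thesis using less.hyps[OF smaller(1) wi i(3)] j(3) by simp
    next
      case 2
      let ?wji = "?wi \<circ> transpose j (Suc j)" and ?wij = "?wj \<circ> transpose i (Suc i)"
      let ?u = "?wji \<circ> transpose i (Suc i)"
      have ueq: "?u = ?wij \<circ> transpose j (Suc j)"
        using 2 by (auto simp: fun_eq_iff transpose_def)
      have p: "?wji permutes {1..n}" "?wij permutes {1..n}"
        using i j le permutes_swap_step[OF wi] permutes_swap_step[OF wj] by auto
      have "?u permutes {1..n}"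
        using i j le permutes_swap_step[OF p(1)] by auto
      then obtain h where h: "grothendieck_rec n ?u h"
        using grothendieck_rec_exists by blast
      have h1: "grothendieck_rec n ?wji (isobaric_divided_diff i h)"
        using i j le 2 by (intro grothendieck_rec_ascentI p h) (auto simp: transpose_def)
      have "grothendieck_rec n ?wi (isobaric_divided_diff j (isobaric_divided_diff i h))"
        using i j le 2 by (intro grothendieck_rec_ascentI wi h1) (auto simp: transpose_def)
      then have f': "f' = isobaric_divided_diff j (isobaric_divided_diff i h)"
        using less.hyps[OF smaller(1) wi i(3)] by simp
      have h2: "grothendieck_rec n ?wij (isobaric_divided_diff j h)"
        using i j le 2 h unfolding ueq
        by (intro grothendieck_rec_ascentI p) (auto simp: transpose_def)
      have "grothendieck_rec n ?wj (isobaric_divided_diff i (isobaric_divided_diff j h))"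
        using i j le 2 by (intro grothendieck_rec_ascentI wj h2) (auto simp: transpose_def)
      then have "g' = isobaric_divided_diff i (isobaric_divided_diff j h)"
        using less.hyps[OF smaller(2) wj j(3)] by simp
      then show ?thesis using f' isobaric_divided_diff_braid[of i h] unfolding 2 by (simp only:)
    next
      case 3
      let ?u = "?wi \<circ> transpose j (Suc j)"
      have ueq: "?u = ?wj \<circ> transpose i (Suc i)"
        using 3 by (auto simp: fun_eq_iff transpose_def)
      have "?u permutes {1..n}"
        using i j le permutes_swap_step[OF wi] by auto
      then obtain h where h: "grothendieck_rec n ?u h"
        using grothendieck_rec_exists by blast
      have "grothendieck_rec n ?wi (isobaric_divided_diff j h)"
        using i j le 3 by (intro grothendieck_rec_ascentI wi h) (auto simp: transpose_def)
      then have f': "f' = isobaric_divided_diff j h"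
        using less.hyps[OF smaller(1) wi i(3)] by simp
      have "grothendieck_rec n ?wj (isobaric_divided_diff i h)"
        using i j le 3 h unfolding ueq
        by (intro grothendieck_rec_ascentI wj) (auto simp: transpose_def)
      then have "g' = isobaric_divided_diff i h"
        using less.hyps[OF smaller(2) wj j(3)] by simp
      then show ?thesis using f' isobaric_divided_diff_commute[OF 3] by simp
    qed
  qed
  show ?case
  proof (cases "w = longest_perm n")
    case True
    show ?thesis
      using longest[OF less.prems(2) True] longest[OF less.prems(3) True] by (simp only:)
  next
    case False
    obtain i f' where i: "1 \<le> i" "i < n" "w i < w (Suc i)"
      and f: "f = isobaric_divided_diff i f'" "grothendieck_rec n (w \<circ> transpose i (Suc i)) f'"
      using cases[OF less.prems(2)] False by blast
    obtain j g' where j: "1 \<le> j" "j < n" "w j < w (Suc j)"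
      and g: "g = isobaric_divided_diff j g'" "grothendieck_rec n (w \<circ> transpose j (Suc j)) g'"
      using cases[OF less.prems(3)] False by blast
    show ?thesis
    proof (cases "i \<le> j")
      case True
      show ?thesis
        unfolding f(1) g(1) by (rule confluent[OF i(1) i(3) f(2) j(2) j(3) g(2) True])
    next
      case False
      then have "j \<le> i" by simp
      show ?thesis
        unfolding f(1) g(1)
        by (rule confluent[OF j(1) j(3) g(2) i(2) i(3) f(2) \<open>j \<le> i\<close>, symmetric])
    qed
  qed
qed

lemma grothendieck_eqI:
  assumes "w permutes {1..n}" "grothendieck_rec n w f"
  shows "grothendieck n w = f"
  unfolding grothendieck_def using assms grothendieck_rec_unique by (intro the_equality) blast+

section \<open>Horizontal strips with flags\<close>

lemma finite_boxes:
  fixes lo hi :: "nat \<Rightarrow> nat"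
  assumes "\<And>r. r > N \<Longrightarrow> hi r = 0"
  shows "finite {\<kappa>. \<forall>r. lo r \<le> \<kappa> r \<and> \<kappa> r \<le> hi r}"
proof (rule finite_subset)
  show "{\<kappa>. \<forall>r. lo r \<le> \<kappa> r \<and> \<kappa> r \<le> hi r}
      \<subseteq> {\<kappa>. \<forall>r. (r \<in> {..N} \<longrightarrow> \<kappa> r \<in> {..Max (hi ` {..N})}) \<and> (r \<notin> {..N} \<longrightarrow> \<kappa> r = 0)}"
    using assms by (auto simp: not_le) (metis Max_ge atMost_iff finite_atMost finite_imageI
        image_eqI le_trans, metis le_zero_eq)
qed (intro finite_set_of_finite_funs finite_atMost)

text \<open>
  A partition is a function on row indices. A sum over all functions between two bounds of a product
  over the rows is a product of sums, one for each row.
\<close>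

lemma sum_boxes_prod:
  fixes f :: "nat \<Rightarrow> nat \<Rightarrow> 'a :: comm_ring_1"
  assumes lo: "\<And>r. r > N \<Longrightarrow> lo r = 0" and hi: "\<And>r. r > N \<Longrightarrow> hi r = 0"
  shows "(\<Sum>\<kappa> | \<forall>r. lo r \<le> \<kappa> r \<and> \<kappa> r \<le> hi r. \<Prod>r\<le>N. f r (\<kappa> r))
    = (\<Prod>r\<le>N. \<Sum>c = lo r..hi r. f r c)"
proof -
  have "(\<Prod>r\<le>N. \<Sum>c = lo r..hi r. f r c)
      = (\<Sum>g\<in>PiE {..N} (\<lambda>r. {lo r..hi r}). \<Prod>r\<le>N. f r (g r))"
    by (rule prod_sum_PiE) auto
  also have "\<dots> = (\<Sum>\<kappa> | \<forall>r. lo r \<le> \<kappa> r \<and> \<kappa> r \<le> hi r. \<Prod>r\<le>N. f r (\<kappa> r))"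
  proof (rule sum.reindex_bij_witness[of _ "\<lambda>\<kappa>. restrict \<kappa> {..N}" "\<lambda>g r. if r \<le> N then g r else 0"])
    fix \<kappa> assume "\<kappa> \<in> {\<kappa>. \<forall>r. lo r \<le> \<kappa> r \<and> \<kappa> r \<le> hi r}"
    then have *: "\<kappa> r \<le> hi r" "lo r \<le> \<kappa> r" for r by auto
    show "(\<lambda>r. if r \<le> N then restrict \<kappa> {..N} r else 0) = \<kappa>"
    proof
      fix r show "(if r \<le> N then restrict \<kappa> {..N} r else 0) = \<kappa> r"
        using *[of r] hi[of r] by auto
    qed
    show "restrict \<kappa> {..N} \<in> PiE {..N} (\<lambda>r. {lo r..hi r})" using * by auto
  qed (use lo hi in \<open>auto simp: PiE_def extensional_def fun_eq_iff Pi_def not_le\<close>)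
  finally show ?thesis ..
qed

text \<open>
  The skew shape \<open>\<nu>/\<mu>\<close> has at most one box in each column. In the flags of a permutation
  row \<open>0\<close> is constant: it records the number of available columns, which makes the first genuine row an instance of the general one.
\<close>

definition horizontal_strip :: "(nat \<Rightarrow> nat) \<Rightarrow> (nat \<Rightarrow> nat) \<Rightarrow> bool" where
  "horizontal_strip \<mu> \<nu> \<longleftrightarrow> (\<forall>r. \<mu> r \<le> \<nu> r \<and> \<nu> (Suc r) \<le> \<mu> r)"

text \<open>
  The boxes of the strip receive the variable \<open>x\<close>. In a set-valued tableau the last box of a row of
  \<open>\<mu>\<close> may receive the current entry in addition to its smaller ones, which contributes the factor
  \<open>1 - x\<close>; the box below it must still be empty, and the flag \<open>\<rho>\<close> must not have closed it already.
\<close>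

definition strip_weight ::
  "nat \<Rightarrow> 'a \<Rightarrow> (nat \<Rightarrow> nat) \<Rightarrow> (nat \<Rightarrow> nat) \<Rightarrow> (nat \<Rightarrow> nat) \<Rightarrow> 'a :: comm_ring_1" where
  "strip_weight N x \<rho> \<mu> \<nu> = (if horizontal_strip \<mu> \<nu>
     then \<Prod>r\<le>N. x ^ (\<nu> r - \<mu> r) * (1 - x) ^ of_bool (\<nu> (Suc r) < \<mu> r \<and> \<rho> r < \<mu> r)
     else 0)"

text \<open>
  In two consecutive strips \<open>\<mu> \<subseteq> \<kappa> \<subseteq> \<nu>\<close> with weights in \<open>x\<close> and \<open>y\<close>, the part that depends on
  the length \<open>c\<close> of row \<open>r\<close> of \<open>\<kappa>\<close>. The factor for the additional entry in row \<open>q\<close> of the first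
  strip depends on row \<open>q + 1\<close> of \<open>\<kappa>\<close>, hence the shift of its index.
\<close>

definition row_term where
  "row_term x y \<rho> \<sigma> \<mu> \<nu> r c =
    (if \<mu> r \<le> c \<and> c \<le> \<nu> r \<and> \<nu> (Suc r) \<le> c \<and> (\<forall>q. r = Suc q \<longrightarrow> c \<le> \<mu> q)
     then x ^ (c - \<mu> r) * y ^ (\<nu> r - c) * (1 - y) ^ of_bool (\<nu> (Suc r) < c \<and> \<sigma> r < c)
       * (case r of 0 \<Rightarrow> 1 | Suc q \<Rightarrow> (1 - x) ^ of_bool (c < \<mu> q \<and> \<rho> q < \<mu> q))
     else (0 :: 'a :: comm_ring_1))"

lemma prod_atMost_shift:
  fixes g :: "nat \<Rightarrow> 'a :: comm_ring_1"
  assumes "g N = 1"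
  shows "(\<Prod>r\<le>N. g r) = (\<Prod>r\<le>N. case r of 0 \<Rightarrow> 1 | Suc q \<Rightarrow> g q)"
proof -
  have "(\<Prod>r\<le>N. case r of 0 \<Rightarrow> 1 | Suc q \<Rightarrow> g q) = (\<Prod>r<N. g r)"
    by (subst prod.atMost_shift) simp
  moreover have "(\<Prod>r\<le>N. g r) = (\<Prod>r<N. g r) * g N"
    by (simp add: lessThan_Suc_atMost[symmetric])
  ultimately show ?thesis using assms by simp
qed

lemma two_strips_eq_row_terms:
  fixes x y :: "'a :: comm_ring_1"
  assumes \<mu>: "\<And>r. r \<ge> N \<Longrightarrow> \<mu> r = 0" and \<nu>: "\<And>r. r \<ge> N \<Longrightarrow> \<nu> r = 0"
    and \<kappa>: "\<And>r. r \<ge> N \<Longrightarrow> \<kappa> r = 0"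
  shows "strip_weight N x \<rho> \<mu> \<kappa> * strip_weight N y \<sigma> \<kappa> \<nu>
    = (\<Prod>r\<le>N. row_term x y \<rho> \<sigma> \<mu> \<nu> r (\<kappa> r))"
proof -
  let ?ok = "\<lambda>r. \<mu> r \<le> \<kappa> r \<and> \<kappa> r \<le> \<nu> r \<and> \<nu> (Suc r) \<le> \<kappa> r \<and> (\<forall>q. r = Suc q \<longrightarrow> \<kappa> r \<le> \<mu> q)"
  have ok: "horizontal_strip \<mu> \<kappa> \<and> horizontal_strip \<kappa> \<nu> \<longleftrightarrow> (\<forall>r. ?ok r)"
    unfolding horizontal_strip_def by (auto dest: not0_implies_Suc)
  also have "\<dots> \<longleftrightarrow> (\<forall>r\<le>N. ?ok r)"
  proof (intro iffI allI)
    fix r assume *: "\<forall>r\<le>N. ?ok r"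
    show "?ok r" using * \<mu>[of r] \<nu>[of r] \<nu>[of "Suc r"] \<kappa>[of r] by (cases "r \<le> N") auto
  qed blast
  finally have ok: "horizontal_strip \<mu> \<kappa> \<and> horizontal_strip \<kappa> \<nu> \<longleftrightarrow> (\<forall>r\<le>N. ?ok r)" .
  show ?thesis
  proof (cases "\<forall>r\<le>N. ?ok r")
    case False
    then obtain r where "r \<le> N" "\<not> ?ok r" by blast
    then have "r \<in> {..N}" "row_term x y \<rho> \<sigma> \<mu> \<nu> r (\<kappa> r) = 0"
      unfolding row_term_def by (simp, intro if_not_P)
    then have "(\<Prod>r\<le>N. row_term x y \<rho> \<sigma> \<mu> \<nu> r (\<kappa> r)) = 0"
      by (intro prod_zero bexI[of _ r]) simp_all
    moreover have "strip_weight N x \<rho> \<mu> \<kappa> * strip_weight N y \<sigma> \<kappa> \<nu> = 0"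
      using False ok by (auto simp: strip_weight_def)
    ultimately show ?thesis by simp
  next
    case True
    have "(\<Prod>r\<le>N. (1 - x) ^ of_bool (\<kappa> (Suc r) < \<mu> r \<and> \<rho> r < \<mu> r))
        = (\<Prod>r\<le>N. case r of 0 \<Rightarrow> 1
             | Suc q \<Rightarrow> (1 - x) ^ of_bool (\<kappa> (Suc q) < \<mu> q \<and> \<rho> q < \<mu> q))"
      using \<mu>[of N] by (subst prod_atMost_shift) auto
    also have "\<dots> = (\<Prod>r\<le>N. case r of 0 \<Rightarrow> 1
             | Suc q \<Rightarrow> (1 - x) ^ of_bool (\<kappa> r < \<mu> q \<and> \<rho> q < \<mu> q))"
      by (intro prod.cong refl) (simp split: nat.split)
    finally have shift: "(\<Prod>r\<le>N. (1 - x) ^ of_bool (\<kappa> (Suc r) < \<mu> r \<and> \<rho> r < \<mu> r)) = \<dots>" .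
    have "strip_weight N x \<rho> \<mu> \<kappa> * strip_weight N y \<sigma> \<kappa> \<nu>
      = (\<Prod>r\<le>N. x ^ (\<kappa> r - \<mu> r)) * (\<Prod>r\<le>N. case r of 0 \<Rightarrow> 1
             | Suc q \<Rightarrow> (1 - x) ^ of_bool (\<kappa> r < \<mu> q \<and> \<rho> q < \<mu> q)) *
        (\<Prod>r\<le>N. y ^ (\<nu> r - \<kappa> r) * (1 - y) ^ of_bool (\<nu> (Suc r) < \<kappa> r \<and> \<sigma> r < \<kappa> r))"
      using True ok shift by (simp add: strip_weight_def prod.distrib)
    also have "\<dots> = (\<Prod>r\<le>N. row_term x y \<rho> \<sigma> \<mu> \<nu> r (\<kappa> r))"
      unfolding prod.distrib[symmetric] using True
      by (intro prod.cong refl) (simp add: row_term_def mult_ac)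
    finally show ?thesis .
  qed
qed

lemma sum_two_strips:
  fixes x y :: "'a :: comm_ring_1"
  assumes "\<And>r. r \<ge> N \<Longrightarrow> \<mu> r = 0" and "\<And>r. r \<ge> N \<Longrightarrow> \<nu> r = 0"
    and lo: "\<And>r. r \<ge> N \<Longrightarrow> lo r = 0" and hi: "\<And>r. r \<ge> N \<Longrightarrow> hi r = 0"
  shows "(\<Sum>\<kappa> | \<forall>r. lo r \<le> \<kappa> r \<and> \<kappa> r \<le> hi r.
      strip_weight N x \<rho> \<mu> \<kappa> * strip_weight N y \<sigma> \<kappa> \<nu>)
    = (\<Prod>r\<le>N. \<Sum>c = lo r..hi r. row_term x y \<rho> \<sigma> \<mu> \<nu> r c)"
proof -
  have "strip_weight N x \<rho> \<mu> \<kappa> * strip_weight N y \<sigma> \<kappa> \<nu>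
      = (\<Prod>r\<le>N. row_term x y \<rho> \<sigma> \<mu> \<nu> r (\<kappa> r))"
    if "\<kappa> \<in> {\<kappa>. \<forall>r. lo r \<le> \<kappa> r \<and> \<kappa> r \<le> hi r}" for \<kappa>
  proof (rule two_strips_eq_row_terms)
    fix r assume "N \<le> r"
    then show "\<kappa> r = 0" using that hi[of r] by (metis (mono_tags, lifting) le_zero_eq mem_Collect_eq)
  qed (use assms in auto)
  then show ?thesis using lo hi by (simp add: sum_boxes_prod)
qed

text \<open>
  The contribution of a row with \<open>N\<close> boxes that can carry either of two consecutive entries, where
  \<open>c\<close> of them carry the smaller one. If \<open>P\<close> holds, the row above may receive the smaller entry as an
  additional one unless \<open>c = N\<close>; if \<open>Q\<close> holds, the row itself may receive the larger one unless \<open>c = 0\<close>.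
\<close>

definition box_sum :: "bool \<Rightarrow> bool \<Rightarrow> nat \<Rightarrow> 'a \<Rightarrow> 'a \<Rightarrow> 'a :: comm_ring_1" where
  "box_sum P Q N x y =
     (\<Sum>c\<le>N. x ^ c * y ^ (N - c) * (1 - x) ^ of_bool (P \<and> c < N) * (1 - y) ^ of_bool (Q \<and> 0 < c))"

lemma box_sum_swap: "box_sum P Q N y x = box_sum Q P N x y"
  unfolding box_sum_def
  by (rule sum.reindex_bij_witness[of _ "\<lambda>c. N - c" "\<lambda>c. N - c"]) (auto simp: mult_ac)

text \<open>
  Both sides are the complete homogeneous polynomial of degree \<open>N\<close> minus \<open>x y\<close> times the one of
  degree \<open>N - 1\<close>.
\<close>

lemma box_sum_True_False:
  fixes x y :: "'a :: comm_ring_1"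
  shows "box_sum True False N x y = box_sum False True N x y"
proof (cases N)
  case 0
  then show ?thesis by (simp add: box_sum_def)
next
  case (Suc M)
  have "box_sum True False N x y = (\<Sum>c\<le>M. x ^ c * y ^ (N - c) * (1 - x)) + x ^ N"
    unfolding Suc box_sum_def by simp
  also have "(\<Sum>c\<le>M. x ^ c * y ^ (N - c) * (1 - x))
     = (\<Sum>c\<le>M. x ^ c * y ^ (N - c)) - (\<Sum>c\<le>M. x ^ Suc c * y ^ (N - c))"
    unfolding sum_subtractf[symmetric] by (intro sum.cong refl) (simp add: algebra_simps)
  also have "(\<Sum>c\<le>M. x ^ c * y ^ (N - c)) = (\<Sum>c\<le>N. x ^ c * y ^ (N - c)) - x ^ N"
    unfolding Suc by simp
  finally have 1: "box_sum True False N x y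
     = (\<Sum>c\<le>N. x ^ c * y ^ (N - c)) - (\<Sum>c\<le>M. x ^ Suc c * y ^ (N - c))" by simp
  have "box_sum False True N x y = y ^ N + (\<Sum>c\<le>M. x ^ Suc c * y ^ (M - c) * (1 - y))"
    unfolding Suc box_sum_def by (subst sum.atMost_Suc_shift) simp
  also have "(\<Sum>c\<le>M. x ^ Suc c * y ^ (M - c) * (1 - y))
     = (\<Sum>c\<le>M. x ^ Suc c * y ^ (M - c)) - (\<Sum>c\<le>M. x ^ Suc c * y ^ (N - c))"
    unfolding sum_subtractf[symmetric] Suc
    by (intro sum.cong refl) (simp add: algebra_simps Suc_diff_le)
  also have "(\<Sum>c\<le>M. x ^ Suc c * y ^ (M - c)) = (\<Sum>c\<le>N. x ^ c * y ^ (N - c)) - y ^ N"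
    unfolding Suc by (simp only: sum.atMost_Suc_shift) simp
  finally show ?thesis using 1 by simp
qed

lemma box_sum_symmetric: "box_sum P Q N y x = box_sum P Q N x y"
  using box_sum_swap[of P Q N y x] box_sum_True_False[of N x y] by (cases P; cases Q) auto

lemma complete_box_sum:
  "(x - y) * box_sum False False N x y = x ^ Suc N - y ^ Suc N"
  unfolding box_sum_def by (subst diff_power_eq_sum) (simp add: lessThan_Suc_atMost)

lemma isobaric_box_sum:
  "(x - y) * box_sum False True N x y = (1 - y) * x ^ Suc N - (1 - x) * y ^ Suc N"
proof (cases N)
  case 0
  then show ?thesis by (simp add: box_sum_def algebra_simps)
next
  case (Suc M)
  have "box_sum False True N x y = y ^ N + (\<Sum>c\<le>M. x ^ Suc c * y ^ (M - c) * (1 - y))"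
    unfolding Suc box_sum_def by (subst sum.atMost_Suc_shift) simp
  also have "(\<Sum>c\<le>M. x ^ Suc c * y ^ (M - c) * (1 - y)) = (1 - y) * x * box_sum False False M x y"
    unfolding box_sum_def sum_distrib_left by (intro sum.cong refl) (simp add: mult_ac)
  finally have bs: "box_sum False True N x y = y ^ N + (1 - y) * x * box_sum False False M x y" .
  have "(x - y) * box_sum False True N x y
     = (x - y) * y ^ N + (1 - y) * x * ((x - y) * box_sum False False M x y)"
    unfolding bs by (simp add: algebra_simps)
  then show ?thesis
    unfolding complete_box_sum Suc by (simp add: algebra_simps)
qed

section \<open>Two consecutive strips\<close>

text \<open>
  In the sum over \<open>\<kappa>\<close>, row \<open>r\<close> of \<open>\<kappa>\<close> ranges from \<open>row_lower\<close> to \<open>row_upper\<close>. What is left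
  after taking out the boxes whose entry is forced is symmetric in the two variables. The forced
  boxes come in pairs: \<open>row_excess\<close> counts the columns in which the two strips put a box in row \<open>r\<close>
  and a box in row \<open>r + 1\<close>, and \<open>row_free\<close> says that the last box of row \<open>r\<close> can receive either
  of the two entries as an additional one. One half of each pair is seen by row \<open>r\<close> of \<open>\<kappa>\<close>, the
  other half by row \<open>r + 1\<close>; this is why \<open>upper_edge\<close> enters with the index of the previous row.
\<close>

definition row_excess :: "(nat \<Rightarrow> nat) \<Rightarrow> (nat \<Rightarrow> nat) \<Rightarrow> nat \<Rightarrow> nat" where
  "row_excess \<mu> \<nu> r = \<nu> (Suc r) - \<mu> r"

definition row_free :: "(nat \<Rightarrow> nat) \<Rightarrow> (nat \<Rightarrow> nat) \<Rightarrow> (nat \<Rightarrow> nat) \<Rightarrow> nat \<Rightarrow> bool" where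
  "row_free \<rho> \<mu> \<nu> r \<longleftrightarrow> \<nu> (Suc r) < \<mu> r \<and> \<rho> r < \<mu> r"

definition row_lower :: "(nat \<Rightarrow> nat) \<Rightarrow> (nat \<Rightarrow> nat) \<Rightarrow> nat \<Rightarrow> nat" where
  "row_lower \<mu> \<nu> r = max (\<mu> r) (\<nu> (Suc r))"

definition row_upper :: "(nat \<Rightarrow> nat) \<Rightarrow> (nat \<Rightarrow> nat) \<Rightarrow> nat \<Rightarrow> nat" where
  "row_upper \<mu> \<nu> r = (case r of 0 \<Rightarrow> \<nu> r | Suc q \<Rightarrow> min (\<nu> r) (\<mu> q))"

definition row_capped :: "(nat \<Rightarrow> nat) \<Rightarrow> (nat \<Rightarrow> nat) \<Rightarrow> (nat \<Rightarrow> nat) \<Rightarrow> nat \<Rightarrow> bool" where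
  "row_capped \<rho> \<mu> \<nu> r \<longleftrightarrow> (case r of 0 \<Rightarrow> False | Suc q \<Rightarrow> \<rho> q < \<mu> q \<and> \<mu> q \<le> \<nu> r)"

definition row_core :: "'a \<Rightarrow> 'a \<Rightarrow> (nat \<Rightarrow> nat) \<Rightarrow> (nat \<Rightarrow> nat) \<Rightarrow> (nat \<Rightarrow> nat) \<Rightarrow> nat \<Rightarrow> 'a :: comm_ring_1" where
  "row_core x y \<rho> \<mu> \<nu> r = (if row_lower \<mu> \<nu> r \<le> row_upper \<mu> \<nu> r
     then box_sum (row_capped \<rho> \<mu> \<nu> r) (\<not> row_free \<rho> \<mu> \<nu> r)
       (row_upper \<mu> \<nu> r - row_lower \<mu> \<nu> r) x y else 0)"

definition upper_edge where
  "upper_edge x y \<rho> \<mu> \<nu> r = y ^ row_excess \<mu> \<nu> r * (1 - x) ^ of_bool (row_free \<rho> \<mu> \<nu> r)"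

abbreviation from_previous :: "(nat \<Rightarrow> 'a :: comm_ring_1) \<Rightarrow> nat \<Rightarrow> 'a" where
  "from_previous g r \<equiv> (case r of 0 \<Rightarrow> 1 | Suc q \<Rightarrow> g q)"

text \<open>
  As \<open>\<sigma> r\<close> lies between \<open>\<rho> r\<close> and \<open>max (\<rho> r) (\<nu> (r + 1))\<close>, both flags exclude the same additional
  entries, so the result can be written in terms of \<open>\<rho>\<close> alone.
\<close>

lemma sum_row_term:
  fixes x y :: "'a :: comm_ring_1"
  assumes \<rho>: "\<rho> r \<le> \<mu> r" "\<rho> r \<le> \<sigma> r" and \<sigma>: "\<sigma> r \<le> max (\<rho> r) (\<nu> (Suc r))"
    and lo: "lo \<le> max (\<mu> r) (\<nu> (Suc r))" and hi: "\<nu> r \<le> hi"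
  shows "(\<Sum>c = lo..hi. row_term x y \<rho> \<sigma> \<mu> \<nu> r c)
    = from_previous (upper_edge x y \<rho> \<mu> \<nu>) r * (upper_edge y x \<rho> \<mu> \<nu> r * row_core x y \<rho> \<mu> \<nu> r)"
proof -
  let ?a = "row_lower \<mu> \<nu> r" and ?b = "row_upper \<mu> \<nu> r"
  let ?P = "row_capped \<rho> \<mu> \<nu> r" and ?e = "row_free \<rho> \<mu> \<nu> r"
  have "(\<Sum>c = lo..hi. row_term x y \<rho> \<sigma> \<mu> \<nu> r c) = (\<Sum>c = ?a..?b. row_term x y \<rho> \<sigma> \<mu> \<nu> r c)"
    using lo hi
    by (intro sum.mono_neutral_right)
      (auto simp: row_lower_def row_upper_def row_term_def not_le split: nat.splits)
  also have "\<dots> = (\<Sum>c = ?a..?b. from_previous (upper_edge x y \<rho> \<mu> \<nu>) r * upper_edge y x \<rho> \<mu> \<nu> r *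
      (x ^ (c - ?a) * y ^ (?b - c) * (1 - x) ^ of_bool (?P \<and> c < ?b)
        * (1 - y) ^ of_bool (\<not> ?e \<and> ?a < c)))"
  proof (rule sum.cong[OF refl])
    fix c assume "c \<in> {?a..?b}"
    then have c: "?a \<le> c" "c \<le> ?b" by auto
    have valid: "\<mu> r \<le> c \<and> c \<le> \<nu> r \<and> \<nu> (Suc r) \<le> c \<and> (\<forall>q. r = Suc q \<longrightarrow> c \<le> \<mu> q)"
      using c by (auto simp: row_lower_def row_upper_def split: nat.splits)
    have x: "x ^ (c - \<mu> r) = x ^ row_excess \<mu> \<nu> r * x ^ (c - ?a)"
      unfolding power_add[symmetric] using c
      by (intro arg_cong[of _ _ "(^) x"]) (auto simp: row_lower_def row_excess_def)
    have y: "y ^ (\<nu> r - c) = from_previous (\<lambda>q. y ^ row_excess \<mu> \<nu> q) r * y ^ (?b - c)"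
      using c by (auto simp: row_upper_def row_excess_def power_add[symmetric] min_def
          split: nat.splits intro!: arg_cong[of _ _ "(^) y"])
    have dead_y: "(1 - y) ^ of_bool (\<nu> (Suc r) < c \<and> \<sigma> r < c)
        = (1 - y) ^ of_bool ?e * (1 - y) ^ of_bool (\<not> ?e \<and> ?a < c)"
      using c \<rho> \<sigma> by (auto simp: row_lower_def row_free_def)
    have dead_x: "(case r of 0 \<Rightarrow> 1 | Suc q \<Rightarrow> (1 - x) ^ of_bool (c < \<mu> q \<and> \<rho> q < \<mu> q))
        = from_previous (\<lambda>q. (1 - x) ^ of_bool (row_free \<rho> \<mu> \<nu> q)) r
          * (1 - x) ^ of_bool (?P \<and> c < ?b)"
      using c by (auto simp: row_upper_def row_free_def row_capped_def split: nat.splits)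
    have prev: "from_previous (upper_edge x y \<rho> \<mu> \<nu>) r = from_previous (\<lambda>q. y ^ row_excess \<mu> \<nu> q) r
        * from_previous (\<lambda>q. (1 - x) ^ of_bool (row_free \<rho> \<mu> \<nu> q)) r"
      by (simp add: upper_edge_def split: nat.split)
    show "row_term x y \<rho> \<sigma> \<mu> \<nu> r c = from_previous (upper_edge x y \<rho> \<mu> \<nu>) r * upper_edge y x \<rho> \<mu> \<nu> r *
      (x ^ (c - ?a) * y ^ (?b - c) * (1 - x) ^ of_bool (?P \<and> c < ?b)
        * (1 - y) ^ of_bool (\<not> ?e \<and> ?a < c))"
      unfolding row_term_def if_P[OF valid] x y dead_y dead_x prev upper_edge_def[of y]
      by (simp only: mult_ac)
  qed
  also have "\<dots> = from_previous (upper_edge x y \<rho> \<mu> \<nu>) r * (upper_edge y x \<rho> \<mu> \<nu> r * row_core x y \<rho> \<mu> \<nu> r)"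
  proof (cases "?a \<le> ?b")
    case True
    have "(\<Sum>c = ?a..?b. x ^ (c - ?a) * y ^ (?b - c) * (1 - x) ^ of_bool (?P \<and> c < ?b)
        * (1 - y) ^ of_bool (\<not> ?e \<and> ?a < c)) = box_sum ?P (\<not> ?e) (?b - ?a) x y"
      unfolding box_sum_def
      by (rule sum.reindex_bij_witness[of _ "\<lambda>c. c + ?a" "\<lambda>c. c - ?a"]) (use True in auto)
    then show ?thesis
      using True by (simp add: row_core_def sum_distrib_left[symmetric] mult.assoc)
  qed (simp add: row_core_def)
  finally show ?thesis .
qed

lemma prod_from_previous_upper_edge:
  assumes "\<mu> N = 0" "\<nu> (Suc N) = 0"
  shows "(\<Prod>r\<le>N. from_previous (upper_edge x y \<rho> \<mu> \<nu>) r) = (\<Prod>r\<le>N. upper_edge x y \<rho> \<mu> \<nu> r)"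
  using assms by (subst (2) prod_atMost_shift) (simp_all add: upper_edge_def row_excess_def row_free_def)

definition flagged_states :: "nat \<Rightarrow> (nat \<Rightarrow> nat \<Rightarrow> nat) \<Rightarrow> nat \<Rightarrow> (nat \<Rightarrow> nat) set" where
  "flagged_states n R m = {\<mu>. \<forall>r. R m r \<le> \<mu> r \<and> \<mu> r \<le> R n r}"

text \<open>
  The generating function of flagged set-valued tableaux whose entries are at most \<open>m\<close>: the entries
  up to \<open>m\<close> fill the partition \<open>\<nu>\<close>, and the flag \<open>R m\<close> is the set of boxes that have to be filled by
  then. The products over rows extend to row \<open>n + 1\<close>, where every partition is \<open>0\<close>.
\<close>

primrec chain_sum :: "nat \<Rightarrow> (nat \<Rightarrow> nat \<Rightarrow> nat) \<Rightarrow> nat \<Rightarrow> (nat \<Rightarrow> nat) \<Rightarrow> int_mpoly" where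
  "chain_sum n R 0 \<nu> = of_bool (\<nu> = R 0)"
| "chain_sum n R (Suc m) \<nu> =
     (\<Sum>\<mu>\<in>flagged_states n R m. chain_sum n R m \<mu> * strip_weight (Suc n) (X (Suc m)) (R m) \<mu> \<nu>)"

lemma finite_flagged_states:
  assumes "\<And>r. n < r \<Longrightarrow> R n r = 0"
  shows "finite (flagged_states n R m)"
  unfolding flagged_states_def by (rule finite_boxes) (use assms in auto)

lemma swap_vars_strip_weight:
  assumes "m \<noteq> i" "m \<noteq> Suc i"
  shows "swap_vars i (strip_weight N (X m) \<rho> \<mu> \<nu>) = strip_weight N (X m) \<rho> \<mu> \<nu>"
  using assms by (simp add: strip_weight_def swap_vars_hom swap_vars_X transpose_def)

lemma swap_vars_chain_sum:
  "m < i \<Longrightarrow> swap_vars i (chain_sum n R m \<nu>) = chain_sum n R m \<nu>"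
proof (induction m arbitrary: \<nu>)
  case 0
  then show ?case by simp
next
  case (Suc m)
  then show ?case by (simp add: swap_vars_hom swap_vars_strip_weight)
qed

lemma is_isobaric_sum:
  "(\<And>a. a \<in> A \<Longrightarrow> is_isobaric j (f a) (g a)) \<Longrightarrow> is_isobaric j (sum f A) (sum g A)"
  unfolding is_isobaric_def by (simp add: swap_vars_sum sum_distrib_left sum_subtractf[symmetric])

lemma is_isobaric_mult_symmetric:
  "is_isobaric j f g \<Longrightarrow> swap_vars j s = s \<Longrightarrow> is_isobaric j (s * f) (s * g)"
  unfolding is_isobaric_def by (simp add: swap_vars_mult mult.left_commute right_diff_distrib)

section \<open>Changing the flags at an ascent\<close>

text \<open>
  Two systems of flags that are related like those of a permutation (\<open>R\<close>) and of its neighbour at the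
  ascent \<open>l + 1\<close> (\<open>R'\<close>): the second one has one more box, at the end of row \<open>k\<close>. In \<open>R\<close> this row is
  forced from step \<open>l + 2\<close> on, in \<open>R'\<close> already from step \<open>l + 1\<close> on.
\<close>

locale ascent_flags =
  fixes n l k L :: nat and R R' :: "nat \<Rightarrow> nat \<Rightarrow> nat"
  assumes l: "Suc l < n"
    and mono: "m \<le> m' \<Longrightarrow> m' \<le> n \<Longrightarrow> R m r \<le> R m' r"
    and bounded: "m \<le> n \<Longrightarrow> n < r \<Longrightarrow> R m r = 0"
    and k: "1 \<le> k" "k \<le> n"
    and before: "m \<le> l \<Longrightarrow> R' m = R m"
    and at: "R' (Suc l) = (R (Suc l))(k := Suc L)"
    and after: "Suc l < m \<Longrightarrow> m \<le> n \<Longrightarrow> R' m = (R m)(k := Suc L)"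
    and full: "Suc l < m \<Longrightarrow> m \<le> n \<Longrightarrow> R m k = L"
    and interlaced: "R (Suc l) r \<le> max (R l r) (R (Suc (Suc l)) (Suc r))"
    and below: "R n (Suc k) \<le> L"
    and above: "L < R l (k - 1)"
begin

abbreviation "S \<equiv> flagged_states n R"
abbreviation "S' \<equiv> flagged_states n R'"

lemma R'_n: "R' n = (R n)(k := Suc L)"
  using after l by auto

lemma R_n_k: "R n k = L"
  using full l by auto

lemma bounded': "m \<le> n \<Longrightarrow> n < r \<Longrightarrow> R' m r = 0"
  using before[of m] at after[of m] bounded[of m r] k by (cases "m \<le> l"; cases "m = Suc l") auto

lemma flagged_state_bounded: "\<mu> \<in> S' m \<Longrightarrow> n < r \<Longrightarrow> \<mu> r = 0"
  using bounded'[of n r] by (auto simp: flagged_states_def) (metis le_zero_eq)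

lemma flagged_states_mono: "m \<le> l \<Longrightarrow> S m \<subseteq> S' m"
  unfolding flagged_states_def using before R'_n R_n_k by (auto split: if_splits) (metis le_SucI)

text \<open>
  Both sums over the intermediate partition are products over the rows. The factors of all rows other
  than \<open>k\<close> agree and are symmetric in \<open>X (l + 1)\<close> and \<open>X (l + 2)\<close>, so the operator only acts on the
  factor of row \<open>k\<close>. Apart from what it shares with row \<open>k + 1\<close>, this factor is a power of the first
  variable for \<open>R'\<close>, as the length of the row is forced, and the operator turns it into the sum over the lengths that \<open>R\<close> allows.
\<close>

lemma kernel_isobaric:
  assumes \<mu>: "\<mu> \<in> S' l" and \<nu>: "\<nu> \<in> S (Suc (Suc l))"
  shows "is_isobaric (Suc l)
    (\<Sum>\<kappa>\<in>S' (Suc l). strip_weight (Suc n) (X (Suc l)) (R' l) \<mu> \<kappa> *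
       strip_weight (Suc n) (X (Suc (Suc l))) (R' (Suc l)) \<kappa> (\<nu>(k := Suc L)))
    (\<Sum>\<kappa>\<in>S (Suc l). strip_weight (Suc n) (X (Suc l)) (R l) \<mu> \<kappa> *
       strip_weight (Suc n) (X (Suc (Suc l))) (R (Suc l)) \<kappa> \<nu>)"
proof -
  let ?N = "Suc n"
  define x y where "x = X (Suc l)" and "y = X (Suc (Suc l))"
  define \<nu>' where "\<nu>' = \<nu>(k := Suc L)"
  let ?\<rho> = "R l"
  have \<rho>': "R' l = ?\<rho>" using before by simp
  have \<mu>b: "\<rho> \<le> \<mu> r" if "\<rho> = ?\<rho> r" for r \<rho>
    using \<mu> that \<rho>' by (simp add: flagged_states_def)
  have \<mu>k: "\<mu> k \<le> Suc L" using \<mu> R'_n by (auto simp: flagged_states_def) (metis fun_upd_same)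
  have \<nu>b: "R (Suc (Suc l)) r \<le> \<nu> r" "\<nu> r \<le> R n r" for r
    using \<nu> by (auto simp: flagged_states_def)
  have \<nu>k: "\<nu> k = L" using \<nu>b[of k] full[of "Suc (Suc l)"] R_n_k l by simp
  have \<mu>0: "\<mu> r = 0" if "?N \<le> r" for r using flagged_state_bounded[OF \<mu>, of r] that by simp
  have \<nu>0: "\<nu> r = 0" if "?N \<le> r" for r using \<nu>b(2)[of r] bounded[of n r] that by simp
  have \<nu>'0: "\<nu>' r = 0" if "?N \<le> r" for r using \<nu>0[OF that] that k by (simp add: \<nu>'_def)
  have \<mu>k1: "Suc L \<le> \<mu> (k - 1)" "Suc L \<le> ?\<rho> (k - 1)" using above \<mu>b[of _ "k - 1"] by auto
  have \<nu>k1: "\<nu> (Suc k) \<le> L" using \<nu>b(2)[of "Suc k"] below by simp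
  have sandwich: "?\<rho> r \<le> R (Suc l) r" "R (Suc l) r \<le> max (?\<rho> r) (\<nu> (Suc r))" for r
    using mono[of l "Suc l" r] interlaced[of r] \<nu>b(1)[of "Suc r"] l by auto
  have new: "(\<Sum>\<kappa>\<in>S (Suc l). strip_weight ?N x ?\<rho> \<mu> \<kappa> * strip_weight ?N y (R (Suc l)) \<kappa> \<nu>)
      = (\<Prod>r\<le>?N. from_previous (upper_edge x y ?\<rho> \<mu> \<nu>) r *
          (upper_edge y x ?\<rho> \<mu> \<nu> r * row_core x y ?\<rho> \<mu> \<nu> r))"
    unfolding flagged_states_def
  proof (subst sum_two_strips[OF \<mu>0 \<nu>0])
    show "(\<Prod>r\<le>?N. \<Sum>c = R (Suc l) r..R n r. row_term x y ?\<rho> (R (Suc l)) \<mu> \<nu> r c)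
      = (\<Prod>r\<le>?N. from_previous (upper_edge x y ?\<rho> \<mu> \<nu>) r *
          (upper_edge y x ?\<rho> \<mu> \<nu> r * row_core x y ?\<rho> \<mu> \<nu> r))"
    proof (intro prod.cong refl sum_row_term)
      fix r
      show "R (Suc l) r \<le> max (\<mu> r) (\<nu> (Suc r))"
        using sandwich(2)[of r] \<mu>b[of _ r] by (simp add: le_max_iff_disj) (metis le_trans)
    qed (use \<mu>b \<nu>b sandwich in auto)
  qed (use bounded l in auto)
  have old: "(\<Sum>\<kappa>\<in>S' (Suc l). strip_weight ?N x ?\<rho> \<mu> \<kappa> * strip_weight ?N y (R' (Suc l)) \<kappa> \<nu>')
      = (\<Prod>r\<le>?N. from_previous (upper_edge x y ?\<rho> \<mu> \<nu>) r *
          (if r = k then x ^ (Suc L - \<mu> k)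
           else upper_edge y x ?\<rho> \<mu> \<nu> r * row_core x y ?\<rho> \<mu> \<nu> r))"
    unfolding flagged_states_def
  proof (subst sum_two_strips[OF \<mu>0 \<nu>'0])
    show "(\<Prod>r\<le>?N. \<Sum>c = R' (Suc l) r..R' n r. row_term x y ?\<rho> (R' (Suc l)) \<mu> \<nu>' r c)
      = (\<Prod>r\<le>?N. from_previous (upper_edge x y ?\<rho> \<mu> \<nu>) r *
          (if r = k then x ^ (Suc L - \<mu> k)
           else upper_edge y x ?\<rho> \<mu> \<nu> r * row_core x y ?\<rho> \<mu> \<nu> r))"
    proof (rule prod.cong[OF refl])
      fix r
      have excess: "row_excess \<mu> \<nu>' q = row_excess \<mu> \<nu> q" for q
        using \<mu>k1 \<nu>k by (auto simp: row_excess_def \<nu>'_def)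
      have free: "row_free ?\<rho> \<mu> \<nu>' q = row_free ?\<rho> \<mu> \<nu> q" for q
        using \<mu>k1 \<nu>k by (auto simp: row_free_def \<nu>'_def)
      have edge: "upper_edge x y ?\<rho> \<mu> \<nu>' = upper_edge x y ?\<rho> \<mu> \<nu>"
        "upper_edge y x ?\<rho> \<mu> \<nu>' = upper_edge y x ?\<rho> \<mu> \<nu>"
        by (simp_all add: fun_eq_iff upper_edge_def excess free)
      show "(\<Sum>c = R' (Suc l) r..R' n r. row_term x y ?\<rho> (R' (Suc l)) \<mu> \<nu>' r c)
        = from_previous (upper_edge x y ?\<rho> \<mu> \<nu>) r *
          (if r = k then x ^ (Suc L - \<mu> k)
           else upper_edge y x ?\<rho> \<mu> \<nu> r * row_core x y ?\<rho> \<mu> \<nu> r)"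
      proof (cases "r = k")
        case False
        have lower: "row_lower \<mu> \<nu>' r = row_lower \<mu> \<nu> r"
          using \<mu>k1 \<nu>k by (auto simp: row_lower_def \<nu>'_def)
        have upper: "row_upper \<mu> \<nu>' r = row_upper \<mu> \<nu> r"
          using False by (auto simp: row_upper_def \<nu>'_def split: nat.split)
        have capped: "row_capped ?\<rho> \<mu> \<nu>' r = row_capped ?\<rho> \<mu> \<nu> r"
          using False by (auto simp: row_capped_def \<nu>'_def split: nat.split)
        have core: "row_core x y ?\<rho> \<mu> \<nu>' r = row_core x y ?\<rho> \<mu> \<nu> r"
          by (simp add: row_core_def lower upper capped free)
        have \<nu>le: "\<nu> q \<le> \<nu>' q" for q using \<nu>k by (simp add: \<nu>'_def)
        have R'r: "R' (Suc l) r = R (Suc l) r" "R' n r = R n r"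
          using False at R'_n by auto
        have *: "R (Suc l) r \<le> max (?\<rho> r) (\<nu>' (Suc r))"
          using sandwich(2)[of r] \<nu>le[of "Suc r"] by auto
        show ?thesis
          using False unfolding edge[symmetric] core[symmetric]
        proof (subst sum_row_term)
          show "R' (Suc l) r \<le> max (\<mu> r) (\<nu>' (Suc r))"
            using * R'r \<mu>b[of _ r] by (simp add: le_max_iff_disj) (metis le_trans)
        qed (use \<mu>b \<nu>b(2)[of r] sandwich(1) R'r False * in \<open>auto simp: \<nu>'_def\<close>)
      next
        case True
        obtain q where q: "k = Suc q" using k(1) by (cases k) auto
        have "(\<Sum>c = R' (Suc l) r..R' n r. row_term x y ?\<rho> (R' (Suc l)) \<mu> \<nu>' r c)
            = row_term x y ?\<rho> (R' (Suc l)) \<mu> \<nu>' k (Suc L)"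
          using True at R'_n by simp
        also have "\<dots> = x ^ (Suc L - \<mu> k) * (1 - x) ^ of_bool (Suc L < \<mu> q \<and> ?\<rho> q < \<mu> q)"
          using q \<mu>k \<mu>k1 \<nu>k1 at by (simp add: row_term_def \<nu>'_def)
        also have "\<dots> = from_previous (upper_edge x y ?\<rho> \<mu> \<nu>) k * x ^ (Suc L - \<mu> k)"
          using q \<mu>k1 \<nu>k by (auto simp: upper_edge_def row_excess_def row_free_def)
        finally show ?thesis using True by simp
      qed
    qed
  qed (use bounded' l in auto)
  define G where "G r = upper_edge x y ?\<rho> \<mu> \<nu> r * (upper_edge y x ?\<rho> \<mu> \<nu> r * row_core x y ?\<rho> \<mu> \<nu> r)" for r
  have shift: "(\<Prod>r\<le>?N. from_previous (upper_edge x y ?\<rho> \<mu> \<nu>) r) = (\<Prod>r\<le>?N. upper_edge x y ?\<rho> \<mu> \<nu> r)"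
    using \<mu>0[of ?N] \<nu>0[of "Suc ?N"] by (intro prod_from_previous_upper_edge) auto
  have kN: "k \<in> {..?N}" using k by auto
  have new': "(\<Sum>\<kappa>\<in>S (Suc l). strip_weight ?N x ?\<rho> \<mu> \<kappa> * strip_weight ?N y (R (Suc l)) \<kappa> \<nu>)
      = prod G ({..?N} - {k}) * G k"
    unfolding new prod.distrib[of _ _ "{..?N}"] shift unfolding G_def prod.distrib[symmetric]
    by (subst prod.remove[OF _ kN]) (simp_all add: mult_ac)
  have old': "(\<Sum>\<kappa>\<in>S' (Suc l). strip_weight ?N x ?\<rho> \<mu> \<kappa> * strip_weight ?N y (R' (Suc l)) \<kappa> \<nu>')
      = prod G ({..?N} - {k}) * (upper_edge x y ?\<rho> \<mu> \<nu> k * x ^ (Suc L - \<mu> k))"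
    unfolding old prod.distrib[of _ _ "{..?N}"] shift unfolding prod.distrib[symmetric]
    by (subst prod.remove[OF _ kN]) (simp_all add: G_def mult_ac)
  have swap_xy: "swap_vars (Suc l) x = y" "swap_vars (Suc l) y = x"
    by (simp_all add: x_def y_def swap_vars_X)
  have swap_box: "swap_vars (Suc l) (box_sum P Q M x y) = box_sum P Q M y x" for P Q M
    by (simp add: box_sum_def swap_vars_hom swap_xy)
  have swap_core: "swap_vars (Suc l) (row_core x y ?\<rho> \<mu> \<nu> r) = row_core x y ?\<rho> \<mu> \<nu> r" for r
    by (simp add: row_core_def swap_box box_sum_symmetric)
  have swap_edge: "swap_vars (Suc l) (upper_edge x y ?\<rho> \<mu> \<nu> r) = upper_edge y x ?\<rho> \<mu> \<nu> r"
    "swap_vars (Suc l) (upper_edge y x ?\<rho> \<mu> \<nu> r) = upper_edge x y ?\<rho> \<mu> \<nu> r" for r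
    by (simp_all add: upper_edge_def swap_vars_hom swap_xy)
  have swap_G: "swap_vars (Suc l) (G r) = G r" for r
    by (simp add: G_def swap_vars_mult swap_edge swap_core)
  have "is_isobaric (Suc l) (upper_edge x y ?\<rho> \<mu> \<nu> k * x ^ (Suc L - \<mu> k)) (G k)"
  proof -
    define e p where "e = row_free ?\<rho> \<mu> \<nu> k" and "p = row_excess \<mu> \<nu> k"
    have lower: "row_lower \<mu> \<nu> k = max (\<mu> k) (\<nu> (Suc k))" by (simp add: row_lower_def)
    have upper: "row_upper \<mu> \<nu> k = L"
      using k \<mu>k1 \<nu>k by (cases k) (auto simp: row_upper_def)
    have capped: "\<not> row_capped ?\<rho> \<mu> \<nu> k"
      using k \<mu>k1 \<nu>k by (cases k) (auto simp: row_capped_def)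
    \<comment> \<open>If the additional box is already filled in \<open>\<mu>\<close>, then \<open>R\<close> admits no chain through \<open>\<mu>\<close>. In
        \<open>R'\<close> this box is free, and the operator annihilates its factor \<open>1 - x\<close>.\<close>
    consider (outside) "\<mu> k = Suc L" | (free) "\<mu> k \<le> L" e | (tied) "\<mu> k \<le> L" "\<not> e"
      using \<mu>k by linarith
    then show ?thesis
    proof cases
      case outside
      have "?\<rho> k \<le> L" using mono[of l n k] R_n_k l by simp
      then have "e" "p = 0"
        using outside \<nu>k1 by (auto simp: e_def p_def row_free_def row_excess_def)
      moreover have "row_core x y ?\<rho> \<mu> \<nu> k = 0"
        using outside by (simp add: row_core_def lower upper)
      ultimately show ?thesis
        using outside unfolding is_isobaric_def
        by (simp add: G_def upper_edge_def e_def[symmetric] p_def[symmetric] swap_vars_hom swap_xy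
            x_def[symmetric] y_def[symmetric] mult.commute)
    next
      case free
      then have "p = 0" and lo: "row_lower \<mu> \<nu> k = \<mu> k"
        using free by (auto simp: e_def p_def row_free_def row_excess_def row_lower_def)
      have core: "row_core x y ?\<rho> \<mu> \<nu> k = box_sum False False (L - \<mu> k) x y"
        using free capped by (simp add: row_core_def lo upper e_def[symmetric])
      have "(x - y) * G k = (1 - x) * (1 - y) * ((x - y) * box_sum False False (L - \<mu> k) x y)"
        using free \<open>p = 0\<close>
        by (simp add: G_def core upper_edge_def e_def[symmetric] p_def[symmetric] mult_ac)
      also have "\<dots> = (1 - x) * (1 - y) * (x ^ (Suc L - \<mu> k) - y ^ (Suc L - \<mu> k))"
        using free by (simp only: complete_box_sum Suc_diff_le)
      finally show ?thesis
        using free \<open>p = 0\<close> unfolding is_isobaric_def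
        by (simp add: upper_edge_def e_def[symmetric] p_def[symmetric] swap_vars_hom swap_xy
            x_def[symmetric] y_def[symmetric]) (simp add: algebra_simps)
    next
      case tied
      let ?a = "row_lower \<mu> \<nu> k"
      have a: "?a \<le> L" using tied \<nu>k1 by (simp add: lower)
      have core: "row_core x y ?\<rho> \<mu> \<nu> k = box_sum False True (L - ?a) x y"
        using tied capped a by (simp add: row_core_def upper e_def[symmetric])
      have expo: "Suc L - \<mu> k = p + Suc (L - ?a)"
        using tied \<nu>k1 by (auto simp: lower p_def row_excess_def)
      have "(x - y) * G k = x ^ p * y ^ p * ((x - y) * box_sum False True (L - ?a) x y)"
        using tied by (simp add: G_def core upper_edge_def e_def[symmetric] p_def[symmetric] mult_ac)
      then show ?thesis
        using tied unfolding is_isobaric_def isobaric_box_sum expo power_add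
        by (simp add: upper_edge_def e_def[symmetric] p_def[symmetric] swap_vars_hom swap_xy
            x_def[symmetric] y_def[symmetric]) (simp add: algebra_simps)
    qed
  qed
  then have "is_isobaric (Suc l)
      (prod G ({..?N} - {k}) * (upper_edge x y ?\<rho> \<mu> \<nu> k * x ^ (Suc L - \<mu> k)))
      (prod G ({..?N} - {k}) * G k)"
    by (rule is_isobaric_mult_symmetric) (simp add: swap_vars_prod swap_G)
  then show ?thesis
    unfolding new'[symmetric] old'[symmetric] by (simp only: \<rho>' x_def y_def \<nu>'_def)
qed

end

context ascent_flags begin

text \<open>
  A partition that uses the additional box cannot grow into one that does not.
\<close>

lemma chain_sum_before:
  "m \<le> l \<Longrightarrow> \<nu> \<in> S m \<Longrightarrow> chain_sum n R' m \<nu> = chain_sum n R m \<nu>"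
proof (induction m arbitrary: \<nu>)
  case 0
  then show ?case using before[of 0] by simp
next
  case (Suc m)
  have sub: "S m \<subseteq> S' m" using Suc.prems flagged_states_mono by simp
  have "strip_weight (Suc n) (X (Suc m)) (R' m) \<mu> \<nu> = 0" if \<mu>: "\<mu> \<in> S' m - S m" for \<mu>
  proof -
    have "\<not> \<mu> k \<le> R n k"
      using \<mu> before[of m] Suc.prems(1) R'_n by (auto simp: flagged_states_def fun_upd_def split: if_splits)
    then have "\<not> \<mu> k \<le> \<nu> k" using Suc.prems(2) by (auto simp: flagged_states_def) (metis le_trans)
    then show ?thesis by (auto simp: strip_weight_def horizontal_strip_def)
  qed
  then have "chain_sum n R' (Suc m) \<nu>
      = (\<Sum>\<mu>\<in>S m. chain_sum n R' m \<mu> * strip_weight (Suc n) (X (Suc m)) (R' m) \<mu> \<nu>)"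
    unfolding chain_sum.simps
    by (intro sum.mono_neutral_right finite_flagged_states sub) (simp_all add: bounded')
  also have "\<dots> = chain_sum n R (Suc m) \<nu>"
    unfolding chain_sum.simps using Suc by (intro sum.cong refl) (simp add: before)
  finally show ?case .
qed

lemma chain_sum_at:
  assumes \<nu>: "\<nu> \<in> S (Suc (Suc l))"
  shows "is_isobaric (Suc l) (chain_sum n R' (Suc (Suc l)) (\<nu>(k := Suc L)))
    (chain_sum n R (Suc (Suc l)) \<nu>)"
proof -
  let ?w = "strip_weight (Suc n)" and ?x = "X (Suc l)" and ?y = "X (Suc (Suc l))"
  define K K' where "K \<mu> = (\<Sum>\<kappa>\<in>S (Suc l). ?w ?x (R l) \<mu> \<kappa> * ?w ?y (R (Suc l)) \<kappa> \<nu>)"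
    and "K' \<mu> = (\<Sum>\<kappa>\<in>S' (Suc l). ?w ?x (R' l) \<mu> \<kappa> * ?w ?y (R' (Suc l)) \<kappa> (\<nu>(k := Suc L)))" for \<mu>
  have sub: "S l \<subseteq> S' l" by (rule flagged_states_mono) simp
  have "K \<mu> = 0" if \<mu>: "\<mu> \<in> S' l - S l" for \<mu>
    unfolding K_def
  proof (rule sum.neutral, rule ballI)
    fix \<kappa> assume \<kappa>: "\<kappa> \<in> S (Suc l)"
    have "\<not> \<mu> k \<le> R n k"
      using \<mu> before[of l] R'_n by (auto simp: flagged_states_def fun_upd_def split: if_splits)
    then have "\<not> \<mu> k \<le> \<kappa> k" using \<kappa> by (auto simp: flagged_states_def) (metis le_trans)
    then show "?w ?x (R l) \<mu> \<kappa> * ?w ?y (R (Suc l)) \<kappa> \<nu> = 0"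
      by (auto simp: strip_weight_def horizontal_strip_def)
  qed
  then have extend: "(\<Sum>\<mu>\<in>S' l. chain_sum n R' l \<mu> * K \<mu>) = (\<Sum>\<mu>\<in>S l. chain_sum n R' l \<mu> * K \<mu>)"
    by (intro sum.mono_neutral_right finite_flagged_states sub) (simp_all add: bounded')
  have "chain_sum n R' (Suc (Suc l)) (\<nu>(k := Suc L)) = (\<Sum>\<mu>\<in>S' l. chain_sum n R' l \<mu> * K' \<mu>)"
    unfolding chain_sum.simps K'_def sum_distrib_left sum_distrib_right
    by (subst sum.swap) (simp only: mult.assoc)
  moreover have "chain_sum n R (Suc (Suc l)) \<nu> = (\<Sum>\<mu>\<in>S l. chain_sum n R l \<mu> * K \<mu>)"
    unfolding chain_sum.simps K_def sum_distrib_left sum_distrib_right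
    by (subst sum.swap) (simp only: mult.assoc)
  moreover have "\<dots> = (\<Sum>\<mu>\<in>S' l. chain_sum n R' l \<mu> * K \<mu>)"
    unfolding extend by (intro sum.cong refl) (simp add: chain_sum_before)
  moreover have "is_isobaric (Suc l) (\<Sum>\<mu>\<in>S' l. chain_sum n R' l \<mu> * K' \<mu>)
      (\<Sum>\<mu>\<in>S' l. chain_sum n R' l \<mu> * K \<mu>)"
    unfolding K_def K'_def
    by (intro is_isobaric_sum is_isobaric_mult_symmetric kernel_isobaric \<nu> swap_vars_chain_sum)
      simp_all
  ultimately show ?thesis by simp
qed

text \<open>
  From step \<open>l + 2\<close> on row \<open>k\<close> is forced in both systems, with and without the additional box, and the
  neighbouring rows are too long or too short to notice the difference.
\<close>

lemma strip_weight_after: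
  assumes m: "Suc l < m" "Suc m \<le> n" and \<mu>: "\<mu> \<in> S m" and \<nu>: "\<nu> \<in> S (Suc m)"
  shows "strip_weight N x (R' m) (\<mu>(k := Suc L)) (\<nu>(k := Suc L)) = strip_weight N x (R m) \<mu> \<nu>"
proof -
  have R': "R' m = (R m)(k := Suc L)" using after m by simp
  have Rk: "R m k = L" using full[of m] m by simp
  have \<mu>b: "R m r \<le> \<mu> r" "\<mu> r \<le> R n r" and \<nu>b: "R (Suc m) r \<le> \<nu> r" "\<nu> r \<le> R n r" for r
    using \<mu> \<nu> by (auto simp: flagged_states_def)
  have \<mu>k: "\<mu> k = L" using \<mu>b[of k] Rk R_n_k by simp
  have \<nu>k: "\<nu> k = L" using \<nu>b[of k] full[of "Suc m"] R_n_k m by simp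
  have Rk1: "Suc L \<le> R m (k - 1)" using above mono[of l m "k - 1"] m by simp
  then have \<mu>k1: "Suc L \<le> \<mu> (k - 1)" using \<mu>b(1)[of "k - 1"] by simp
  have \<nu>k1: "\<nu> (Suc k) \<le> L" using \<nu>b(2)[of "Suc k"] below by simp
  have strip: "horizontal_strip (\<mu>(k := Suc L)) (\<nu>(k := Suc L)) \<longleftrightarrow> horizontal_strip \<mu> \<nu>"
    unfolding horizontal_strip_def
  proof (intro all_cong1)
    fix r
    show "((\<mu>(k := Suc L)) r \<le> (\<nu>(k := Suc L)) r \<and> (\<nu>(k := Suc L)) (Suc r) \<le> (\<mu>(k := Suc L)) r)
        \<longleftrightarrow> (\<mu> r \<le> \<nu> r \<and> \<nu> (Suc r) \<le> \<mu> r)"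
      using \<mu>k \<nu>k \<nu>k1 \<mu>k1 k(1) by (cases "r = k"; cases "Suc r = k") auto
  qed
  have "(x :: 'a :: comm_ring_1) ^ ((\<nu>(k := Suc L)) r - (\<mu>(k := Suc L)) r) *
      (1 - x) ^ of_bool ((\<nu>(k := Suc L)) (Suc r) < (\<mu>(k := Suc L)) r \<and> R' m r < (\<mu>(k := Suc L)) r)
     = x ^ (\<nu> r - \<mu> r) * (1 - x) ^ of_bool (\<nu> (Suc r) < \<mu> r \<and> R m r < \<mu> r)" for r x
    using \<mu>k \<nu>k \<nu>k1 \<mu>k1 k(1) Rk Rk1 unfolding R' by (cases "r = k"; cases "Suc r = k") auto
  then show ?thesis unfolding strip_weight_def strip by simp
qed

lemma chain_sum_after:
  assumes "Suc l < m" "m \<le> n" "\<nu> \<in> S m"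
  shows "is_isobaric (Suc l) (chain_sum n R' m (\<nu>(k := Suc L))) (chain_sum n R m \<nu>)"
  using assms
proof (induction m arbitrary: \<nu>)
  case (Suc m)
  show ?case
  proof (cases "m = Suc l")
    case True
    show ?thesis unfolding True by (rule chain_sum_at) (use Suc.prems True in simp)
  next
    case False
    then have m: "Suc l < m" "Suc m \<le> n" using Suc.prems by auto
    have R': "R' m = (R m)(k := Suc L)" using after m by simp
    have Rk: "R m k = L" using full[of m] m by simp
    have "chain_sum n R' (Suc m) (\<nu>(k := Suc L)) = (\<Sum>\<mu>\<in>S m. chain_sum n R' m (\<mu>(k := Suc L)) *
        strip_weight (Suc n) (X (Suc m)) (R' m) (\<mu>(k := Suc L)) (\<nu>(k := Suc L)))"
      unfolding chain_sum.simps
    proof (rule sum.reindex_bij_witness[of _ "\<lambda>\<mu>. \<mu>(k := Suc L)" "\<lambda>\<mu>. \<mu>(k := L)"])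
      fix \<mu> assume "\<mu> \<in> S' m"
      then have *: "R' m r \<le> \<mu> r" "\<mu> r \<le> R' n r" for r by (auto simp: flagged_states_def)
      have "\<mu> k = Suc L" using *[of k] R' R'_n by simp
      then show "(\<mu>(k := L))(k := Suc L) = \<mu>" by auto
      show "\<mu>(k := L) \<in> S m"
        unfolding flagged_states_def
      proof (intro CollectI allI)
        fix r
        show "R m r \<le> (\<mu>(k := L)) r \<and> (\<mu>(k := L)) r \<le> R n r"
          using *[of r] Rk R_n_k R' R'_n by (cases "r = k") auto
      qed
      show "chain_sum n R' m ((\<mu>(k := L))(k := Suc L)) *
          strip_weight (Suc n) (X (Suc m)) (R' m) ((\<mu>(k := L))(k := Suc L)) (\<nu>(k := Suc L))
        = chain_sum n R' m \<mu> * strip_weight (Suc n) (X (Suc m)) (R' m) \<mu> (\<nu>(k := Suc L))"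
        using \<open>(\<mu>(k := L))(k := Suc L) = \<mu>\<close> by simp
    next
      fix \<mu> assume "\<mu> \<in> S m"
      then have *: "R m r \<le> \<mu> r" "\<mu> r \<le> R n r" for r by (auto simp: flagged_states_def)
      have "\<mu> k = L" using *[of k] Rk R_n_k by simp
      then show "(\<mu>(k := Suc L))(k := L) = \<mu>" by auto
      show "\<mu>(k := Suc L) \<in> S' m"
        using * unfolding flagged_states_def R' R'_n by auto
    qed
    also have "\<dots> = (\<Sum>\<mu>\<in>S m. strip_weight (Suc n) (X (Suc m)) (R m) \<mu> \<nu> *
        chain_sum n R' m (\<mu>(k := Suc L)))"
      using m Suc.prems by (intro sum.cong refl) (simp add: strip_weight_after mult.commute)
    finally have old: "chain_sum n R' (Suc m) (\<nu>(k := Suc L)) = \<dots>" .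
    have new: "chain_sum n R (Suc m) \<nu> = (\<Sum>\<mu>\<in>S m. strip_weight (Suc n) (X (Suc m)) (R m) \<mu> \<nu> *
        chain_sum n R m \<mu>)"
      by (simp add: mult.commute)
    show ?thesis
      unfolding old new using m Suc.prems
      by (intro is_isobaric_sum is_isobaric_mult_symmetric Suc.IH swap_vars_strip_weight) auto
  qed
qed simp

text \<open>
  The operator \<open>isobaric_divided_diff (l + 1)\<close> commutes with everything that happens before step
  \<open>l + 1\<close> and after step \<open>l + 2\<close>, since those steps do not involve its two variables.
\<close>

theorem chain_sum_isobaric:
  "is_isobaric (Suc l) (chain_sum n R' n (R' n)) (chain_sum n R n (R n))"
  unfolding R'_n using l by (intro chain_sum_after) (auto simp: flagged_states_def intro: mono)

end

section \<open>Columns of the Rothe diagram\<close>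

lemma first_entry:
  fixes a p :: nat
  assumes "a \<le> p" "p \<in> S" "a \<notin> S"
  obtains q where "a \<le> q" "q < p" "q \<notin> S" "Suc q \<in> S"
proof -
  have "\<exists>q\<ge>a. q < p \<and> q \<notin> S \<and> Suc q \<in> S"
    using assms
  proof (induction p rule: dec_induct)
    case (step p)
    show ?case
    proof (cases "p \<in> S")
      case True
      then show ?thesis using step.IH step.prems less_Suc_eq by metis
    next
      case False
      then show ?thesis using step by blast
    qed
  qed simp
  then show ?thesis using that by blast
qed

definition rothe_column :: "nat \<Rightarrow> (nat \<Rightarrow> nat) \<Rightarrow> nat \<Rightarrow> nat set" where
  "rothe_column n w j = {i. (i, j) \<in> rothe_diagram n w}"

definition column_height :: "nat \<Rightarrow> (nat \<Rightarrow> nat) \<Rightarrow> nat \<Rightarrow> nat \<Rightarrow> nat" where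
  "column_height n w m j = card (rothe_column n w j \<inter> {1..m})"

text \<open>
  If the columns are sorted by inclusion, these are the row lengths of the diagram that consists of the
  squares in the first \<open>m\<close> rows, pushed upwards.
\<close>

definition column_flag :: "nat \<Rightarrow> (nat \<Rightarrow> nat) \<Rightarrow> nat \<Rightarrow> nat \<Rightarrow> nat" where
  "column_flag n w m r = card {j \<in> {1..n}. r \<le> column_height n w m j}"

definition nested_columns :: "nat \<Rightarrow> (nat \<Rightarrow> nat) \<Rightarrow> bool" where
  "nested_columns n w \<longleftrightarrow> (\<forall>j\<in>{1..n}. \<forall>j'\<in>{1..n}.
     rothe_column n w j \<subseteq> rothe_column n w j' \<or> rothe_column n w j' \<subseteq> rothe_column n w j)"

lemma rothe_column_subset: "rothe_column n w j \<subseteq> {1..n}"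
  by (auto simp: rothe_column_def rothe_diagram_def)

lemma finite_rothe_column [simp]: "finite (rothe_column n w j)"
  by (rule finite_subset[OF rothe_column_subset]) simp

lemma mem_rothe_column:
  "j \<in> {1..n} \<Longrightarrow> i \<in> rothe_column n w j \<longleftrightarrow> i \<in> {1..n} \<and> i < inv w j \<and> j < w i"
  by (simp add: rothe_column_def rothe_diagram_def)

lemma mem_rothe_column_image:
  assumes "w permutes {1..n}" "q \<in> {1..n}"
  shows "i \<in> rothe_column n w (w q) \<longleftrightarrow> 1 \<le> i \<and> i < q \<and> w q < w i"
  using assms mem_rothe_column[of "w q" n i w] permutes_in_image[OF assms(1), of q]
  by (auto simp: permutes_inverses(2))

text \<open>
  Rows \<open>p\<close> and \<open>q\<close> that witness that two columns are incomparable, together with the positions of the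
  two column indices in \<open>w\<close>, form the pattern \<open>2143\<close>.
\<close>

lemma vexillary_nested_columns:
  assumes w: "w permutes {1..n}" and vex: "vexillary n w"
  shows "nested_columns n w"
proof -
  have contra: False
    if pq: "p < q" and j: "j \<in> {1..n}" and j': "j' \<in> {1..n}"
      and p: "p \<in> rothe_column n w j" "p \<notin> rothe_column n w j'"
      and q: "q \<in> rothe_column n w j'" "q \<notin> rothe_column n w j" for p q j j'
  proof -
    obtain s where s: "s \<in> {1..n}" "j = w s"
      using permutes_image[OF w] j by (metis image_iff)
    obtain s' where s': "s' \<in> {1..n}" "j' = w s'"
      using permutes_image[OF w] j' by (metis image_iff)
    note mem = mem_rothe_column_image[OF w s(1)] mem_rothe_column_image[OF w s'(1)]
    have "1 \<le> p" "p < s" "w s < w p" "q < s'" "w s' < w q"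
      using p(1) q(1) unfolding s s' mem by auto
    moreover have "w p < w s'"
    proof -
      have "w p \<le> w s'" using p(2) \<open>1 \<le> p\<close> \<open>q < s'\<close> pq unfolding s' mem by auto
      moreover have "w p \<noteq> w s'"
        using permutes_inj[OF w] \<open>q < s'\<close> pq by (metis injD less_trans nat_neq_iff)
      ultimately show ?thesis by simp
    qed
    moreover have "s < q"
    proof -
      have "s \<le> q"
        using q(2) calculation pq unfolding s mem by auto
      moreover have "s \<noteq> q"
        using \<open>w s < w p\<close> \<open>w s' < w q\<close> \<open>w p < w s'\<close> by auto
      ultimately show ?thesis by simp
    qed
    ultimately show False
      using vex s(1) s'(1) unfolding vexillary_def by (metis atLeastAtMost_iff)
  qed
  show ?thesis unfolding nested_columns_def
  proof (intro ballI, rule ccontr)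
    fix j j' assume j: "j \<in> {1..n}" "j' \<in> {1..n}"
      and "\<not> (rothe_column n w j \<subseteq> rothe_column n w j' \<or> rothe_column n w j' \<subseteq> rothe_column n w j)"
    then obtain p q where "p \<in> rothe_column n w j" "p \<notin> rothe_column n w j'"
      "q \<in> rothe_column n w j'" "q \<notin> rothe_column n w j" by blast
    then show False
      using contra[of p q j j'] contra[of q p j' j] j by (cases p q rule: linorder_cases) auto
  qed
qed

locale perm_ascent =
  fixes n i :: nat and w :: "nat \<Rightarrow> nat"
  assumes w: "w permutes {1..n}" and i: "1 \<le> i" "i < n" and ascent: "w i < w (Suc i)"
begin

abbreviation "v \<equiv> w \<circ> transpose i (Suc i)"
abbreviation "C \<equiv> rothe_column n w"
abbreviation "C' \<equiv> rothe_column n v"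

lemma v: "v permutes {1..n}"
  by (rule permutes_swap_step[OF w i])

lemma wi: "w i \<in> {1..n}"
  using permutes_in_image[OF w, of i] i by simp

lemma mem_column_at_ascent: "p \<in> C (w i) \<longleftrightarrow> 1 \<le> p \<and> p < i \<and> w i < w p"
  using mem_rothe_column_image[OF w, of i] i by simp

lemma new_column_at_ascent: "C' (w i) = insert i (C (w i))"
proof -
  have "w i = v (Suc i)" by simp
  then have "p \<in> C' (w i) \<longleftrightarrow> 1 \<le> p \<and> p < Suc i \<and> w i < v p" for p
    using mem_rothe_column_image[OF v, of "Suc i"] i by simp
  then have new: "p \<in> C' (w i) \<longleftrightarrow> 1 \<le> p \<and> p < Suc i \<and> w i < v p" for p .
  show ?thesis
  proof (rule set_eqI)
    fix p
    consider "p < i" | "p = i" | "i < p" by linarith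
    then show "p \<in> C' (w i) \<longleftrightarrow> p \<in> insert i (C (w i))"
      unfolding new insert_iff mem_column_at_ascent
      by cases (use ascent i in \<open>simp_all add: transpose_def\<close>)
  qed
qed

lemma column_lower_ascent_row: "j \<in> {1..n} \<Longrightarrow> i \<in> C j \<Longrightarrow> Suc i \<in> C j"
proof -
  assume j: "j \<in> {1..n}" and "i \<in> C j"
  obtain q where q: "q \<in> {1..n}" "j = w q"
    using permutes_image[OF w] j by (metis image_iff)
  note mem = mem_rothe_column_image[OF w q(1)]
  have "i < q" "w q < w i" using \<open>i \<in> C j\<close> unfolding q mem by auto
  moreover have "q \<noteq> Suc i" using \<open>w q < w i\<close> ascent by auto
  ultimately show ?thesis using ascent i unfolding q mem by simp
qed

lemma new_column:
  assumes j: "j \<in> {1..n}" "j \<noteq> w i"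
  shows "p \<in> C' j \<longleftrightarrow> transpose i (Suc i) p \<in> C j"
proof -
  let ?t = "transpose i (Suc i)"
  obtain q where q: "q \<in> {1..n}" "j = w q"
    using permutes_image[OF w] j by (metis image_iff)
  have "q \<noteq> i" using j q by auto
  have tq: "?t q \<in> {1..n}" "j = v (?t q)"
    using q i by (auto simp: transpose_def)
  note memv = mem_rothe_column_image[OF v tq(1), folded tq(2)]
  note memw = mem_rothe_column_image[OF w q(1), folded q(2)]
  show ?thesis
  proof (cases "q = Suc i")
    case False
    then show ?thesis
      using \<open>q \<noteq> i\<close> i q(1) unfolding memv memw by (auto simp: transpose_def)
  next
    case True
    have "p \<in> C' j \<longleftrightarrow> 1 \<le> p \<and> p < i \<and> j < v p" for p
      using memv[of p] True by simp
    moreover have "p \<in> C j \<longleftrightarrow> 1 \<le> p \<and> p < Suc i \<and> j < w p" for p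
      using memw[of p] True by simp
    moreover have "w i < j" using ascent q True by simp
    ultimately show ?thesis using i by (auto simp: transpose_def less_Suc_eq)
  qed
qed

lemma column_gap_prefix:
  assumes j: "j \<in> {1..n}" and gap: "i \<notin> C j" "Suc i \<in> C j"
  shows "p \<in> C j \<Longrightarrow> p < i \<Longrightarrow> p \<in> C (w i)"
proof -
  obtain q where q: "q \<in> {1..n}" "j = w q"
    using permutes_image[OF w] j by (metis image_iff)
  note mem = mem_rothe_column_image[OF w q(1)]
  have "w i \<le> w q" using gap i unfolding q mem by auto
  then show "p \<in> C j \<Longrightarrow> p < i \<Longrightarrow> p \<in> C (w i)"
    unfolding q mem mem_column_at_ascent by auto
qed

end

lemma column_height_le: "column_height n w m j \<le> m"
  unfolding column_height_def
  using card_mono[of "{1..m}" "rothe_column n w j \<inter> {1..m}"] by simp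

lemma column_height_mono: "m \<le> m' \<Longrightarrow> column_height n w m j \<le> column_height n w m' j"
  unfolding column_height_def by (intro card_mono) auto

lemma column_height_subset:
  "rothe_column n w j \<subseteq> rothe_column n w j' \<Longrightarrow> column_height n w m j \<le> column_height n w m j'"
  unfolding column_height_def by (intro card_mono) auto

lemma column_height_Suc:
  "column_height n w (Suc m) j = column_height n w m j + of_bool (Suc m \<in> rothe_column n w j)"
proof -
  have "rothe_column n w j \<inter> {1..Suc m} = (if Suc m \<in> rothe_column n w j
      then insert (Suc m) (rothe_column n w j \<inter> {1..m}) else rothe_column n w j \<inter> {1..m})"
    by (auto simp: le_Suc_eq)
  then show ?thesis by (simp add: column_height_def)
qed

lemma column_flag_mono:
  assumes "m \<le> m'"
  shows "column_flag n w m r \<le> column_flag n w m' r"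
proof -
  have "r \<le> column_height n w m' j" if "r \<le> column_height n w m j" for j
    using that column_height_mono[OF assms, of n w j] by simp
  then show ?thesis unfolding column_flag_def by (intro card_mono) auto
qed

lemma column_flag_antimono: "r \<le> r' \<Longrightarrow> column_flag n w m r' \<le> column_flag n w m r"
  unfolding column_flag_def by (intro card_mono) auto

lemma column_flag_eq_0:
  assumes "m < r"
  shows "column_flag n w m r = 0"
proof -
  have "\<not> r \<le> column_height n w m j" for j
    using column_height_le[of n w m j] assms by simp
  then show ?thesis by (simp add: column_flag_def)
qed

lemma column_flag_row_0: "column_flag n w m 0 = n"
proof -
  have "{j \<in> {1..n}. 0 \<le> column_height n w m j} = {1..n}" by auto
  then show ?thesis unfolding column_flag_def by simp
qed

text \<open>
  An ascent \<open>i\<close> such that nestedness survives the passage to \<open>v\<close>. The diagram of \<open>v\<close> arises by moving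
  squares from row \<open>i + 1\<close> up to row \<open>i\<close> in the columns with a gap at \<open>i\<close>, and by adding the square
  \<open>(i, w i)\<close>.
\<close>

locale nested_ascent = perm_ascent +
  assumes nested: "nested_columns n w" and nested': "nested_columns n v"
begin

abbreviation "A \<equiv> C (w i)"

text \<open>
  The column of \<open>w i\<close> contains everything that a column with a gap has above the gap, and nestedness
  turns this inclusion into an equality. Nestedness of \<open>v\<close> excludes larger columns that avoid
  both rows.
\<close>

lemma column_cases:
  assumes j: "j \<in> {1..n}" "j \<noteq> w i"
  obtains (neither) "i \<notin> C j" "Suc i \<notin> C j" "C j \<subseteq> A"
  | (gap) "i \<notin> C j" "Suc i \<in> C j" "C j \<inter> {1..<i} = A"
  | (both) "i \<in> C j" "Suc i \<in> C j" "A \<subseteq> C j"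
proof -
  have A: "i \<notin> A" "Suc i \<notin> A" "A \<subseteq> {1..<i}" by (auto simp: mem_column_at_ascent)
  have chain: "C j \<subseteq> A \<or> A \<subseteq> C j"
    using nested j wi by (auto simp: nested_columns_def)
  consider "i \<notin> C j" "Suc i \<notin> C j" | "i \<notin> C j" "Suc i \<in> C j" | "i \<in> C j" "Suc i \<in> C j"
    using column_lower_ascent_row[OF j(1)] by blast
  then show ?thesis
  proof cases
    case 1
    have same: "p \<in> C' j \<longleftrightarrow> p \<in> C j" for p
      using new_column[OF j, of p] 1 by (auto simp: transpose_def split: if_splits)
    have "C' j \<subseteq> C' (w i) \<or> C' (w i) \<subseteq> C' j"
      using nested' j wi by (auto simp: nested_columns_def)
    then have "C j \<subseteq> A" using 1 same unfolding new_column_at_ascent by blast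
    then show ?thesis using neither 1 by blast
  next
    case 2
    have "A \<subseteq> C j" using chain 2 A by blast
    then have "C j \<inter> {1..<i} = A" using column_gap_prefix[OF j(1) 2] A by auto
    then show ?thesis using gap 2 by blast
  next
    case 3
    then have "\<not> C j \<subseteq> A" using A(1) by auto
    then show ?thesis using both[OF 3] chain by simp
  qed
qed

text \<open>
  The square added to column \<open>w i\<close> enlarges the column of height \<open>card A\<close>, so the new box lies in the
  row below that height, behind the columns that meet row \<open>i + 1\<close>.
\<close>

definition box_row where "box_row = Suc (card A)"
definition crossing where "crossing = {j \<in> {1..n}. Suc i \<in> C j}"

lemma wi_notin_crossing: "w i \<notin> crossing"
  by (auto simp: crossing_def mem_column_at_ascent)

lemma height_A: "i \<le> Suc m \<Longrightarrow> column_height n w m (w i) = card A"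
  unfolding column_height_def by (intro arg_cong[of _ _ card]) (auto simp: mem_column_at_ascent)

lemma height_new_A: "i \<le> m \<Longrightarrow> column_height n v m (w i) = box_row"
proof -
  assume "i \<le> m"
  then have "C' (w i) \<inter> {1..m} = insert i A"
    unfolding new_column_at_ascent using i by (auto simp: mem_column_at_ascent)
  then show ?thesis by (simp add: column_height_def box_row_def mem_column_at_ascent)
qed

lemma height_before: "m < i \<Longrightarrow> j \<in> {1..n} \<Longrightarrow> column_height n v m j = column_height n w m j"
proof -
  assume m: "m < i" and j: "j \<in> {1..n}"
  have "C' j \<inter> {1..m} = C j \<inter> {1..m}"
  proof (cases "j = w i")
    case True
    then show ?thesis using m by (auto simp: new_column_at_ascent)
  next
    case False
    have "p \<in> C' j \<longleftrightarrow> p \<in> C j" if "p \<le> m" for p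
      using new_column[OF j False, of p] that m by (simp add: transpose_def)
    then show ?thesis by auto
  qed
  then show ?thesis by (simp add: column_height_def)
qed

lemma height_after:
  assumes m: "i < m" and j: "j \<in> {1..n}" "j \<noteq> w i"
  shows "column_height n v m j = column_height n w m j"
proof -
  let ?t = "transpose i (Suc i)"
  have "C' j \<inter> {1..m} = ?t ` (C j \<inter> {1..m})"
  proof (intro set_eqI iffI)
    fix p assume "p \<in> C' j \<inter> {1..m}"
    then have "?t p \<in> C j \<inter> {1..m}"
      using new_column[OF j, of p] m i by (auto simp: transpose_def)
    then show "p \<in> ?t ` (C j \<inter> {1..m})" by (metis imageI transpose_involutory)
  next
    fix p assume "p \<in> ?t ` (C j \<inter> {1..m})"
    then obtain q where "q \<in> C j" "1 \<le> q" "q \<le> m" "p = ?t q" by auto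
    then show "p \<in> C' j \<inter> {1..m}"
      using new_column[OF j, of p] m i by (auto simp: transpose_def)
  qed
  then show ?thesis unfolding column_height_def
    by (simp add: card_image inj_on_subset[OF inj_transpose])
qed

lemma height_crossing:
  assumes j: "j \<in> {1..n}" and m: "i < m"
  shows "box_row \<le> column_height n w m j \<longleftrightarrow> j \<in> crossing"
proof (cases "j = w i")
  case True
  then show ?thesis using height_A[of m] m wi_notin_crossing by (simp add: box_row_def)
next
  case False
  show ?thesis
  proof (cases rule: column_cases[OF j False])
    case 1
    then have "column_height n w m j \<le> card A"
      unfolding column_height_def by (intro card_mono) auto
    then show ?thesis using 1 by (simp add: crossing_def box_row_def)
  next
    case 2
    have "A \<subseteq> C j" using 2(3) by blast
    moreover have "A \<subseteq> {1..m}" using m by (auto simp: mem_column_at_ascent)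
    ultimately have "insert (Suc i) A \<subseteq> C j \<inter> {1..m}" using 2(2) m by simp
    then have "card (insert (Suc i) A) \<le> column_height n w m j"
      unfolding column_height_def by (intro card_mono) auto
    then show ?thesis using 2 j by (simp add: crossing_def box_row_def mem_column_at_ascent)
  next
    case 3
    have "A \<subseteq> C j" using 3(3) by blast
    moreover have "A \<subseteq> {1..m}" using m by (auto simp: mem_column_at_ascent)
    ultimately have "insert (Suc i) A \<subseteq> C j \<inter> {1..m}" using 3(2) m by simp
    then have "card (insert (Suc i) A) \<le> column_height n w m j"
      unfolding column_height_def by (intro card_mono) auto
    then show ?thesis using 3 j by (simp add: crossing_def box_row_def mem_column_at_ascent)
  qed
qed

lemma height_at:
  assumes j: "j \<in> {1..n}"
  shows "r \<le> column_height n v i j \<longleftrightarrow>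
    (if r = box_row then j \<in> insert (w i) crossing else r \<le> column_height n w i j)"
proof (cases "j = w i")
  case True
  then show ?thesis using height_new_A[of i] height_A[of i] by (auto simp: box_row_def)
next
  case False
  obtain i0 where i0: "i = Suc i0" using i(1) by (cases i) auto
  have new: "column_height n v i j = column_height n w i0 j + of_bool (Suc i \<in> C j)"
    using new_column[OF j False, of i] height_before[of i0 j] j
    unfolding i0 column_height_Suc by (simp add: i0)
  have old: "column_height n w i j = column_height n w i0 j + of_bool (i \<in> C j)"
    unfolding i0 column_height_Suc by simp
  show ?thesis
  proof (cases rule: column_cases[OF j False])
    case 1
    then have "column_height n w i0 j \<le> card A"
      unfolding column_height_def by (intro card_mono) auto
    then show ?thesis using 1(1,2) False new old by (simp add: crossing_def box_row_def)
  next
    case 2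
    have "C j \<inter> {1..i0} = A" using 2(3) by (auto simp: i0 less_Suc_eq_le atLeastLessThanSuc_atLeastAtMost)
    then have "column_height n w i0 j = card A" by (simp add: column_height_def)
    then show ?thesis using 2(1,2) False new old j by (simp add: crossing_def box_row_def le_Suc_eq)
  next
    case 3
    have "1 \<le> p \<and> p \<le> i0" if "p \<in> A" for p
      using mem_column_at_ascent[of p] that i0 by simp
    with 3(3) have "A \<subseteq> C j \<inter> {1..i0}" by auto
    then have "card A \<le> column_height n w i0 j"
      unfolding column_height_def by (intro card_mono) auto
    then show ?thesis using 3(1,2) False new old j by (simp add: crossing_def box_row_def)
  qed
qed

lemma card_insert_crossing: "card (insert (w i) crossing) = Suc (card crossing)"
  using wi_notin_crossing by (simp add: crossing_def)

lemma flag_full: "i < m \<Longrightarrow> column_flag n w m box_row = card crossing"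
  unfolding column_flag_def using height_crossing by (intro arg_cong[of _ _ card]) (auto simp: crossing_def)

lemma flag_before: "m < i \<Longrightarrow> column_flag n v m = column_flag n w m"
  unfolding column_flag_def fun_eq_iff using height_before by (intro allI arg_cong[of _ _ card]) auto

lemma flag_at: "column_flag n v i = (column_flag n w i)(box_row := Suc (card crossing))"
proof
  fix r
  have "{j \<in> {1..n}. r \<le> column_height n v i j}
      = (if r = box_row then insert (w i) crossing else {j \<in> {1..n}. r \<le> column_height n w i j})"
    using height_at wi by (auto simp: crossing_def)
  then show "column_flag n v i r = ((column_flag n w i)(box_row := Suc (card crossing))) r"
    using card_insert_crossing by (simp add: column_flag_def)
qed

lemma flag_after:
  assumes m: "i < m"
  shows "column_flag n v m = (column_flag n w m)(box_row := Suc (card crossing))"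
proof
  fix r
  have "r \<le> column_height n v m j \<longleftrightarrow>
      (if r = box_row then j \<in> insert (w i) crossing else r \<le> column_height n w m j)"
    if j: "j \<in> {1..n}" for j
  proof (cases "j = w i")
    case True
    then show ?thesis using height_new_A[of m] height_A[of m] m by (auto simp: box_row_def)
  next
    case False
    then show ?thesis using height_after[OF m j False] height_crossing[OF j m] by auto
  qed
  then have "{j \<in> {1..n}. r \<le> column_height n v m j}
      = (if r = box_row then insert (w i) crossing else {j \<in> {1..n}. r \<le> column_height n w m j})"
    using wi by (auto simp: crossing_def)
  then show "column_flag n v m r = ((column_flag n w m)(box_row := Suc (card crossing))) r"
    using card_insert_crossing by (simp add: column_flag_def)
qed

text \<open>
  A column that meets row \<open>i\<close> also meets row \<open>i + 1\<close>. The two sets of columns on the right-hand side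
  are comparable because the columns are nested.
\<close>

lemma flag_interlaced:
  "column_flag n w i r \<le> max (column_flag n w (i - 1) r) (column_flag n w (Suc i) (Suc r))"
proof -
  obtain i0 where i0: "i = Suc i0" using i(1) by (cases i) auto
  let ?U = "{j \<in> {1..n}. r \<le> column_height n w i0 j}"
  let ?V = "{j \<in> {1..n}. Suc r \<le> column_height n w (Suc i) j}"
  have "{j \<in> {1..n}. r \<le> column_height n w i j} \<subseteq> ?U \<union> ?V"
    using column_lower_ascent_row by (auto simp: i0 column_height_Suc split: if_splits)
  moreover have "?U \<subseteq> ?V \<or> ?V \<subseteq> ?U"
  proof (rule ccontr)
    assume "\<not> (?U \<subseteq> ?V \<or> ?V \<subseteq> ?U)"
    then obtain j j' where j: "j \<in> ?U" "j \<notin> ?V" and j': "j' \<in> ?V" "j' \<notin> ?U" by blast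
    then have "C j \<subseteq> C j' \<or> C j' \<subseteq> C j" using nested by (auto simp: nested_columns_def)
    then show False
      using j j' column_height_subset[of n w j j' i0] column_height_subset[of n w j' j "Suc i"]
      by auto
  qed
  ultimately have "{j \<in> {1..n}. r \<le> column_height n w i j} \<subseteq> ?U
      \<or> {j \<in> {1..n}. r \<le> column_height n w i j} \<subseteq> ?V" by blast
  then have "column_flag n w i r \<le> card ?U \<or> column_flag n w i r \<le> card ?V"
    unfolding column_flag_def using card_mono[of ?U] card_mono[of ?V] by fastforce
  then show ?thesis by (auto simp: column_flag_def i0)
qed

lemma flag_above: "card crossing < column_flag n w (i - 1) (box_row - 1)"
proof -
  have "card A \<le> column_height n w (i - 1) j" if j: "j \<in> insert (w i) crossing" for j
  proof (cases "j = w i")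
    case True
    then show ?thesis using height_A[of "i - 1"] by simp
  next
    case False
    with j have jn: "j \<in> {1..n}" and Suc: "Suc i \<in> C j" by (auto simp: crossing_def)
    have "A \<subseteq> C j" by (cases rule: column_cases[OF jn False]) (use Suc in auto)
    then show ?thesis
      using height_A[of "i - 1"] column_height_subset[of n w "w i" j "i - 1"] i by simp
  qed
  then have "insert (w i) crossing \<subseteq> {j \<in> {1..n}. box_row - 1 \<le> column_height n w (i - 1) j}"
    using wi by (auto simp: crossing_def box_row_def)
  then have "card (insert (w i) crossing) \<le> column_flag n w (i - 1) (box_row - 1)"
    unfolding column_flag_def by (intro card_mono) auto
  then show ?thesis using card_insert_crossing by simp
qed

lemma ascent_flags: "ascent_flags n (i - 1) box_row (card crossing) (column_flag n w) (column_flag n v)"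
proof -
  have "card A \<le> card {1..<i}"
    by (rule card_mono) (auto simp: mem_column_at_ascent)
  then have "box_row \<le> n" using i by (simp add: box_row_def)
  have Suc_i: "Suc (i - 1) = i" using i by simp
  show ?thesis
  proof (unfold_locales, unfold Suc_i)
    show "column_flag n w n (Suc box_row) \<le> card crossing"
      using column_flag_antimono[of box_row "Suc box_row" n w n] flag_full[of n] i by simp
    show "box_row \<le> n" by fact
    show "1 \<le> box_row" by (simp add: box_row_def)
  qed (use i flag_before flag_at flag_after flag_full flag_interlaced flag_above in
      \<open>auto intro: column_flag_mono column_flag_eq_0\<close>)
qed

lemma is_isobaric_nested:
  "is_isobaric i (chain_sum n (column_flag n v) n (column_flag n v n))
     (chain_sum n (column_flag n w) n (column_flag n w n))"
  using ascent_flags.chain_sum_isobaric[OF ascent_flags] i by simp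

end

section \<open>Grothendieck polynomials as sums over flagged chains\<close>

context perm_ascent
begin

lemma nested_columns_swap:
  assumes nested: "nested_columns n w"
    and below: "\<And>j. j \<in> {1..n} \<Longrightarrow> j \<noteq> w i \<Longrightarrow> Suc i \<notin> C j \<Longrightarrow> C j \<subseteq> C (w i)"
  shows "nested_columns n v"
proof -
  have other: "C' j \<subseteq> C' (w i) \<or> C' (w i) \<subseteq> C' j" if j: "j \<in> {1..n}" "j \<noteq> w i" for j
  proof (cases "Suc i \<in> C j")
    case True
    then have "\<not> C j \<subseteq> C (w i)" using mem_column_at_ascent[of "Suc i"] by auto
    then have "C (w i) \<subseteq> C j" using nested j(1) wi unfolding nested_columns_def by blast
    moreover have "p \<in> C' j \<longleftrightarrow> p \<in> C j" if "p \<in> C (w i)" for p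
    proof -
      have "p < i" using that mem_column_at_ascent[of p] by simp
      then show ?thesis using new_column[OF j, of p] by (simp add: transpose_def)
    qed
    ultimately have "C (w i) \<subseteq> C' j" by blast
    moreover have "i \<in> C' j" using True new_column[OF j, of i] by simp
    ultimately show ?thesis unfolding new_column_at_ascent by blast
  next
    case False
    have "p \<in> C (w i)" if "p \<in> C' j" for p
    proof -
      have "transpose i (Suc i) p \<in> C (w i)"
        using new_column[OF j, of p] that below[OF j False] by blast
      moreover from this have "p < i"
        using mem_column_at_ascent[of "transpose i (Suc i) p"]
        by (simp add: transpose_def split: if_splits)
      ultimately show ?thesis by (simp add: transpose_def)
    qed
    then show ?thesis unfolding new_column_at_ascent by blast
  qed
  show ?thesis unfolding nested_columns_def
  proof (intro ballI)
    fix j j' assume j: "j \<in> {1..n}" "j' \<in> {1..n}"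
    then have "C j \<subseteq> C j' \<or> C j' \<subseteq> C j" using nested by (auto simp: nested_columns_def)
    then show "C' j \<subseteq> C' j' \<or> C' j' \<subseteq> C' j"
      using other[of j] other[of j'] j new_column[of j] new_column[of j'] by blast
  qed
qed

end

lemma ascent_of_gap:
  assumes w: "w permutes {1..n}" and j: "j \<in> {1..n}"
    and gap: "1 \<le> i" "i \<notin> rothe_column n w j" "Suc i \<in> rothe_column n w j"
  shows "perm_ascent n i w"
proof -
  obtain q where q: "q \<in> {1..n}" "j = w q"
    using permutes_image[OF w] j by (metis image_iff)
  note mem = mem_rothe_column_image[OF w q(1)]
  have "w i \<le> w q" "w q < w (Suc i)" "Suc i \<le> n" using gap q(1) unfolding q mem by auto
  then show ?thesis using w gap by unfold_locales auto
qed

text \<open>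
  If some column has a gap, take the lowest gap of all columns: a column that avoids rows \<open>i\<close> and
  \<open>i + 1\<close> but is not contained in the column of \<open>w i\<close> would have a lower one. If no column has a gap,
  take the first ascent \<open>i\<close>: then the column of \<open>w i\<close> consists of all rows above \<open>i\<close>.
\<close>

lemma exists_nested_ascent:
  assumes w: "w permutes {1..n}" and nested: "nested_columns n w" and "w \<noteq> longest_perm n"
  shows "\<exists>i. nested_ascent n i w"
proof -
  let ?C = "rothe_column n w"
  define gap where "gap q \<longleftrightarrow> 1 \<le> q \<and> (\<exists>j\<in>{1..n}. q \<notin> ?C j \<and> Suc q \<in> ?C j)" for q
  have above_gap: "\<exists>q\<ge>Suc i. gap q" if *: "j \<in> {1..n}" "Suc i \<notin> ?C j" "p \<in> ?C j" "Suc i \<le> p" for i j p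
  proof -
    obtain q where q: "Suc i \<le> q" "q \<notin> ?C j" "Suc q \<in> ?C j"
      using first_entry[OF *(4,3,2)] by metis
    then have "gap q" using *(1) unfolding gap_def by auto
    then show ?thesis using q(1) by blast
  qed
  show ?thesis
  proof (cases "\<exists>q. gap q")
    case True
    have bound: "q \<le> n" if q: "gap q" for q
    proof -
      obtain j where "Suc q \<in> ?C j" using q by (auto simp: gap_def)
      then have "Suc q \<in> {1..n}" using rothe_column_subset[of n w j] by blast
      then show ?thesis by simp
    qed
    define i where "i = Greatest gap"
    have i: "gap i" unfolding i_def by (rule GreatestI_ex_nat[OF True bound])
    have max: "q \<le> i" if "gap q" for q
      unfolding i_def by (rule Greatest_le_nat[of gap, OF that bound])
    obtain j0 where j0: "j0 \<in> {1..n}" "i \<notin> ?C j0" "Suc i \<in> ?C j0" "1 \<le> i"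
      using i by (auto simp: gap_def)
    interpret perm_ascent n i w by (rule ascent_of_gap[OF w j0(1,4,2,3)])
    have "nested_columns n v"
    proof (rule nested_columns_swap[OF nested])
      fix j assume j: "j \<in> {1..n}" "j \<noteq> w i" "Suc i \<notin> C j"
      have "C j \<subseteq> C j0" using nested j j0 unfolding nested_columns_def by blast
      moreover have "p < i" if p: "p \<in> C j" for p
      proof (rule ccontr)
        assume "\<not> p < i"
        moreover have "p \<noteq> i" using p j column_lower_ascent_row by blast
        ultimately have "\<exists>q\<ge>Suc i. gap q" using above_gap[OF j(1,3) p] by simp
        then show False using max by fastforce
      qed
      ultimately show "C j \<subseteq> C (w i)" using column_gap_prefix[OF j0(1-3)] by blast
    qed
    then have "nested_ascent n i w" using nested by unfold_locales
    then show ?thesis by blast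
  next
    case False
    let ?P = "\<lambda>i. 1 \<le> i \<and> i < n \<and> w i < w (Suc i)"
    define i where "i = Least ?P"
    have "\<exists>i. ?P i"
      using no_ascent_longest_perm[OF w] assms(3) by blast
    then have P: "?P i" unfolding i_def by (rule LeastI_ex)
    then have i: "1 \<le> i" "i < n" "w i < w (Suc i)" by simp_all
    have least: "\<not> w q < w (Suc q)" if "1 \<le> q" "q < i" for q
      using not_less_Least[of q ?P] that i(2) unfolding i_def by simp
    interpret perm_ascent n i w using w i by unfold_locales
    have desc: "w i \<le> w p" if "p \<le> i" "1 \<le> p" for p
      using that
    proof (induction p rule: inc_induct)
      case (step q)
      then show ?case using least[of q] by simp
    qed simp
    have desc': "w i < w p" if "p < i" "1 \<le> p" for p
      using desc[of p] that permutes_inj[OF w] by (metis injD le_neq_implies_less less_imp_le_nat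
          nat_neq_iff)
    have "nested_columns n v"
    proof (rule nested_columns_swap[OF nested])
      fix j assume j: "j \<in> {1..n}" "j \<noteq> w i" "Suc i \<notin> C j"
      show "C j \<subseteq> C (w i)"
      proof
        fix p assume p: "p \<in> C j"
        have "\<not> Suc i \<le> p" using above_gap[OF j(1,3) p] False by blast
        moreover have "p \<noteq> i" using p j column_lower_ascent_row by blast
        moreover have "1 \<le> p" using p rothe_column_subset[of n w j] by auto
        ultimately show "p \<in> C (w i)" using desc'[of p] unfolding mem_column_at_ascent by simp
      qed
    qed
    then have "nested_ascent n i w" using nested by unfold_locales
    then show ?thesis by blast
  qed
qed

lemma column_flag_longest:
  assumes "m \<le> n"
  shows "column_flag n (longest_perm n) m r = (if r \<le> m then n - r else 0)"
proof -
  have perm: "longest_perm n permutes {1..n}"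
    by (rule bij_imp_permutes, rule bij_betw_byWitness[where f' = "longest_perm n"])
      (auto simp: longest_perm_def)
  have col: "rothe_column n (longest_perm n) j = {1..n - j}" if j: "j \<in> {1..n}" for j
  proof -
    define q where "q = n + 1 - j"
    have q: "q \<in> {1..n}" "longest_perm n q = j" using j by (auto simp: q_def longest_perm_def)
    have "i \<in> rothe_column n (longest_perm n) j \<longleftrightarrow> 1 \<le> i \<and> i < q \<and> j < longest_perm n i" for i
      using mem_rothe_column_image[OF perm q(1), of i] q(2) by simp
    moreover have "j < longest_perm n i" if "1 \<le> i" "i < q" for i
    proof -
      have "i \<in> {1..n}" using that j unfolding q_def by simp
      then have "longest_perm n i = n + 1 - i" by (simp add: longest_perm_def)
      then show ?thesis using that j unfolding q_def by simp
    qed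
    ultimately have "i \<in> rothe_column n (longest_perm n) j \<longleftrightarrow> i \<in> {1..n - j}" for i
      using j unfolding q_def by (metis Suc_diff_le Suc_eq_plus1 atLeastAtMost_iff less_Suc_eq_le)
    then show ?thesis by blast
  qed
  have height: "column_height n (longest_perm n) m j = min m (n - j)" if "j \<in> {1..n}" for j
    using col[OF that] by (simp add: column_height_def)
  show ?thesis
  proof (cases "r \<le> m")
    case False
    then show ?thesis using column_flag_eq_0 by simp
  next
    case True
    have "r \<le> column_height n (longest_perm n) m j \<longleftrightarrow> j \<le> n - r" if "j \<in> {1..n}" for j
      using height[OF that] True that assms by auto
    then have "{j \<in> {1..n}. r \<le> column_height n (longest_perm n) m j} = {1..n - r}"
      by auto
    then show ?thesis using True by (simp add: column_flag_def)
  qed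
qed

text \<open>
  The flags of the longest permutation leave only the chain that fills one full row at each step.
\<close>

lemma chain_sum_longest:
  fixes n :: nat
  defines "R \<equiv> column_flag n (longest_perm n)"
  assumes "m \<le> n" "\<nu> \<in> flagged_states n R m"
  shows "chain_sum n R m \<nu> = of_bool (\<nu> = R m) * (\<Prod>i = 1..m. X i ^ (n - i))"
  using assms(2,3)
proof (induction m arbitrary: \<nu>)
  case (Suc m)
  have R: "R l r = (if r \<le> l then n - r else 0)" if "l \<le> n" for l r
    using column_flag_longest[OF that] by (simp add: R_def)
  let ?w = "strip_weight (Suc n) (X (Suc m)) (R m)"
  have Rm: "R m \<in> flagged_states n R m"
    using Suc.prems(1) R by (auto simp: flagged_states_def)
  have "chain_sum n R (Suc m) \<nu>
      = (\<Sum>\<mu>\<in>flagged_states n R m. if \<mu> = R m then (\<Prod>i = 1..m. X i ^ (n - i)) * ?w (R m) \<nu> else 0)"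
    unfolding chain_sum.simps using Suc.prems(1) by (intro sum.cong refl) (simp add: Suc.IH)
  also have "\<dots> = (\<Prod>i = 1..m. X i ^ (n - i)) * ?w (R m) \<nu>"
    using Rm finite_flagged_states[of n R m] R[of n] by simp
  also have "?w (R m) \<nu> = of_bool (\<nu> = R (Suc m)) * X (Suc m) ^ (n - Suc m)"
  proof -
    have strip: "horizontal_strip (R m) \<nu> \<longleftrightarrow> \<nu> = R (Suc m)"
    proof
      assume h: "horizontal_strip (R m) \<nu>"
      show "\<nu> = R (Suc m)"
      proof
        fix r
        have "R (Suc m) r \<le> \<nu> r" "\<nu> r \<le> R n r"
          using Suc.prems(2) by (auto simp: flagged_states_def)
        moreover have "r = Suc q \<Longrightarrow> \<nu> r \<le> R m q" for q
          using h by (simp add: horizontal_strip_def)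
        ultimately show "\<nu> r = R (Suc m) r"
          using R[of n r] R[of "Suc m" r] R[of m "r - 1"] Suc.prems(1)
          by (cases r) (force split: if_splits)+
      qed
    next
      assume "\<nu> = R (Suc m)"
      then show "horizontal_strip (R m) \<nu>"
        using Suc.prems(1) R by (auto simp: horizontal_strip_def)
    qed
    have "(\<Prod>r\<le>Suc n. X (Suc m) ^ (R (Suc m) r - R m r) * (1 - X (Suc m)) ^
        of_bool (R (Suc m) (Suc r) < R m r \<and> R m r < R m r))
      = (\<Prod>r\<le>Suc n. if r = Suc m then X (Suc m) ^ (n - Suc m) else 1)"
      using Suc.prems(1) R by (intro prod.cong refl) auto
    also have "\<dots> = X (Suc m) ^ (n - Suc m)"
      using Suc.prems(1) by (subst prod.delta) auto
    finally show ?thesis unfolding strip_weight_def strip by simp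
  qed
  finally show ?case by (simp add: mult_ac)
qed (simp add: R_def)

theorem grothendieck_rec_nested:
  assumes "w permutes {1..n}" "nested_columns n w"
  shows "grothendieck_rec n w (chain_sum n (column_flag n w) n (column_flag n w n))"
  using assms
proof (induction "card (noninversions n w)" arbitrary: w rule: less_induct)
  case less
  show ?case
  proof (cases "w = longest_perm n")
    case True
    have "chain_sum n (column_flag n w) n (column_flag n w n) = (\<Prod>i = 1..n. X i ^ (n - i))"
      unfolding True by (subst chain_sum_longest) (auto simp: flagged_states_def)
    then show ?thesis using True grothendieck_rec.longest by simp
  next
    case False
    then obtain i where "nested_ascent n i w" using exists_nested_ascent less.prems by blast
    then interpret nested_ascent n i w .
    have "grothendieck_rec n v (chain_sum n (column_flag n v) n (column_flag n v n))"
      using card_noninversions_ascent[OF i ascent] by (intro less.hyps v nested')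
    then show ?thesis
      using grothendieck_rec_ascentI[OF w i ascent] is_isobaric_nested unfolding is_isobaric_iff
      by metis
  qed
qed

corollary grothendieck_eq_chain_sum:
  assumes "w permutes {1..n}" "nested_columns n w"
  shows "grothendieck n w = chain_sum n (column_flag n w) n (column_flag n w n)"
  using assms by (intro grothendieck_eqI grothendieck_rec_nested)

section \<open>The support of a sum over flagged chains\<close>

definition monomial_degree :: "monomial \<Rightarrow> nat" where
  "monomial_degree m = (\<Sum>i\<in>Poly_Mapping.keys m. Poly_Mapping.lookup m i)"

lemma monomial_degree_add_single:
  "monomial_degree (m + Poly_Mapping.single i s) = monomial_degree m + s"
proof -
  let ?K = "insert i (Poly_Mapping.keys m)"
  have sub: "Poly_Mapping.keys (m + Poly_Mapping.single i s) \<subseteq> ?K"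
    using keys_add[of m "Poly_Mapping.single i s"] by (auto split: if_splits)
  have "monomial_degree (m + Poly_Mapping.single i s)
      = (\<Sum>a\<in>?K. Poly_Mapping.lookup (m + Poly_Mapping.single i s) a)"
    unfolding monomial_degree_def using sub
    by (intro sum.mono_neutral_left) (auto simp: in_keys_iff)
  also have "\<dots> = (\<Sum>a\<in>?K. Poly_Mapping.lookup m a) + (\<Sum>a\<in>?K. if a = i then s else 0)"
    unfolding sum.distrib[symmetric]
    by (intro sum.cong refl) (simp add: lookup_add lookup_single when_def)
  also have "(\<Sum>a\<in>?K. Poly_Mapping.lookup m a) = monomial_degree m"
    unfolding monomial_degree_def by (intro sum.mono_neutral_right) (auto simp: in_keys_iff)
  also have "(\<Sum>a\<in>?K. if a = i then s else 0) = s" by (subst sum.delta) auto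
  finally show ?thesis .
qed

text \<open>
  The sign of each coefficient is determined by the degree of its monomial, up to the global sign
  \<open>(-1) ^ d\<close>. Such polynomials add without cancellation.
\<close>

definition alternating :: "nat \<Rightarrow> int_mpoly \<Rightarrow> bool" where
  "alternating d f \<longleftrightarrow> (\<forall>m. 0 \<le> (-1) ^ (d + monomial_degree m) * Poly_Mapping.lookup f m)"

lemma alternating_0 [simp]: "alternating d 0"
  by (simp add: alternating_def)

lemma alternating_even_1: "even d \<Longrightarrow> alternating d 1"
  by (auto simp: alternating_def lookup_one when_def monomial_degree_def)

lemma sum_alternating:
  assumes "finite A" and alt: "\<And>a. a \<in> A \<Longrightarrow> alternating d (f a)"
  shows "alternating d (sum f A)" and "Poly_Mapping.keys (sum f A) = (\<Union>a\<in>A. Poly_Mapping.keys (f a))"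
proof -
  have eq: "(-1) ^ (d + monomial_degree m) * Poly_Mapping.lookup (sum f A) m
      = (\<Sum>a\<in>A. (-1) ^ (d + monomial_degree m) * Poly_Mapping.lookup (f a) m)" for m
    by (simp add: lookup_sum sum_distrib_left)
  have nonneg: "0 \<le> (-1) ^ (d + monomial_degree m) * Poly_Mapping.lookup (f a) m" if "a \<in> A" for a m
    using alt[OF that] by (simp add: alternating_def)
  show "alternating d (sum f A)"
    unfolding alternating_def eq by (intro allI sum_nonneg nonneg)
  have "Poly_Mapping.lookup (sum f A) m = 0 \<longleftrightarrow> (\<forall>a\<in>A. Poly_Mapping.lookup (f a) m = 0)" for m
  proof -
    have "Poly_Mapping.lookup (sum f A) m = 0
        \<longleftrightarrow> (-1) ^ (d + monomial_degree m) * Poly_Mapping.lookup (sum f A) m = 0" by simp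
    also have "\<dots> \<longleftrightarrow> (\<forall>a\<in>A. (-1) ^ (d + monomial_degree m) * Poly_Mapping.lookup (f a) m = 0)"
      unfolding eq using assms(1) nonneg by (intro sum_nonneg_eq_0_iff)
    finally show ?thesis by simp
  qed
  then show "Poly_Mapping.keys (sum f A) = (\<Union>a\<in>A. Poly_Mapping.keys (f a))"
    by (auto simp: in_keys_iff)
qed

lemma single_diff_add:
  assumes "s \<le> Poly_Mapping.lookup (m :: monomial) i"
  shows "m - Poly_Mapping.single i s + Poly_Mapping.single i s = m"
  using assms
  by (intro poly_mapping_eqI) (auto simp: lookup_add lookup_minus lookup_single when_def)

lemma lookup_mult_X:
  "Poly_Mapping.lookup (f * X i) m = (if Poly_Mapping.lookup m i = 0 then 0
     else Poly_Mapping.lookup f (m - Poly_Mapping.single i 1))"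
proof (induction f rule: int_mpoly_induct)
  case (single k c)
  have "k + Poly_Mapping.single i 1 = m \<longleftrightarrow>
      Poly_Mapping.lookup m i \<noteq> 0 \<and> k = m - Poly_Mapping.single i 1"
    using single_diff_add[of 1 m i] by (auto simp: lookup_add)
  then show ?case by (auto simp: X_def mult_single lookup_single when_def)
next
  case (add f g)
  then show ?case by (simp add: distrib_right lookup_add)
qed

lemma mem_add_single_image:
  "m \<in> (\<lambda>m. m + Poly_Mapping.single i 1) ` M \<longleftrightarrow>
     Poly_Mapping.lookup m i \<noteq> 0 \<and> m - Poly_Mapping.single i 1 \<in> (M :: monomial set)"
proof
  assume "Poly_Mapping.lookup m i \<noteq> 0 \<and> m - Poly_Mapping.single i 1 \<in> M"
  then show "m \<in> (\<lambda>m. m + Poly_Mapping.single i 1) ` M"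
    using single_diff_add[of 1 m i]
    by (intro image_eqI[of _ _ "m - Poly_Mapping.single i 1"]) auto
qed (auto simp: lookup_add)

lemma degree_minus_single:
  assumes "Poly_Mapping.lookup m i \<noteq> 0"
  shows "monomial_degree m = Suc (monomial_degree (m - Poly_Mapping.single i 1))"
  using monomial_degree_add_single[of "m - Poly_Mapping.single i 1" i 1]
    single_diff_add[of 1 m i] assms by simp

lemma keys_mult_X:
  "Poly_Mapping.keys (f * X i) = (\<lambda>m. m + Poly_Mapping.single i 1) ` Poly_Mapping.keys f"
  unfolding set_eq_iff mem_add_single_image in_keys_iff lookup_mult_X by simp

lemma alternating_mult_X: "alternating d f \<Longrightarrow> alternating (Suc d) (f * X i)"
  unfolding alternating_def lookup_mult_X
proof
  fix m assume f: "\<forall>m. 0 \<le> (- 1) ^ (d + monomial_degree m) * Poly_Mapping.lookup f m"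
  show "0 \<le> (- 1) ^ (Suc d + monomial_degree m) * (if Poly_Mapping.lookup m i = 0 then 0
     else Poly_Mapping.lookup f (m - Poly_Mapping.single i 1))"
    using f[rule_format, of "m - Poly_Mapping.single i 1"] degree_minus_single[of m i] by simp
qed

lemma
  assumes f: "alternating d f"
  shows alternating_mult_1_minus_X: "alternating d (f * (1 - X i))"
    and keys_mult_1_minus_X: "Poly_Mapping.keys (f * (1 - X i))
      = Poly_Mapping.keys f \<union> (\<lambda>m. m + Poly_Mapping.single i 1) ` Poly_Mapping.keys f"
proof -
  define T where "T m = (if Poly_Mapping.lookup m i = 0 then 0
      else (-1) ^ (d + monomial_degree (m - Poly_Mapping.single i 1))
        * Poly_Mapping.lookup f (m - Poly_Mapping.single i 1))" for m
  have T: "T m = - ((-1) ^ (d + monomial_degree m) * Poly_Mapping.lookup (f * X i) m)" for m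
  proof (cases "Poly_Mapping.lookup m i = 0")
    case False
    show ?thesis
      unfolding T_def lookup_mult_X if_not_P[OF False] degree_minus_single[OF False] by simp
  qed (simp add: T_def lookup_mult_X)
  have eq: "(-1) ^ (d + monomial_degree m) * Poly_Mapping.lookup (f * (1 - X i)) m
     = (-1) ^ (d + monomial_degree m) * Poly_Mapping.lookup f m + T m" for m
    unfolding T by (simp add: right_diff_distrib lookup_minus)
  have pos: "0 \<le> (-1) ^ (d + monomial_degree m) * Poly_Mapping.lookup f m" for m
    using f by (simp add: alternating_def)
  have "0 \<le> T m" for m unfolding T_def using pos[of "m - Poly_Mapping.single i 1"] by simp
  then show "alternating d (f * (1 - X i))"
    unfolding alternating_def eq using pos by (intro allI add_nonneg_nonneg)
  have "Poly_Mapping.lookup (f * (1 - X i)) m = 0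
      \<longleftrightarrow> Poly_Mapping.lookup f m = 0 \<and> Poly_Mapping.lookup (f * X i) m = 0" for m
  proof -
    have "Poly_Mapping.lookup (f * (1 - X i)) m = 0
        \<longleftrightarrow> (-1) ^ (d + monomial_degree m) * Poly_Mapping.lookup (f * (1 - X i)) m = 0" by simp
    also have "\<dots> \<longleftrightarrow> (-1) ^ (d + monomial_degree m) * Poly_Mapping.lookup f m = 0 \<and> T m = 0"
      unfolding eq using pos[of m] \<open>0 \<le> T m\<close> by (rule add_nonneg_eq_0_iff)
    finally show ?thesis unfolding T by simp
  qed
  then show "Poly_Mapping.keys (f * (1 - X i))
      = Poly_Mapping.keys f \<union> (\<lambda>m. m + Poly_Mapping.single i 1) ` Poly_Mapping.keys f"
    unfolding keys_mult_X[symmetric] set_eq_iff Un_iff in_keys_iff by blast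
qed

lemma
  assumes f: "alternating d f"
  shows alternating_mult_powers: "alternating (d + s) (f * X i ^ s * (1 - X i) ^ t)"
    and keys_mult_powers: "Poly_Mapping.keys (f * X i ^ s * (1 - X i) ^ t)
      = {m + Poly_Mapping.single i u | m u. m \<in> Poly_Mapping.keys f \<and> s \<le> u \<and> u \<le> s + t}"
proof -
  have add1: "m + Poly_Mapping.single i u + Poly_Mapping.single i (Suc 0)
      = m + Poly_Mapping.single i (Suc u)" for m :: monomial and u
    by (simp add: add.assoc single_add[symmetric])
  have pow: "alternating (d + s) (f * X i ^ s) \<and> Poly_Mapping.keys (f * X i ^ s)
      = (\<lambda>m. m + Poly_Mapping.single i s) ` Poly_Mapping.keys f"
  proof (induction s)
    case (Suc s)
    have "f * X i ^ Suc s = (f * X i ^ s) * X i" by (simp add: mult_ac)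
    then show ?case
      using Suc alternating_mult_X[of "d + s" "f * X i ^ s" i]
      by (simp only: keys_mult_X image_image add1 One_nat_def) simp
  qed (use f in simp)
  have "alternating (d + s) (f * X i ^ s * (1 - X i) ^ t) \<and>
    Poly_Mapping.keys (f * X i ^ s * (1 - X i) ^ t)
      = {m + Poly_Mapping.single i u | m u. m \<in> Poly_Mapping.keys f \<and> s \<le> u \<and> u \<le> s + t}"
  proof (induction t)
    case 0
    then show ?case using pow by (auto simp: image_iff)
  next
    case (Suc t)
    let ?g = "f * X i ^ s * (1 - X i) ^ t"
    let ?M = "\<lambda>t. {m + Poly_Mapping.single i u | m u. m \<in> Poly_Mapping.keys f \<and> s \<le> u \<and> u \<le> s + t}"
    have g: "f * X i ^ s * (1 - X i) ^ Suc t = ?g * (1 - X i)" by (simp add: mult_ac)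
    have "?M (Suc t) = ?M t \<union> (\<lambda>m. m + Poly_Mapping.single i 1) ` ?M t"
    proof (intro equalityI subsetI)
      fix x assume "x \<in> ?M (Suc t)"
      then obtain m u where x: "x = m + Poly_Mapping.single i u" "m \<in> Poly_Mapping.keys f"
        "s \<le> u" "u \<le> s + Suc t" by blast
      show "x \<in> ?M t \<union> (\<lambda>m. m + Poly_Mapping.single i 1) ` ?M t"
      proof (cases "u \<le> s + t")
        case False
        then have "x = (m + Poly_Mapping.single i (s + t)) + Poly_Mapping.single i 1"
          using x by (simp add: add1 le_Suc_eq)
        moreover have "m + Poly_Mapping.single i (s + t) \<in> ?M t" using x(2) by force
        ultimately show ?thesis by blast
      qed (use x in blast)
    next
      fix x assume "x \<in> ?M t \<union> (\<lambda>m. m + Poly_Mapping.single i 1) ` ?M t"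
      then consider m u where "x = m + Poly_Mapping.single i u" "m \<in> Poly_Mapping.keys f"
          "s \<le> u" "u \<le> s + t"
        | m u where "x = m + Poly_Mapping.single i (Suc u)" "m \<in> Poly_Mapping.keys f"
          "s \<le> u" "u \<le> s + t" by (auto simp: add1)
      then show "x \<in> ?M (Suc t)"
      proof cases
        case 1 then show ?thesis by fastforce
      next
        case 2
        then have "s \<le> Suc u" "Suc u \<le> s + Suc t" by auto
        with 2 show ?thesis by blast
      qed
    qed
    then show ?case
      unfolding g using Suc alternating_mult_1_minus_X[of "d + s" ?g i]
        keys_mult_1_minus_X[of "d + s" ?g i] by simp
  qed
  then show "alternating (d + s) (f * X i ^ s * (1 - X i) ^ t)"
    "Poly_Mapping.keys (f * X i ^ s * (1 - X i) ^ t)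
      = {m + Poly_Mapping.single i u | m u. m \<in> Poly_Mapping.keys f \<and> s \<le> u \<and> u \<le> s + t}"
    by blast+
qed

definition strip_size :: "nat \<Rightarrow> (nat \<Rightarrow> nat) \<Rightarrow> (nat \<Rightarrow> nat) \<Rightarrow> nat" where
  "strip_size N \<mu> \<nu> = (\<Sum>r\<le>N. \<nu> r - \<mu> r)"

definition free_rows :: "nat \<Rightarrow> (nat \<Rightarrow> nat) \<Rightarrow> (nat \<Rightarrow> nat) \<Rightarrow> (nat \<Rightarrow> nat) \<Rightarrow> nat set" where
  "free_rows N \<rho> \<mu> \<nu> = {r \<in> {..N}. \<nu> (Suc r) < \<mu> r \<and> \<rho> r < \<mu> r}"

lemma strip_weight_eq_powers:
  "strip_weight N x \<rho> \<mu> \<nu> = (if horizontal_strip \<mu> \<nu>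
     then x ^ strip_size N \<mu> \<nu> * (1 - x) ^ card (free_rows N \<rho> \<mu> \<nu>) else 0)"
proof -
  have "card (free_rows N \<rho> \<mu> \<nu>) = (\<Sum>r\<le>N. of_bool (\<nu> (Suc r) < \<mu> r \<and> \<rho> r < \<mu> r))"
    unfolding free_rows_def by (simp add: sum.If_cases of_bool_def Int_def)
  then show ?thesis
    unfolding strip_weight_def strip_size_def by (simp only: prod.distrib power_sum)
qed

text \<open>
  The vector \<open>\<alpha>\<close> is the weight of a set-valued tableau on this chain: at each step any number of the free
  rows can receive an additional entry.
\<close>

definition flagged_chain ::
  "nat \<Rightarrow> (nat \<Rightarrow> nat \<Rightarrow> nat) \<Rightarrow> nat \<Rightarrow> (nat \<Rightarrow> nat \<Rightarrow> nat) \<Rightarrow> (nat \<Rightarrow> nat) \<Rightarrow> bool" where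
  "flagged_chain n R M \<Lambda> \<alpha> \<longleftrightarrow> \<Lambda> 0 = R 0 \<and> (\<forall>m<M. \<Lambda> m \<in> flagged_states n R m \<and>
     horizontal_strip (\<Lambda> m) (\<Lambda> (Suc m)) \<and>
     strip_size (Suc n) (\<Lambda> m) (\<Lambda> (Suc m)) \<le> \<alpha> (Suc m) \<and>
     \<alpha> (Suc m) \<le> strip_size (Suc n) (\<Lambda> m) (\<Lambda> (Suc m))
        + card (free_rows (Suc n) (R m) (\<Lambda> m) (\<Lambda> (Suc m))))"

lemma strip_size_eq:
  assumes "horizontal_strip \<mu> \<nu>"
  shows "sum \<nu> {..N} = sum \<mu> {..N} + strip_size N \<mu> \<nu>"
  unfolding strip_size_def sum.distrib[symmetric] using assms
  by (intro sum.cong refl) (simp add: horizontal_strip_def)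

lemma keys_chain_sum:
  assumes bounded: "\<And>r. n < r \<Longrightarrow> R n r = 0"
  shows "alternating (sum (R 0) {..Suc n} + sum \<nu> {..Suc n}) (chain_sum n R M \<nu>) \<and>
    (\<forall>a. a \<in> Poly_Mapping.keys (chain_sum n R M \<nu>) \<longleftrightarrow>
      (\<exists>\<Lambda>. \<Lambda> M = \<nu> \<and> flagged_chain n R M \<Lambda> (Poly_Mapping.lookup a)) \<and>
      (\<forall>i. i = 0 \<or> M < i \<longrightarrow> Poly_Mapping.lookup a i = 0))"
proof (induction M arbitrary: \<nu>)
  case 0
  have "a = 0 \<longleftrightarrow> (\<forall>i. i = 0 \<or> 0 < i \<longrightarrow> Poly_Mapping.lookup a i = 0)" for a :: monomial
    by (auto simp: poly_mapping_eq_iff fun_eq_iff)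
  then show ?case
    by (cases "\<nu> = R 0") (auto simp: alternating_even_1 flagged_chain_def intro: exI[of _ "\<lambda>_. R 0"])
next
  case (Suc M)
  let ?c = "sum (R 0) {..Suc n}"
  define g where "g \<mu> = chain_sum n R M \<mu> * strip_weight (Suc n) (X (Suc M)) (R M) \<mu> \<nu>" for \<mu>
  have g_eq: "g \<mu> = (if horizontal_strip \<mu> \<nu> then chain_sum n R M \<mu> * X (Suc M) ^ strip_size (Suc n) \<mu> \<nu>
      * (1 - X (Suc M)) ^ card (free_rows (Suc n) (R M) \<mu> \<nu>) else 0)" for \<mu>
    by (simp add: g_def strip_weight_eq_powers mult.assoc)
  have alt: "alternating (?c + sum \<nu> {..Suc n}) (g \<mu>)" for \<mu>
  proof (cases "horizontal_strip \<mu> \<nu>")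
    case True
    show ?thesis
      unfolding g_eq strip_size_eq[OF True] add.assoc[symmetric] using True Suc.IH[of \<mu>]
      by (simp only: if_True alternating_mult_powers)
  qed (simp add: g_eq)
  have fin: "finite (flagged_states n R M)" using bounded by (rule finite_flagged_states)
  have chain: "chain_sum n R (Suc M) \<nu> = sum g (flagged_states n R M)"
    by (simp add: g_def)
  have keys_g: "Poly_Mapping.keys (g \<mu>) = (if horizontal_strip \<mu> \<nu> then
      {a + Poly_Mapping.single (Suc M) u | a u. a \<in> Poly_Mapping.keys (chain_sum n R M \<mu>) \<and>
        strip_size (Suc n) \<mu> \<nu> \<le> u \<and>
        u \<le> strip_size (Suc n) \<mu> \<nu> + card (free_rows (Suc n) (R M) \<mu> \<nu>)} else {})" for \<mu>
    unfolding g_eq using keys_mult_powers[OF conjunct1[OF Suc.IH[of \<mu>]]]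
    by (simp only: if_distrib[of Poly_Mapping.keys] keys_zero)
  have "a \<in> Poly_Mapping.keys (chain_sum n R (Suc M) \<nu>) \<longleftrightarrow>
      (\<exists>\<Lambda>. \<Lambda> (Suc M) = \<nu> \<and> flagged_chain n R (Suc M) \<Lambda> (Poly_Mapping.lookup a)) \<and>
      (\<forall>i. i = 0 \<or> Suc M < i \<longrightarrow> Poly_Mapping.lookup a i = 0)" for a
  proof
    assume "a \<in> Poly_Mapping.keys (chain_sum n R (Suc M) \<nu>)"
    then obtain \<mu> where \<mu>: "\<mu> \<in> flagged_states n R M" "a \<in> Poly_Mapping.keys (g \<mu>)"
      unfolding chain sum_alternating(2)[OF fin alt] by blast
    then have strip: "horizontal_strip \<mu> \<nu>" by (auto simp: keys_g split: if_splits)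
    with \<mu> obtain a' u where a: "a = a' + Poly_Mapping.single (Suc M) u"
      "a' \<in> Poly_Mapping.keys (chain_sum n R M \<mu>)" "strip_size (Suc n) \<mu> \<nu> \<le> u"
      "u \<le> strip_size (Suc n) \<mu> \<nu> + card (free_rows (Suc n) (R M) \<mu> \<nu>)"
      by (auto simp: keys_g)
    obtain \<Lambda> where \<Lambda>: "\<Lambda> M = \<mu>" "flagged_chain n R M \<Lambda> (Poly_Mapping.lookup a')"
      and zero: "\<And>i. i = 0 \<or> M < i \<Longrightarrow> Poly_Mapping.lookup a' i = 0"
      using a(2) Suc.IH[of \<mu>] by blast
    have look: "Poly_Mapping.lookup a i = (if i = Suc M then u else Poly_Mapping.lookup a' i)" for i
      using zero[of i] by (auto simp: a(1) lookup_add lookup_single when_def)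
    have "flagged_chain n R (Suc M) (\<Lambda>(Suc M := \<nu>)) (Poly_Mapping.lookup a)"
      using \<Lambda> \<mu>(1) strip a(3,4) by (auto simp: flagged_chain_def look less_Suc_eq)
    then show "(\<exists>\<Lambda>. \<Lambda> (Suc M) = \<nu> \<and> flagged_chain n R (Suc M) \<Lambda> (Poly_Mapping.lookup a)) \<and>
      (\<forall>i. i = 0 \<or> Suc M < i \<longrightarrow> Poly_Mapping.lookup a i = 0)"
      using zero by (intro conjI exI[of _ "\<Lambda>(Suc M := \<nu>)"]) (simp_all add: look)
  next
    assume "(\<exists>\<Lambda>. \<Lambda> (Suc M) = \<nu> \<and> flagged_chain n R (Suc M) \<Lambda> (Poly_Mapping.lookup a)) \<and>
      (\<forall>i. i = 0 \<or> Suc M < i \<longrightarrow> Poly_Mapping.lookup a i = 0)"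
    then obtain \<Lambda> where \<Lambda>: "\<Lambda> (Suc M) = \<nu>" "flagged_chain n R (Suc M) \<Lambda> (Poly_Mapping.lookup a)"
      and zero: "\<And>i. i = 0 \<or> Suc M < i \<Longrightarrow> Poly_Mapping.lookup a i = 0" by blast
    define u a' where "u = Poly_Mapping.lookup a (Suc M)" and "a' = a - Poly_Mapping.single (Suc M) u"
    have a: "a = a' + Poly_Mapping.single (Suc M) u"
      by (simp add: a'_def u_def single_diff_add)
    have look: "Poly_Mapping.lookup a' i = (if i = Suc M then 0 else Poly_Mapping.lookup a i)" for i
      by (simp add: a'_def u_def lookup_minus lookup_single when_def)
    have "flagged_chain n R M \<Lambda> (Poly_Mapping.lookup a')"
      using \<Lambda>(2) by (auto simp: flagged_chain_def look)
    moreover have "\<forall>i. i = 0 \<or> M < i \<longrightarrow> Poly_Mapping.lookup a' i = 0"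
      using zero by (auto simp: look Suc_lessI)
    ultimately have a': "a' \<in> Poly_Mapping.keys (chain_sum n R M (\<Lambda> M))"
      using Suc.IH[of "\<Lambda> M"] by blast
    have step: "\<Lambda> M \<in> flagged_states n R M" "horizontal_strip (\<Lambda> M) \<nu>"
      "strip_size (Suc n) (\<Lambda> M) \<nu> \<le> u"
      "u \<le> strip_size (Suc n) (\<Lambda> M) \<nu> + card (free_rows (Suc n) (R M) (\<Lambda> M) \<nu>)"
      using \<Lambda> by (auto simp: flagged_chain_def u_def)
    have "a \<in> Poly_Mapping.keys (g (\<Lambda> M))"
      unfolding keys_g if_P[OF step(2)] using a a' step(3,4)
      by (intro CollectI exI[of _ a'] exI[of _ u] conjI)
    then show "a \<in> Poly_Mapping.keys (chain_sum n R (Suc M) \<nu>)"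
      unfolding chain sum_alternating(2)[OF fin alt] by (rule UN_I[OF step(1)])
  qed
  then show ?case
    using sum_alternating(1)[OF fin alt] unfolding chain by (intro conjI allI)
qed

section \<open>Threads of a bubbling diagram\<close>

text \<open>
  Moves change the row and the rank of a square by the same amount, so the difference of the two is
  inherited by the squares that a move creates. In the Rothe diagram it is the number of the square
  within its column, counted from the top, because the rank counts the empty positions above a square.
\<close>

definition thread :: "(square \<Rightarrow> int) \<Rightarrow> nat \<Rightarrow> nat \<Rightarrow> int" where
  "thread r i j = int i - r (i, j)"

text \<open>
  The reachable diagrams, described without reference to moves: each column splits into threads, one
  for each square of its column in the Rothe diagram. A thread has a single live square, at its top, its
  squares do not lie below the initial one, and the threads of a column are stacked in order. Dead
  squares of one row carry different thread numbers.
\<close>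

locale threaded =
  fixes n :: nat and w :: "nat \<Rightarrow> nat" and D :: "square set" and r :: "square \<Rightarrow> int"
    and F :: "square set"
  assumes grid: "D \<subseteq> {1..n} \<times> {1..n}"
    and dead: "F \<subseteq> D"
    and flag: "(i, j) \<in> D \<Longrightarrow> int (column_height n w (i - 1) j) < thread r i j"
    and thread_le: "(i, j) \<in> D \<Longrightarrow> thread r i j \<le> int (column_height n w n j)"
    and live_ex: "j \<in> {1..n} \<Longrightarrow> 1 \<le> k \<Longrightarrow> k \<le> column_height n w n j \<Longrightarrow>
      \<exists>i. (i, j) \<in> D - F \<and> thread r i j = int k"
    and thread_mono: "(i, j) \<in> D \<Longrightarrow> (i', j) \<in> D \<Longrightarrow> i < i' \<Longrightarrow> thread r i j \<le> thread r i' j"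
    and thread_live: "(i, j) \<in> D \<Longrightarrow> (i', j) \<in> D - F \<Longrightarrow> i < i' \<Longrightarrow> thread r i j < thread r i' j"
    and dead_distinct: "(i, j) \<in> F \<Longrightarrow> (i, j') \<in> F \<Longrightarrow> j \<noteq> j' \<Longrightarrow> thread r i j \<noteq> thread r i j'"
begin

lemma finite_D: "finite D"
  using grid finite_subset by blast

lemma row_pos: "(i, j) \<in> D \<Longrightarrow> 1 \<le> i \<and> i \<le> n \<and> 1 \<le> j \<and> j \<le> n"
  using grid by auto

lemma thread_pos: "(i, j) \<in> D \<Longrightarrow> 1 \<le> thread r i j"
  using flag[of i j] by linarith

lemma live_inj:
  assumes "(i, j) \<in> D - F" "(i', j) \<in> D - F" "thread r i j = thread r i' j"
  shows "i = i'"
  using thread_live[of i j i'] thread_live[of i' j i] assms by (cases i i' rule: linorder_cases) auto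

lemma live_less:
  assumes "(i, j) \<in> D - F" "(i', j) \<in> D" "thread r i j < thread r i' j"
  shows "i < i'"
  using thread_live[of i' j i] assms by (cases i i' rule: linorder_cases) auto

text \<open>
  The live square of the same thread exists somewhere in the column, and stacking puts it above.
\<close>

lemma live_above_dead:
  assumes "(i, j) \<in> F"
  obtains i0 where "(i0, j) \<in> D - F" "thread r i0 j = thread r i j" "i0 < i"
proof -
  have ij: "(i, j) \<in> D" using assms dead by blast
  obtain k where k: "thread r i j = int k" "1 \<le> k"
    using thread_pos[OF ij] by (metis nat_0_le nat_le_iff of_nat_1 order_trans zero_le_one nat_mono
        nat_one_as_int zle_iff_zadd)
  then obtain i0 where i0: "(i0, j) \<in> D - F" "thread r i0 j = int k"
    using live_ex[of j k] row_pos[OF ij] thread_le[OF ij] by auto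
  have "i0 \<noteq> i" using i0 assms by auto
  moreover have "\<not> i < i0" using thread_live[OF ij i0(1)] i0(2) k(1) by auto
  ultimately show ?thesis using that[OF i0(1)] i0 k by simp
qed

lemma thread_le_row: "(i, j) \<in> D \<Longrightarrow> thread r i j \<le> int i"
proof -
  have live: "int k \<le> int i" if "(i, j) \<in> D - F" "thread r i j = int k" for i j k
    using that
  proof (induction k arbitrary: i)
    case (Suc k)
    show ?case
    proof (cases "k = 0")
      case True
      then show ?thesis using row_pos[of i j] Suc.prems by auto
    next
      case False
      have "Suc k \<le> column_height n w n j" using thread_le[of i j] Suc.prems by auto
      then obtain i0 where i0: "(i0, j) \<in> D - F" "thread r i0 j = int k"
        using live_ex[of j k] False row_pos[of i j] Suc.prems by auto
      then have "i0 < i" using live_less[OF i0(1), of i] Suc.prems by auto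
      then show ?thesis using Suc.IH[OF i0] by simp
    qed
  qed simp
  have live: "thread r i j \<le> int i" if "(i, j) \<in> D - F" for i j
    using live[OF that, of "nat (thread r i j)"] thread_pos[of i j] that by auto
  assume ij: "(i, j) \<in> D"
  show ?thesis
  proof (cases "(i, j) \<in> F")
    case True
    then obtain i0 where "(i0, j) \<in> D - F" "thread r i0 j = thread r i j" "i0 < i"
      by (rule live_above_dead)
    then show ?thesis using live[of i0 j] by simp
  qed (use live ij in auto)
qed

lemma is_bubbling_diagram: "is_bubbling_diagram n n (D, r, F)"
proof -
  have nonneg: "0 \<le> r s" if "s \<in> D" for s
    using thread_le_row[of "fst s" "snd s"] that by (simp add: thread_def)
  have above: "(\<exists>i'<i. (i', j) \<in> D - F) \<and>
      r (i, j) - r (Max {i'. i' < i \<and> (i', j) \<in> D - F}, j)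
        = int i - int (Max {i'. i' < i \<and> (i', j) \<in> D - F})" if ij: "(i, j) \<in> F" for i j
  proof -
    obtain i0 where i0: "(i0, j) \<in> D - F" "thread r i0 j = thread r i j" "i0 < i"
      using ij by (rule live_above_dead)
    have "i' \<le> i0" if "(i', j) \<in> D - F" "i' < i" for i'
    proof (rule ccontr)
      assume "\<not> i' \<le> i0"
      then have "thread r i0 j < thread r i' j" using thread_live[of i0 j i'] that(1) i0(1) by auto
      moreover have "thread r i' j \<le> thread r i j"
        using thread_mono[of i' j i] that ij dead by auto
      ultimately show False using i0(2) by simp
    qed
    then have "Max {i'. i' < i \<and> (i', j) \<in> D - F} = i0"
      using i0 by (intro Max_eqI) auto
    then show ?thesis using i0 by (auto simp: thread_def)
  qed
  have distinct: "r (i, j) \<noteq> r (i, k')" if "(i, j) \<in> F" "(i, k') \<in> F" "j \<noteq> k'" for i j k'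
    using dead_distinct[OF that] by (simp add: thread_def)
  show ?thesis
    unfolding is_bubbling_diagram_def Let_def using grid dead nonneg above distinct by fast
qed

end

text \<open>
  Both kinds of moves at once: the live square leaves its position empty, or it remains there as a dead
  square.
\<close>

lemma threaded_raise:
  assumes T: "threaded n w D r F" and i: "i \<ge> 2" and ij: "(i, j) \<in> D - F" and e: "(i - 1, j) \<notin> D"
    and left: "D' = D - {(i, j)} \<and> F' = F \<or>
      D' = D \<and> F' = insert (i, j) F \<and> \<not> (\<exists>k'. (i, k') \<in> F \<and> r (i, k') = r (i, j))"
  shows "threaded n w (insert (i - 1, j) D') (r((i - 1, j) := r (i, j) - 1)) F'"
proof -
  interpret threaded n w D r F by (rule T)
  let ?r = "r((i - 1, j) := r (i, j) - 1)" and ?D = "insert (i - 1, j) D'"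
  have sub: "D' \<subseteq> D" "F' \<subseteq> D'" "(i, j) \<notin> D' - F'" "F \<subseteq> F'"
    "\<And>s. s \<in> D - F \<Longrightarrow> s \<noteq> (i, j) \<Longrightarrow> s \<in> D' - F'"
    using left dead ij by auto
  have new: "thread ?r (i - 1) j = thread r i j" using i by (simp add: thread_def)
  have old: "thread ?r p q = thread r p q" if "(p, q) \<in> D" for p q
    using that e by (auto simp: thread_def)
  have ijD: "(i, j) \<in> D" using ij by auto
  show ?thesis
  proof
    show "?D \<subseteq> {1..n} \<times> {1..n}" using sub(1) grid row_pos[OF ijD] i by auto
    show "F' \<subseteq> ?D" using sub(2) by auto
    fix p q assume pq: "(p, q) \<in> ?D"
    show "int (column_height n w (p - 1) q) < thread ?r p q"
    proof (cases "(p, q) = (i - 1, j)")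
      case True
      then show ?thesis
        using new flag[OF ijD] column_height_mono[OF diff_le_self[of "i - 1" 1], of n w j] by simp
    qed (use pq sub(1) old flag in auto)
    show "thread ?r p q \<le> int (column_height n w n q)"
      using pq sub(1) new old thread_le ijD by auto
    fix p'
    have strict: "thread ?r p q < thread ?r (i - 1) j" if "q = j" "p < i - 1"
      using that pq sub(1) old[of p q] new thread_live[OF _ ij, of p] by auto
    show "thread ?r p q \<le> thread ?r p' q" if *: "(p', q) \<in> ?D" "p < p'"
    proof (cases "(p', q) = (i - 1, j)")
      case True
      then show ?thesis using strict *(2) by (auto simp: le_less)
    next
      case False
      then have p'D: "(p', q) \<in> D" and p': "thread ?r p' q = thread r p' q" using *(1) sub(1) old by auto
      show ?thesis
      proof (cases "(p, q) = (i - 1, j)")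
        case True
        then have "thread ?r p q = thread r i j" "thread ?r p' q = thread r p' j"
          using new p' by auto
        moreover have "(p', j) \<in> D" "i < p' \<or> p' = i" using True * p'D i by auto
        ultimately show ?thesis using thread_mono[OF ijD, of p'] by auto
      next
        case False
        then have "(p, q) \<in> D" using pq sub(1) by auto
        then show ?thesis using thread_mono[of p q p'] old[of p q] p' p'D * by auto
      qed
    qed
    show "thread ?r p q < thread ?r p' q" if *: "(p', q) \<in> ?D - F'" "p < p'"
    proof (cases "(p', q) = (i - 1, j)")
      case True
      then show ?thesis using strict *(2) by auto
    next
      case False
      then have p'D: "(p', q) \<in> D" and p': "thread ?r p' q = thread r p' q" using *(1) sub(1) old by auto
      show ?thesis
      proof (cases "(p, q) = (i - 1, j)")
        case True
        then have "thread ?r p q = thread r i j" "thread ?r p' q = thread r p' j"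
          using new p' by auto
        moreover have "p' \<noteq> i" using True * sub(3) i by auto
        moreover have "(p', j) \<in> D - F" "i \<le> p'" using True * i p'D sub(4) by auto
        ultimately show ?thesis using thread_live[OF ijD, of p'] by (simp add: le_less)
      next
        case False
        then have "(p, q) \<in> D" using pq sub(1) by auto
        then show ?thesis using thread_live[of p q p'] old[of p q] p' p'D * subsetD[OF sub(4), of "(p', q)"] by auto
      qed
    qed
  next
    fix q k assume "q \<in> {1..n}" "1 \<le> k" "k \<le> column_height n w n q"
    then obtain p where p: "(p, q) \<in> D - F" "thread r p q = int k" using live_ex by blast
    show "\<exists>p. (p, q) \<in> ?D - F' \<and> thread ?r p q = int k"
    proof (cases "(p, q) = (i, j)")
      case True
      moreover have "(i - 1, j) \<notin> F'" using sub(1,2) e by blast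
      ultimately show ?thesis using new p by (intro exI[of _ "i - 1"]) auto
    next
      case False
      then show ?thesis using old p sub(5) by (intro exI[of _ p]) auto
    qed
  next
    have ne: "F' = F \<or> F' = insert (i, j) F \<and> (\<forall>q. (i, q) \<in> F \<longrightarrow> thread r i j \<noteq> thread r i q)"
      using left by (auto simp: thread_def)
    fix p q q' assume F: "(p, q) \<in> F'" "(p, q') \<in> F'" "q \<noteq> q'"
    then have "(p, q) \<in> D" "(p, q') \<in> D" using sub(1,2) by auto
    moreover have "thread r p q \<noteq> thread r p q'"
      using F ne dead_distinct[of p q q'] by auto
    ultimately show "thread ?r p q \<noteq> thread ?r p q'" by (simp only: old not_False_eq_True)
  qed
qed

section \<open>Reachability\<close>

text \<open>
  A row \<open>p < i\<close> either has \<open>w p < j\<close>, which the rank counts, or meets column \<open>j\<close> of the diagram.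
\<close>

lemma rothe_rank_eq:
  assumes w: "w permutes {1..n}" and ij: "(i, j) \<in> rothe_diagram n w"
  shows "rothe_rank n w (i, j) + int (column_height n w i j) = int i"
proof -
  have j: "j \<in> {1..n}" and i: "i \<in> {1..n}" using ij by (auto simp: rothe_diagram_def)
  obtain q where q: "q \<in> {1..n}" "j = w q"
    using permutes_image[OF w] j by (metis image_iff)
  note mem = mem_rothe_column_image[OF w q(1), folded q(2)]
  have iC: "i \<in> rothe_column n w j" using ij by (simp add: rothe_column_def)
  then have iq: "i < q" using mem[of i] by simp
  let ?L = "{p \<in> {1..n}. p < i \<and> w p < j}" and ?H = "rothe_column n w j \<inter> {1..i}"
  have ne: "w p \<noteq> j" if "p < i" for p
  proof -
    have "p \<noteq> q" using that iq by simp
    then show ?thesis using permutes_inj[OF w] q(2) by (metis injD)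
  qed
  have "p \<in> ?L \<union> ?H \<longleftrightarrow> p \<in> {1..i}" for p
  proof -
    consider "p < i" | "p = i" | "i < p" by linarith
    then show ?thesis
    proof cases
      case 1
      then show ?thesis using ne[OF 1] i iq mem[of p] by auto
    next
      case 2
      then show ?thesis using iC i by simp
    next
      case 3
      then show ?thesis by simp
    qed
  qed
  then have un: "?L \<union> ?H = {1..i}" by blast
  have "p \<notin> ?H" if "p \<in> ?L" for p using mem[of p] that by auto
  then have "?L \<inter> ?H = {}" by blast
  then have "card ?L + card ?H = i"
    using card_Un_disjoint[of ?L ?H] un by simp
  then show ?thesis by (simp add: rothe_rank_def column_height_def)
qed

lemma thread_rothe:
  assumes "w permutes {1..n}" "(i, j) \<in> rothe_diagram n w"
  shows "thread (rothe_rank n w) i j = int (column_height n w i j)"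
  using rothe_rank_eq[OF assms] by (simp add: thread_def)

lemma column_height_pred:
  assumes "(i, j) \<in> rothe_diagram n w"
  shows "column_height n w i j = Suc (column_height n w (i - 1) j)"
proof -
  obtain i0 where "i = Suc i0" using assms by (cases i) (auto simp: rothe_diagram_def)
  then show ?thesis using assms by (simp add: column_height_Suc rothe_column_def)
qed

lemma column_height_less:
  assumes "i < i'" "(i', j) \<in> rothe_diagram n w"
  shows "column_height n w i j < column_height n w i' j"
proof -
  have "i \<le> i' - 1" using assms(1) by simp
  from column_height_mono[OF this, of n w j] show ?thesis
    using column_height_pred[OF assms(2)] by simp
qed

lemma column_height_attained:
  assumes "1 \<le> k" "k \<le> column_height n w n j"
  obtains i where "(i, j) \<in> rothe_diagram n w" "column_height n w i j = k"
proof -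
  have "\<not> k \<le> column_height n w 0 j" using assms(1) by (simp add: column_height_def)
  then obtain q where "\<not> k \<le> column_height n w q j" "k \<le> column_height n w (Suc q) j"
    using first_entry[of 0 n "{m. k \<le> column_height n w m j}"] assms(2) by auto
  then show ?thesis
    using that[of "Suc q"]
    by (cases "(Suc q, j) \<in> rothe_diagram n w") (auto simp: column_height_Suc rothe_column_def)
qed

lemma threaded_rothe:
  assumes w: "w permutes {1..n}"
  shows "threaded n w (rothe_diagram n w) (rothe_rank n w) {}"
proof
  show "rothe_diagram n w \<subseteq> {1..n} \<times> {1..n}" by (auto simp: rothe_diagram_def)
  fix i j assume ij: "(i, j) \<in> rothe_diagram n w"
  then have "i \<le> n" by (auto simp: rothe_diagram_def)
  then show "thread (rothe_rank n w) i j \<le> int (column_height n w n j)"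
    using thread_rothe[OF w ij] column_height_mono[of i n n w j] by simp
  show "int (column_height n w (i - 1) j) < thread (rothe_rank n w) i j"
    using thread_rothe[OF w ij] column_height_pred[OF ij] by simp
  fix i'
  show "thread (rothe_rank n w) i j \<le> thread (rothe_rank n w) i' j"
    if "(i', j) \<in> rothe_diagram n w" "i < i'"
    using thread_rothe[OF w ij] thread_rothe[OF w that(1)] column_height_less[OF that(2,1)] by simp
  show "thread (rothe_rank n w) i j < thread (rothe_rank n w) i' j"
    if "(i', j) \<in> rothe_diagram n w - {}" "i < i'"
    using thread_rothe[OF w ij] thread_rothe[OF w, of i' j] column_height_less[OF that(2), of j n w]
      that(1) by simp
next
  fix j k assume "j \<in> {1..n}" "1 \<le> k" "k \<le> column_height n w n j"
  then obtain i where i: "(i, j) \<in> rothe_diagram n w" "column_height n w i j = k"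
    using column_height_attained[of k n w j] by blast
  then show "\<exists>i. (i, j) \<in> rothe_diagram n w - {} \<and> thread (rothe_rank n w) i j = int k"
    using thread_rothe[OF w i(1)] by (intro exI[of _ i]) simp
qed auto

lemma threaded_step:
  assumes "bubbling_step (D, r, F) (D', r', F')" "threaded n w D r F"
  shows "threaded n w D' r' F'"
  using assms
  by (cases rule: bubbling_step.cases) (blast intro: threaded_raise)+

lemma threaded_reachable:
  assumes w: "w permutes {1..n}" and reach: "bubbling_step\<^sup>*\<^sup>* (rothe_bubbling n w) (D, r, F)"
  shows "threaded n w D r F"
proof -
  have "case \<D> of (D, r, F) \<Rightarrow> threaded n w D r F"
    if "bubbling_step\<^sup>*\<^sup>* (rothe_bubbling n w) \<D>" for \<D>
    using that
  proof (induction rule: rtranclp_induct)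
    case base
    then show ?case using threaded_rothe[OF w] by (simp add: rothe_bubbling_def)
  next
    case (step y z)
    then show ?case by (cases y; cases z) (auto intro: threaded_step)
  qed
  then show ?thesis using reach by fastforce
qed

context threaded
begin

text \<open>
  If no live square can be moved down, then no thread contains a dead square, since otherwise the position
  below its live square would be dead or could be occupied; and the lowest live square that is above its
  initial position would have a live square directly below it, which again is too high.
\<close>

lemma stuck_is_rothe:
  assumes stuck: "\<And>i j. (i, j) \<in> D - F \<Longrightarrow> (Suc i, j) \<notin> F \<and>
      ((Suc i, j) \<notin> D \<longrightarrow> thread r i j \<le> int (column_height n w i j))"
    and w: "w permutes {1..n}"
  shows "F = {}" and "D = rothe_diagram n w" and "\<And>s. s \<in> D \<Longrightarrow> r s = rothe_rank n w s"
proof -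
  show F: "F = {}"
  proof (rule ccontr)
    assume "F \<noteq> {}"
    then obtain i j where ij: "(i, j) \<in> F" by auto
    have ijD: "(i, j) \<in> D" using ij dead by blast
    obtain i0 where i0: "(i0, j) \<in> D - F" "thread r i0 j = thread r i j" "i0 < i"
      using ij by (rule live_above_dead)
    have nF: "(Suc i0, j) \<notin> F" using stuck[OF i0(1)] by simp
    then have lt: "Suc i0 < i" using i0(3) ij by (cases "Suc i0 = i") auto
    show False
    proof (cases "(Suc i0, j) \<in> D")
      case True
      then have "thread r i0 j < thread r (Suc i0) j" using thread_live[of i0 j "Suc i0"] i0(1) nF by auto
      then show False using thread_mono[OF True ijD lt] i0(2) by simp
    next
      case False
      have "column_height n w i0 j \<le> column_height n w (i - 1) j"
        using i0(3) by (intro column_height_mono) simp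
      then show False using stuck[OF i0(1)] False flag[OF ijD] i0(2) by simp
    qed
  qed
  have height: "int (column_height n w i j) = thread r i j" if ij: "(i, j) \<in> D" for i j
  proof -
    have ge: "thread r i j \<le> int (column_height n w i j)"
      using ij
    proof (induction "n - i" arbitrary: i rule: less_induct)
      case less
      show ?case
      proof (cases "(Suc i, j) \<in> D")
        case False
        then show ?thesis using stuck[of i j] less.prems F by simp
      next
        case True
        have "n - Suc i < n - i" using row_pos[OF True] by linarith
        then have "thread r (Suc i) j \<le> int (column_height n w (Suc i) j)"
          using less.hyps[OF _ True] by simp
        moreover have "thread r i j < thread r (Suc i) j"
          using thread_live[OF less.prems, of "Suc i"] True F by simp
        moreover have "column_height n w (Suc i) j \<le> Suc (column_height n w i j)"
          by (simp add: column_height_Suc)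
        ultimately show ?thesis by linarith
      qed
    qed
    obtain i0 where "i = Suc i0" using row_pos[OF ij] by (cases i) auto
    then show ?thesis
      using ge flag[OF ij]
      by (cases "i \<in> rothe_column n w j") (auto simp: column_height_Suc)
  qed
  have sub: "(i, j) \<in> rothe_diagram n w" if ij: "(i, j) \<in> D" for i j
  proof -
    obtain i0 where i0: "i = Suc i0" using row_pos[OF ij] by (cases i) auto
    then show ?thesis
      using height[OF ij] flag[OF ij]
      by (cases "(i, j) \<in> rothe_diagram n w") (auto simp: column_height_Suc rothe_column_def)
  qed
  show "D = rothe_diagram n w"
  proof (intro equalityI subsetI)
    fix s assume s: "s \<in> rothe_diagram n w"
    obtain i j where ij: "s = (i, j)" by (cases s)
    have i: "i \<le> n" "j \<in> {1..n}" using s ij by (auto simp: rothe_diagram_def)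
    have "1 \<le> column_height n w i j" using column_height_pred s ij by auto
    moreover have "column_height n w i j \<le> column_height n w n j"
      using i by (intro column_height_mono)
    ultimately obtain i0 where i0: "(i0, j) \<in> D - F" "thread r i0 j = int (column_height n w i j)"
      using live_ex[OF i(2)] by blast
    have "column_height n w i0 j = column_height n w i j" using height[of i0 j] i0 by auto
    moreover have "(i0, j) \<in> rothe_diagram n w" using sub i0(1) by auto
    ultimately have "i0 = i"
      using column_height_less[of i i0 j n w] column_height_less[of i0 i j n w] s ij
      by (cases i i0 rule: linorder_cases) auto
    then show "s \<in> D" using i0 ij by auto
  qed (use sub in auto)
  fix s assume s: "s \<in> D"
  obtain i j where ij: "s = (i, j)" by (cases s)
  have "thread (rothe_rank n w) i j = thread r i j"
    using thread_rothe[OF w sub, of i j] height[of i j] s ij by simp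
  then show "r s = rothe_rank n w s" by (simp add: thread_def ij)
qed

lemma threaded_undo_K_bubble:
  assumes ij: "(i, j) \<in> D - F" and below: "(Suc i, j) \<in> F"
  shows "threaded n w (D - {(i, j)}) r (F - {(Suc i, j)})" and "thread r (Suc i) j = thread r i j"
proof -
  have bD: "(Suc i, j) \<in> D" using below dead by blast
  obtain i0 where i0: "(i0, j) \<in> D - F" "thread r i0 j = thread r (Suc i) j" "i0 < Suc i"
    using below by (rule live_above_dead)
  have "i0 = i"
  proof (rule ccontr)
    assume "i0 \<noteq> i"
    then have "thread r i0 j < thread r i j" using thread_live[OF _ ij, of i0] i0 by auto
    then show False using thread_mono[of i j "Suc i"] ij bD i0(2) by auto
  qed
  then show same: "thread r (Suc i) j = thread r i j" using i0 by simp
  show "threaded n w (D - {(i, j)}) r (F - {(Suc i, j)})"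
  proof
    show "D - {(i, j)} \<subseteq> {1..n} \<times> {1..n}" using grid by auto
    show "F - {(Suc i, j)} \<subseteq> D - {(i, j)}" using dead ij by auto
    fix p q assume pq: "(p, q) \<in> D - {(i, j)}"
    show "int (column_height n w (p - 1) q) < thread r p q" using flag pq by auto
    show "thread r p q \<le> int (column_height n w n q)" using thread_le pq by auto
    fix p'
    show "thread r p q \<le> thread r p' q" if "(p', q) \<in> D - {(i, j)}" "p < p'"
      using thread_mono that pq by auto
    show "thread r p q < thread r p' q"
      if *: "(p', q) \<in> D - {(i, j)} - (F - {(Suc i, j)})" "p < p'"
    proof (cases "(p', q) = (Suc i, j)")
      case True
      then have "p < i" using pq *(2) by (auto simp: less_Suc_eq)
      then show ?thesis using thread_live[OF _ ij, of p] pq True same by auto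
    qed (use thread_live[of p q p'] * pq in auto)
  next
    fix q k assume "q \<in> {1..n}" "1 \<le> k" "k \<le> column_height n w n q"
    then obtain p where p: "(p, q) \<in> D - F" "thread r p q = int k" using live_ex by blast
    show "\<exists>p. (p, q) \<in> D - {(i, j)} - (F - {(Suc i, j)}) \<and> thread r p q = int k"
    proof (cases "(p, q) = (i, j)")
      case True
      then show ?thesis using same p bD by (intro exI[of _ "Suc i"]) auto
    next
      case False
      then show ?thesis using p by (intro exI[of _ p]) auto
    qed
  qed (use dead_distinct in auto)
qed

lemma threaded_undo_bubble:
  assumes ij: "(i, j) \<in> D - F" and below: "(Suc i, j) \<notin> D"
    and room: "int (column_height n w i j) < thread r i j"
  shows "threaded n w (insert (Suc i, j) (D - {(i, j)})) (r((Suc i, j) := r (i, j) + 1)) F"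
proof -
  let ?r = "r((Suc i, j) := r (i, j) + 1)" and ?D = "insert (Suc i, j) (D - {(i, j)})"
  have new: "thread ?r (Suc i) j = thread r i j" by (simp add: thread_def)
  have old: "thread ?r p q = thread r p q" if "(p, q) \<in> D" for p q
    using that below by (auto simp: thread_def)
  have ijD: "(i, j) \<in> D" using ij by auto
  have "i < n"
  proof (rule ccontr)
    assume "\<not> i < n"
    then have "i = n" using row_pos[OF ijD] by simp
    then show False using room thread_le[OF ijD] by simp
  qed
  show ?thesis
  proof
    show "?D \<subseteq> {1..n} \<times> {1..n}" using grid row_pos[OF ijD] \<open>i < n\<close> by auto
    show "F \<subseteq> ?D" using dead ij by auto
    fix p q assume pq: "(p, q) \<in> ?D"
    show "int (column_height n w (p - 1) q) < thread ?r p q"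
      using pq new old flag room by (cases "(p, q) = (Suc i, j)") auto
    show "thread ?r p q \<le> int (column_height n w n q)"
      using pq new old thread_le ijD by auto
    fix p'
    have strict: "thread ?r p q < thread ?r (Suc i) j" if "q = j" "p < Suc i"
    proof -
      have "(p, q) \<in> D" "p < i" using that pq by (auto simp: less_Suc_eq)
      then show ?thesis using that old[of p q] new thread_live[OF _ ij, of p] by auto
    qed
    show "thread ?r p q \<le> thread ?r p' q" if *: "(p', q) \<in> ?D" "p < p'"
    proof (cases "(p', q) = (Suc i, j)")
      case True
      then show ?thesis using strict *(2) by (auto simp: le_less)
    next
      case False
      then have p'D: "(p', q) \<in> D" and p': "thread ?r p' q = thread r p' q" using *(1) old by auto
      show ?thesis
      proof (cases "(p, q) = (Suc i, j)")
        case True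
        then have "thread ?r p q = thread r i j" "thread ?r p' q = thread r p' j"
          using new p' by auto
        moreover have "(p', j) \<in> D" "i < p'" using True * p'D by auto
        ultimately show ?thesis using thread_mono[OF ijD, of p'] by simp
      next
        case False
        then have "(p, q) \<in> D" using pq by auto
        then show ?thesis using thread_mono[of p q p'] old[of p q] p' p'D * by auto
      qed
    qed
    show "thread ?r p q < thread ?r p' q" if *: "(p', q) \<in> ?D - F" "p < p'"
    proof (cases "(p', q) = (Suc i, j)")
      case True
      then show ?thesis using strict *(2) by auto
    next
      case False
      then have p'D: "(p', q) \<in> D" and p': "thread ?r p' q = thread r p' q" using *(1) old by auto
      show ?thesis
      proof (cases "(p, q) = (Suc i, j)")
        case True
        then have "thread ?r p q = thread r i j" "thread ?r p' q = thread r p' j"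
          using new p' by auto
        moreover have "(p', j) \<in> D - F" "i < p'" using True * p'D by auto
        ultimately show ?thesis using thread_live[OF ijD, of p'] by simp
      next
        case False
        then have "(p, q) \<in> D" using pq by auto
        then show ?thesis using thread_live[of p q p'] old[of p q] p' p'D * by auto
      qed
    qed
  next
    fix q k assume "q \<in> {1..n}" "1 \<le> k" "k \<le> column_height n w n q"
    then obtain p where p: "(p, q) \<in> D - F" "thread r p q = int k" using live_ex by blast
    show "\<exists>p. (p, q) \<in> ?D - F \<and> thread ?r p q = int k"
    proof (cases "(p, q) = (i, j)")
      case True
      then show ?thesis using new p below dead by (intro exI[of _ "Suc i"]) auto
    next
      case False
      then show ?thesis using old p by (intro exI[of _ p]) auto
    qed
  next
    fix p q q' assume F: "(p, q) \<in> F" "(p, q') \<in> F" "q \<noteq> q'"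
    then have "(p, q) \<in> D" "(p, q') \<in> D" using dead by auto
    then show "thread ?r p q \<noteq> thread ?r p q'" using dead_distinct[OF F] by (simp only: old not_False_eq_True)
  qed
qed

end

text \<open>
  Moves are undone until none can be undone. The ranks agree on the diagram only, since
  a move leaves behind an arbitrary value at the position that becomes empty.
\<close>

lemma reachable_threaded:
  assumes w: "w permutes {1..n}" and "threaded n w D r F"
  shows "\<exists>r'. (\<forall>s\<in>D. r' s = r s) \<and> bubbling_step\<^sup>*\<^sup>* (rothe_bubbling n w) (D, r', F)"
  using assms(2)
proof (induction "\<Sum>s\<in>D. Suc n - fst s" arbitrary: D r F rule: less_induct)
  case less
  interpret threaded n w D r F by (rule less.prems)
  consider (K) i j where "(i, j) \<in> D - F" "(Suc i, j) \<in> F"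
    | (B) i j where "(i, j) \<in> D - F" "(Suc i, j) \<notin> D" "int (column_height n w i j) < thread r i j"
    | (stuck) "\<And>i j. (i, j) \<in> D - F \<Longrightarrow> (Suc i, j) \<notin> F \<and>
        ((Suc i, j) \<notin> D \<longrightarrow> thread r i j \<le> int (column_height n w i j))"
    by (meson not_le)
  then show ?case
  proof cases
    case K
    let ?D = "D - {(i, j)}" and ?F = "F - {(Suc i, j)}"
    have ijD: "(i, j) \<in> D" using K by auto
    have bD: "(Suc i, j) \<in> ?D" using K dead by auto
    have T: "threaded n w ?D r ?F" and same: "thread r (Suc i) j = thread r i j"
      using threaded_undo_K_bubble[OF K] by auto
    have "(\<Sum>s\<in>D. Suc n - fst s) = (Suc n - i) + (\<Sum>s\<in>?D. Suc n - fst s)"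
      using sum.remove[OF finite_D ijD, of "\<lambda>s. Suc n - fst s"] by simp
    then have "(\<Sum>s\<in>?D. Suc n - fst s) < (\<Sum>s\<in>D. Suc n - fst s)"
      using row_pos[OF ijD] by linarith
    then obtain r' where r': "\<forall>s\<in>?D. r' s = r s"
      and reach: "bubbling_step\<^sup>*\<^sup>* (rothe_bubbling n w) (?D, r', ?F)"
      using less.hyps[OF _ T] by blast
    have "\<not> (\<exists>k'. (Suc i, k') \<in> ?F \<and> r' (Suc i, k') = r' (Suc i, j))"
    proof
      assume "\<exists>k'. (Suc i, k') \<in> ?F \<and> r' (Suc i, k') = r' (Suc i, j)"
      then obtain k' where k': "(Suc i, k') \<in> F" "k' \<noteq> j" "r' (Suc i, k') = r' (Suc i, j)" by auto
      then have "r (Suc i, k') = r (Suc i, j)" using r' bD dead by auto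
      then show False using dead_distinct[OF k'(1) K(2) k'(2)] by (simp add: thread_def)
    qed
    then have "bubbling_step (?D, r', ?F)
        (insert (Suc i - 1, j) ?D, r'((Suc i - 1, j) := r' (Suc i, j) - 1), insert (Suc i, j) ?F)"
      using bD row_pos[OF ijD] by (intro K_bubble) auto
    moreover have "insert (Suc i - 1, j) ?D = D" "insert (Suc i, j) ?F = F" using ijD K(2) by auto
    ultimately have "bubbling_step\<^sup>*\<^sup>* (rothe_bubbling n w) (D, r'((i, j) := r' (Suc i, j) - 1), F)"
      using reach by simp
    moreover have "(r'((i, j) := r' (Suc i, j) - 1)) s = r s" if "s \<in> D" for s
      using that r' bD same by (auto simp: thread_def)
    ultimately show ?thesis by blast
  next
    case B
    let ?D = "insert (Suc i, j) (D - {(i, j)})" and ?r = "r((Suc i, j) := r (i, j) + 1)"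
    have ijD: "(i, j) \<in> D" using B by auto
    have T: "threaded n w ?D ?r F" using threaded_undo_bubble[OF B] .
    have "(\<Sum>s\<in>D. Suc n - fst s) = (Suc n - i) + (\<Sum>s\<in>D - {(i, j)}. Suc n - fst s)"
      using sum.remove[OF finite_D ijD, of "\<lambda>s. Suc n - fst s"] by simp
    moreover have "(\<Sum>s\<in>?D. Suc n - fst s) = (Suc n - Suc i) + (\<Sum>s\<in>D - {(i, j)}. Suc n - fst s)"
      using B(2) finite_D by (subst sum.insert) auto
    ultimately have "(\<Sum>s\<in>?D. Suc n - fst s) < (\<Sum>s\<in>D. Suc n - fst s)"
      using row_pos[OF ijD] by linarith
    then obtain r' where r': "\<forall>s\<in>?D. r' s = ?r s"
      and reach: "bubbling_step\<^sup>*\<^sup>* (rothe_bubbling n w) (?D, r', F)"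
      using less.hyps[OF _ T] by blast
    have "(Suc i, j) \<notin> F" using B(2) dead by auto
    then have "bubbling_step (?D, r', F)
        (insert (Suc i - 1, j) (?D - {(Suc i, j)}), r'((Suc i - 1, j) := r' (Suc i, j) - 1), F)"
      using row_pos[OF ijD] by (intro bubble) auto
    moreover have "insert (Suc i - 1, j) (?D - {(Suc i, j)}) = D" using ijD B(2) by auto
    ultimately have "bubbling_step\<^sup>*\<^sup>* (rothe_bubbling n w) (D, r'((i, j) := r' (Suc i, j) - 1), F)"
      using reach by simp
    moreover have "(r'((i, j) := r' (Suc i, j) - 1)) s = r s" if "s \<in> D" for s
      using that r' B(2) by auto
    ultimately show ?thesis by blast
  next
    case stuck
    note initial = stuck_is_rothe[OF stuck w]
    have "bubbling_step\<^sup>*\<^sup>* (rothe_bubbling n w) (D, rothe_rank n w, F)"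
      using initial(1,2) by (simp add: rothe_bubbling_def)
    then show ?thesis using initial(3) by (intro exI[of _ "rothe_rank n w"]) auto
  qed
qed

section \<open>From bubbling diagrams to flagged chains\<close>

context threaded
begin

text \<open>
  The columns whose \<open>k\<close>-th thread has its live square in one of the rows \<open>1, \<dots>, m\<close>. Counting these columns
  has the effect of sorting the rows of a tableau, and the conditions on a flagged chain
  become inclusions between such sets, which hold whatever the order of the columns is. All columns count
  for \<open>k = 0\<close>, in accordance with row \<open>0\<close> of a partition.
\<close>

definition reached :: "nat \<Rightarrow> nat \<Rightarrow> nat set" where
  "reached m k = {j \<in> {1..n}. k = 0 \<or> (\<exists>i\<le>m. (i, j) \<in> D - F \<and> thread r i j = int k)}"

definition reached_count :: "nat \<Rightarrow> nat \<Rightarrow> nat" where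
  "reached_count m k = card (reached m k)"

lemma finite_reached [simp]: "finite (reached m k)"
  by (simp add: reached_def)

lemma reachedI:
  "j \<in> {1..n} \<Longrightarrow> i \<le> m \<Longrightarrow> (i, j) \<in> D - F \<Longrightarrow> thread r i j = int k \<Longrightarrow> j \<in> reached m k"
  unfolding reached_def by blast

lemma reached_mono: "m \<le> m' \<Longrightarrow> reached m k \<subseteq> reached m' k"
  unfolding reached_def using le_trans by blast

lemma reached_0: "reached m 0 = {1..n}"
  by (auto simp: reached_def)

text \<open>
  The live square of thread \<open>k\<close> lies strictly above that of thread \<open>k + 1\<close>.
\<close>

lemma reached_Suc: "reached (Suc m) (Suc k) \<subseteq> reached m k"
proof
  fix j assume "j \<in> reached (Suc m) (Suc k)"
  then obtain i where j: "j \<in> {1..n}" and i: "i \<le> Suc m" "(i, j) \<in> D - F" "thread r i j = int (Suc k)"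
    by (auto simp: reached_def)
  show "j \<in> reached m k"
  proof (cases "k = 0")
    case False
    have "Suc k \<le> column_height n w n j" using thread_le[of i j] i by auto
    then obtain i0 where i0: "(i0, j) \<in> D - F" "thread r i0 j = int k"
      using live_ex[OF j, of k] False by auto
    have "i0 < i" using live_less[OF i0(1), of i] i i0(2) by auto
    then show ?thesis using i(1) by (intro reachedI[OF j _ i0]) simp
  qed (use j reached_0 in auto)
qed

lemma reached_flag: "{j \<in> {1..n}. k \<le> column_height n w m j} \<subseteq> reached m k" if m: "m \<le> n"
proof
  fix j assume "j \<in> {j \<in> {1..n}. k \<le> column_height n w m j}"
  then have j: "j \<in> {1..n}" and k: "k \<le> column_height n w m j" by auto
  show "j \<in> reached m k"
  proof (cases "k = 0")
    case False
    have "k \<le> column_height n w n j" using k column_height_mono[OF m, of n w j] by simp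
    then obtain i where i: "(i, j) \<in> D - F" "thread r i j = int k"
      using live_ex[OF j, of k] False by auto
    have "column_height n w (i - 1) j < k" using flag[of i j] i by auto
    then have "\<not> m \<le> i - 1" using k column_height_mono[of m "i - 1" n w j] by auto
    then show ?thesis by (intro reachedI[OF j _ i]) simp
  qed (use j reached_0 in auto)
qed

lemma reached_le: "reached m k \<subseteq> {j \<in> {1..n}. k \<le> column_height n w n j}"
proof
  fix j assume j: "j \<in> reached m k"
  then have jn: "j \<in> {1..n}" by (simp add: reached_def)
  show "j \<in> {j \<in> {1..n}. k \<le> column_height n w n j}"
  proof (cases "k = 0")
    case False
    then obtain i where "(i, j) \<in> D - F" "thread r i j = int k" using j by (auto simp: reached_def)
    then show ?thesis using thread_le[of i j] jn by auto
  qed (use jn in simp)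
qed

lemma reached_count_flag: "m \<le> n \<Longrightarrow> column_flag n w m k \<le> reached_count m k"
  unfolding column_flag_def reached_count_def using reached_flag by (intro card_mono) auto

lemma reached_count_le: "reached_count m k \<le> column_flag n w n k"
  unfolding column_flag_def reached_count_def using reached_le by (intro card_mono) auto

lemma reached_count_states:
  "m \<le> n \<Longrightarrow> reached_count m \<in> flagged_states n (column_flag n w) m"
  using reached_count_flag reached_count_le by (simp add: flagged_states_def)

lemma reached_count_start: "reached_count 0 = column_flag n w 0"
proof
  fix k
  show "reached_count 0 k = column_flag n w 0 k"
  proof (cases "k = 0")
    case True
    then show ?thesis by (simp add: reached_count_def reached_0 column_flag_row_0)
  next
    case False
    have "j \<notin> reached 0 k" for j using row_pos[of 0 j] False by (auto simp: reached_def)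
    then have "reached 0 k = {}" by blast
    then show ?thesis using False by (simp add: reached_count_def column_flag_eq_0)
  qed
qed

lemma reached_count_end: "reached_count n = column_flag n w n"
  using reached_count_flag[of n] reached_count_le[of n] by (intro ext antisym) auto

lemma reached_count_strip: "horizontal_strip (reached_count m) (reached_count (Suc m))"
  unfolding horizontal_strip_def reached_count_def
  by (intro allI conjI card_mono reached_mono reached_Suc) auto

lemma strip_size_reached:
  "strip_size (Suc n) (reached_count m) (reached_count (Suc m)) = card {j. (Suc m, j) \<in> D - F}"
proof -
  let ?N = "\<lambda>k. {j. (Suc m, j) \<in> D - F \<and> thread r (Suc m) j = int k}"
  have fin: "finite (?N k)" for k
    by (rule finite_subset[of _ "{1..n}"]) (use row_pos in auto)
  have diff: "reached_count (Suc m) k - reached_count m k = card (?N k)" for k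
  proof -
    have "reached (Suc m) k - reached m k = ?N k"
    proof (intro equalityI subsetI)
      fix j assume j: "j \<in> reached (Suc m) k - reached m k"
      then have "k \<noteq> 0" by (auto simp: reached_def)
      then obtain i where i: "i \<le> Suc m" "(i, j) \<in> D - F" "thread r i j = int k"
        using j unfolding reached_def by blast
      have "j \<in> {1..n}" using j by (simp add: reached_def)
      then have "\<not> i \<le> m" using reachedI[OF _ _ i(2,3), of m] j by blast
      then have "i = Suc m" using i(1) by simp
      then show "j \<in> ?N k" using i by simp
    next
      fix j assume j: "j \<in> ?N k"
      then have jn: "j \<in> {1..n}" using row_pos by auto
      have "k \<noteq> 0" using thread_pos[of "Suc m" j] j by auto
      moreover have "i = Suc m" if "(i, j) \<in> D - F" "thread r i j = int k" for i
        using live_inj[of i j "Suc m"] that j by simp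
      ultimately have "j \<notin> reached m k" unfolding reached_def by (auto dest: Suc_n_not_le_n[THEN notE])
      moreover have "j \<in> reached (Suc m) k"
        using j by (intro reachedI[OF jn, of "Suc m"]) auto
      ultimately show "j \<in> reached (Suc m) k - reached m k" by blast
    qed
    then show ?thesis
      unfolding reached_count_def by (metis card_Diff_subset finite_reached reached_mono le_SucI order_refl)
  qed
  have "{j. (Suc m, j) \<in> D - F} = (\<Union>k\<le>Suc n. ?N k)"
  proof (intro equalityI subsetI)
    fix j assume j: "j \<in> {j. (Suc m, j) \<in> D - F}"
    then have "thread r (Suc m) j \<le> int n" "1 \<le> thread r (Suc m) j"
      using thread_le[of "Suc m" j] column_height_le[of n w n j] thread_pos[of "Suc m" j] by auto
    then have "j \<in> ?N (nat (thread r (Suc m) j))" "nat (thread r (Suc m) j) \<le> Suc n"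
      using j by auto
    then show "j \<in> (\<Union>k\<le>Suc n. ?N k)" by blast
  qed auto
  then have "card {j. (Suc m, j) \<in> D - F} = (\<Sum>k\<le>Suc n. card (?N k))"
    using fin by (simp only:) (rule card_UN_disjoint, auto)
  then show ?thesis by (simp add: strip_size_def diff)
qed

text \<open>
  A dead square in row \<open>m + 1\<close> makes the row of its thread free: its column separates the sets whose
  cardinalities are compared. Different dead squares of one row have different threads.
\<close>

lemma dead_le_free_rows:
  assumes m: "m < n"
  shows "card {j. (Suc m, j) \<in> F}
    \<le> card (free_rows (Suc n) (column_flag n w m) (reached_count m) (reached_count (Suc m)))"
proof (rule card_inj_on_le)
  let ?f = "\<lambda>j. nat (thread r (Suc m) j)"
  show "inj_on ?f {j. (Suc m, j) \<in> F}"
  proof (rule inj_onI, rule ccontr)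
    fix j j' assume j: "j \<in> {j. (Suc m, j) \<in> F}" "j' \<in> {j. (Suc m, j) \<in> F}" "?f j = ?f j'" "j \<noteq> j'"
    then have "thread r (Suc m) j = thread r (Suc m) j'"
      using thread_pos[of "Suc m" j] thread_pos[of "Suc m" j'] dead by auto
    then show False using dead_distinct[of "Suc m" j j'] j by simp
  qed
  show "?f ` {j. (Suc m, j) \<in> F} \<subseteq>
      free_rows (Suc n) (column_flag n w m) (reached_count m) (reached_count (Suc m))"
  proof clarify
    fix j assume jF: "(Suc m, j) \<in> F"
    then have jD: "(Suc m, j) \<in> D" using dead by auto
    have jn: "j \<in> {1..n}" using row_pos[OF jD] by simp
    define k where "k = ?f j"
    have k: "thread r (Suc m) j = int k" using thread_pos[OF jD] by (simp add: k_def)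
    have "k \<le> Suc n" using thread_le[OF jD] column_height_le[of n w n j] k by simp
    obtain i0 where i0: "(i0, j) \<in> D - F" "thread r i0 j = thread r (Suc m) j" "i0 < Suc m"
      using jF by (rule live_above_dead)
    have inm: "j \<in> reached m k"
      using i0(2,3) k by (intro reachedI[OF jn _ i0(1)]) auto
    have "j \<notin> reached (Suc m) (Suc k)"
    proof
      assume "j \<in> reached (Suc m) (Suc k)"
      then obtain i where i: "i \<le> Suc m" "(i, j) \<in> D - F" "thread r i j = int (Suc k)"
        by (auto simp: reached_def)
      have "i \<noteq> Suc m" using i(2) jF by auto
      then show False using thread_mono[of i j "Suc m"] i jD k by auto
    qed
    then have "reached_count (Suc m) (Suc k) < reached_count m k"
      unfolding reached_count_def using inm reached_Suc[of m k] by (intro psubset_card_mono) auto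
    moreover have "j \<notin> {j \<in> {1..n}. k \<le> column_height n w m j}"
      using flag[OF jD] k by simp
    then have "column_flag n w m k < reached_count m k"
      unfolding column_flag_def reached_count_def using inm reached_flag[of m k] m
      by (intro psubset_card_mono) auto
    ultimately show "?f j \<in> free_rows (Suc n) (column_flag n w m) (reached_count m) (reached_count (Suc m))"
      using \<open>k \<le> Suc n\<close> unfolding k_def[symmetric] by (simp add: free_rows_def)
  qed
qed (simp add: free_rows_def)

lemma card_row: "card {j. (i, j) \<in> D} = card {j. (i, j) \<in> D - F} + card {j. (i, j) \<in> F}"
proof -
  have fin: "finite {j. (i, j) \<in> D}"
    by (rule finite_subset[of _ "{1..n}"]) (use row_pos in auto)
  have "{j. (i, j) \<in> D} = {j. (i, j) \<in> D - F} \<union> {j. (i, j) \<in> F}" using dead by auto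
  then show ?thesis
    using fin by (metis (no_types, lifting) card_Un_disjoint DiffD2 disjoint_iff finite_Un mem_Collect_eq)
qed

lemma flagged_chain_reached_count:
  assumes "\<And>i. \<alpha> i = card {j. (i, j) \<in> D}"
  shows "flagged_chain n (column_flag n w) n reached_count \<alpha>"
  unfolding flagged_chain_def
proof (intro conjI allI impI)
  show "reached_count 0 = column_flag n w 0" by (rule reached_count_start)
  fix m assume m: "m < n"
  show "reached_count m \<in> flagged_states n (column_flag n w) m" using m reached_count_states by simp
  show "horizontal_strip (reached_count m) (reached_count (Suc m))" by (rule reached_count_strip)
  show "strip_size (Suc n) (reached_count m) (reached_count (Suc m)) \<le> \<alpha> (Suc m)"
    unfolding strip_size_reached assms card_row by simp
  show "\<alpha> (Suc m) \<le> strip_size (Suc n) (reached_count m) (reached_count (Suc m))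
      + card (free_rows (Suc n) (column_flag n w m) (reached_count m) (reached_count (Suc m)))"
    unfolding strip_size_reached assms card_row using dead_le_free_rows[OF m] by simp
qed

end

section \<open>From flagged chains to bubbling diagrams\<close>

lemma initial_segment_card:
  assumes sub: "S \<subseteq> {1..n::nat}" and down: "\<And>k k'. k \<in> S \<Longrightarrow> 1 \<le> k' \<Longrightarrow> k' \<le> k \<Longrightarrow> k' \<in> S"
  shows "S = {1..card S}"
proof (cases "S = {}")
  case False
  have fin: "finite S" using sub finite_subset by blast
  have "S = {1..Max S}"
  proof (intro equalityI subsetI)
    fix k assume "k \<in> S"
    then show "k \<in> {1..Max S}" using sub fin by auto
  next
    fix k assume "k \<in> {1..Max S}"
    then show "k \<in> S" using down[OF Max_in[OF fin False], of k] by simp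
  qed
  then show ?thesis by (metis card_atLeastAtMost diff_Suc_1)
qed simp

text \<open>
  Given a chain, the columns are ordered by decreasing inclusion, and the column at position \<open>p\<close> is filled
  like column \<open>p\<close> of the tableau: thread \<open>k\<close> puts its live square in the first row \<open>m\<close> with
  \<open>p \<le> \<Lambda> m k\<close>.
\<close>

locale chain_filling =
  fixes n :: nat and w :: "nat \<Rightarrow> nat" and \<Lambda> :: "nat \<Rightarrow> nat \<Rightarrow> nat" and \<alpha> :: "nat \<Rightarrow> nat"
  assumes nested: "nested_columns n w"
    and chain: "flagged_chain n (column_flag n w) n \<Lambda> \<alpha>"
    and final: "\<Lambda> n = column_flag n w n"
begin

abbreviation "C \<equiv> rothe_column n w"
abbreviation "R \<equiv> column_flag n w"

lemma start: "\<Lambda> 0 = R 0"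
  using chain by (simp add: flagged_chain_def)

lemma strip: "m < n \<Longrightarrow> horizontal_strip (\<Lambda> m) (\<Lambda> (Suc m))"
  using chain by (simp add: flagged_chain_def)

lemma flag_le: "m \<le> n \<Longrightarrow> R m k \<le> \<Lambda> m k"
  using chain final by (cases "m = n") (auto simp: flagged_chain_def flagged_states_def)

lemma le_shape: "m \<le> n \<Longrightarrow> \<Lambda> m k \<le> R n k"
  using chain final by (cases "m = n") (auto simp: flagged_chain_def flagged_states_def)

lemma step_mono: "m < n \<Longrightarrow> \<Lambda> m k \<le> \<Lambda> (Suc m) k"
  using strip by (simp add: horizontal_strip_def)

lemma step_interlace: "m < n \<Longrightarrow> \<Lambda> (Suc m) (Suc k) \<le> \<Lambda> m k"
  using strip by (simp add: horizontal_strip_def)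

lemma rows_antimono: "m \<le> n \<Longrightarrow> k \<le> k' \<Longrightarrow> \<Lambda> m k' \<le> \<Lambda> m k"
proof -
  assume m: "m \<le> n" and "k \<le> k'"
  have Suc: "\<Lambda> m (Suc k) \<le> \<Lambda> m k" for k
  proof (cases m)
    case 0
    then show ?thesis using start column_flag_antimono[of k "Suc k"] by simp
  next
    case (Suc m')
    then show ?thesis using step_interlace[of m' k] step_mono[of m' k] m by simp
  qed
  show ?thesis using \<open>k \<le> k'\<close> Suc lift_Suc_antimono_le[of "\<Lambda> m"] by blast
qed

lemma row_0: "m \<le> n \<Longrightarrow> \<Lambda> m 0 = n"
  using flag_le[of m 0] le_shape[of m 0] by (simp add: column_flag_row_0)

lemma le_n: "m \<le> n \<Longrightarrow> \<Lambda> m k \<le> n"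
  using rows_antimono[of m 0 k] row_0[of m] by simp

text \<open>
  A linear order on the columns that refines reverse inclusion; ties are broken by the index.
\<close>

definition before :: "nat \<Rightarrow> nat set" where
  "before j = {j' \<in> {1..n}. C j \<subset> C j' \<or> C j = C j' \<and> j' \<le> j}"

definition pos :: "nat \<Rightarrow> nat" where
  "pos j = card (before j)"

lemma finite_before [simp]: "finite (before j)"
  by (simp add: before_def)

lemma before_self: "j \<in> {1..n} \<Longrightarrow> j \<in> before j"
  by (simp add: before_def)

lemma before_total:
  assumes j: "j \<in> {1..n}" "j' \<in> {1..n}"
  shows "j' \<in> before j \<or> j \<in> before j'"
proof -
  have "C j \<subseteq> C j' \<or> C j' \<subseteq> C j" using nested j unfolding nested_columns_def by blast
  then show ?thesis using j unfolding before_def by (cases "C j = C j'") auto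
qed

lemma before_trans: "j' \<in> before j \<Longrightarrow> before j' \<subseteq> before j"
  unfolding before_def by auto

lemma before_antisym: "j' \<in> before j \<Longrightarrow> j \<in> before j' \<Longrightarrow> j = j'"
  unfolding before_def by auto

lemma pos_inj: "inj_on pos {1..n}"
proof -
  have aux: "j = j'" if j: "j \<in> {1..n}" "j' \<in> before j" "pos j = pos j'" for j j'
  proof -
    have "before j' = before j"
      using before_trans[OF j(2)] j(3) card_subset_eq[of "before j" "before j'"] by (simp add: pos_def)
    then show ?thesis using before_self[OF j(1)] before_antisym[OF j(2)] by simp
  qed
  show ?thesis
  proof (rule inj_onI)
    fix j j' assume "j \<in> {1..n}" "j' \<in> {1..n}" "pos j = pos j'"
    then show "j = j'" using before_total[of j j'] aux[of j j'] aux[of j' j] by auto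
  qed
qed

lemma pos_range: "j \<in> {1..n} \<Longrightarrow> pos j \<in> {1..n}"
proof -
  assume j: "j \<in> {1..n}"
  have "before j \<noteq> {}" using before_self[OF j] by auto
  then have "1 \<le> pos j" unfolding pos_def by (simp add: Suc_le_eq card_gt_0_iff)
  moreover have "pos j \<le> card {1..n}" unfolding pos_def by (intro card_mono) (auto simp: before_def)
  ultimately show ?thesis by simp
qed

lemma pos_image: "pos ` {1..n} = {1..n}"
proof (rule card_subset_eq)
  show "pos ` {1..n} \<subseteq> {1..n}" using pos_range by blast
  show "card (pos ` {1..n}) = card {1..n}" by (rule card_image[OF pos_inj])
qed simp

lemma card_pos_le: "x \<le> n \<Longrightarrow> card {j \<in> {1..n}. pos j \<le> x} = x"
proof -
  assume x: "x \<le> n"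
  have "pos ` {j \<in> {1..n}. pos j \<le> x} = {1..x}"
  proof (intro equalityI subsetI)
    fix p assume "p \<in> {1..x}"
    moreover from this obtain j where "j \<in> {1..n}" "pos j = p" using pos_image x
      by (metis atLeastAtMost_iff image_iff le_trans)
    ultimately show "p \<in> pos ` {j \<in> {1..n}. pos j \<le> x}" by auto
  next
    fix p assume "p \<in> pos ` {j \<in> {1..n}. pos j \<le> x}"
    then obtain j where "j \<in> {1..n}" "pos j \<le> x" "p = pos j" by auto
    then show "p \<in> {1..x}" using pos_range[of j] by simp
  qed
  moreover have "inj_on pos {j \<in> {1..n}. pos j \<le> x}"
    by (rule inj_on_subset[OF pos_inj]) auto
  ultimately show ?thesis using card_image by fastforce
qed

text \<open>
  By nestedness, the columns that have height at least \<open>k\<close> within the first \<open>m\<close> rows form an initial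
  segment of the order.
\<close>

lemma pos_le_flag:
  assumes j: "j \<in> {1..n}"
  shows "pos j \<le> R m k \<longleftrightarrow> k \<le> column_height n w m j"
proof
  assume k: "k \<le> column_height n w m j"
  have "k \<le> column_height n w m j'" if "j' \<in> before j" for j'
  proof -
    have "C j \<subseteq> C j'" using that by (auto simp: before_def)
    from column_height_subset[OF this, of m] show ?thesis using k by simp
  qed
  then show "pos j \<le> R m k"
    unfolding pos_def column_flag_def by (intro card_mono) (auto simp: before_def)
next
  assume le: "pos j \<le> R m k"
  show "k \<le> column_height n w m j"
  proof (rule ccontr)
    assume k: "\<not> k \<le> column_height n w m j"
    have "{j' \<in> {1..n}. k \<le> column_height n w m j'} \<subseteq> before j - {j}"
    proof
      fix j' assume j': "j' \<in> {j' \<in> {1..n}. k \<le> column_height n w m j'}"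
      have "\<not> C j' \<subseteq> C j" using column_height_subset[of n w j' j m] j' k by auto
      then have "C j \<subset> C j'" using nested j j' unfolding nested_columns_def by blast
      then show "j' \<in> before j - {j}" using j' by (auto simp: before_def)
    qed
    then have "R m k \<le> card (before j - {j})"
      unfolding column_flag_def by (intro card_mono) auto
    also have "\<dots> < pos j"
      unfolding pos_def using before_self[OF j] by (intro card_Diff1_less) auto
    finally show False using le by simp
  qed
qed

text \<open>
  The number of threads of column \<open>j\<close> that have started in rows \<open>1, \<dots>, i\<close>. It grows by one exactly in
  the rows with a live square, and on the diagram it is the thread of the square.
\<close>

definition reach :: "nat \<Rightarrow> nat \<Rightarrow> nat" where
  "reach i j = card {k \<in> {1..n}. pos j \<le> \<Lambda> i k}"

lemma le_reach:
  assumes j: "j \<in> {1..n}" and i: "i \<le> n" and k: "1 \<le> k"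
  shows "k \<le> reach i j \<longleftrightarrow> pos j \<le> \<Lambda> i k"
proof -
  have "{k \<in> {1..n}. pos j \<le> \<Lambda> i k} = {1..reach i j}"
    unfolding reach_def
  proof (rule initial_segment_card[of _ n])
    fix k k' assume "k \<in> {k \<in> {1..n}. pos j \<le> \<Lambda> i k}" "1 \<le> k'" "k' \<le> k"
    then show "k' \<in> {k \<in> {1..n}. pos j \<le> \<Lambda> i k}" using rows_antimono[OF i, of k' k] by auto
  qed auto
  then have "k \<le> reach i j \<longleftrightarrow> k \<in> {k \<in> {1..n}. pos j \<le> \<Lambda> i k}" using k by auto
  moreover have "k \<le> n" if "pos j \<le> \<Lambda> i k"
  proof (rule ccontr)
    assume "\<not> k \<le> n"
    then have "\<Lambda> i k = 0" using le_shape[OF i, of k] column_flag_eq_0[of n k n w] by simp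
    then show False using that pos_range[OF j] by simp
  qed
  ultimately show ?thesis using k by auto
qed

lemma reach_0: "j \<in> {1..n} \<Longrightarrow> reach 0 j = 0"
  using le_reach[of j 0 1] start column_flag_eq_0[of 0 1 n w] pos_range[of j] by auto

lemma reach_Suc_ge: "j \<in> {1..n} \<Longrightarrow> m < n \<Longrightarrow> reach m j \<le> reach (Suc m) j"
  unfolding reach_def using step_mono le_trans by (intro card_mono) fastforce+

lemma reach_Suc_le:
  assumes j: "j \<in> {1..n}" and m: "m < n"
  shows "reach (Suc m) j \<le> Suc (reach m j)"
proof (rule ccontr)
  assume "\<not> reach (Suc m) j \<le> Suc (reach m j)"
  then have "Suc (Suc (reach m j)) \<le> reach (Suc m) j" by simp
  then have "pos j \<le> \<Lambda> (Suc m) (Suc (Suc (reach m j)))"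
    using le_reach[OF j, of "Suc m" "Suc (Suc (reach m j))"] m by simp
  also have "\<dots> \<le> \<Lambda> m (Suc (reach m j))" using step_interlace[OF m] .
  finally have "Suc (reach m j) \<le> reach m j"
    using le_reach[OF j, of m "Suc (reach m j)"] m by simp
  then show False by simp
qed

lemma reach_mono:
  assumes j: "j \<in> {1..n}" and "m \<le> m'" "m' \<le> n"
  shows "reach m j \<le> reach m' j"
  using assms(2,3)
proof (induction m' rule: dec_induct)
  case (step m')
  then show ?case using reach_Suc_ge[OF j, of m'] by simp
qed simp

lemma dead_rows_exist:
  assumes "m < n"
  shows "\<exists>E. E \<subseteq> free_rows (Suc n) (R m) (\<Lambda> m) (\<Lambda> (Suc m)) \<and>
    card E = \<alpha> (Suc m) - strip_size (Suc n) (\<Lambda> m) (\<Lambda> (Suc m))"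
proof -
  have "\<alpha> (Suc m) - strip_size (Suc n) (\<Lambda> m) (\<Lambda> (Suc m))
      \<le> card (free_rows (Suc n) (R m) (\<Lambda> m) (\<Lambda> (Suc m)))"
    using chain assms unfolding flagged_chain_def by (simp add: le_diff_conv add.commute)
  then show ?thesis by (metis obtain_subset_with_card_n)
qed

text \<open>
  The free rows that supply the part of the weight not covered by the strip.
\<close>

definition dead_rows :: "nat \<Rightarrow> nat set" where
  "dead_rows m = (SOME E. E \<subseteq> free_rows (Suc n) (R m) (\<Lambda> m) (\<Lambda> (Suc m)) \<and>
    card E = \<alpha> (Suc m) - strip_size (Suc n) (\<Lambda> m) (\<Lambda> (Suc m)))"

lemma dead_rows:
  assumes "m < n"
  shows "dead_rows m \<subseteq> free_rows (Suc n) (R m) (\<Lambda> m) (\<Lambda> (Suc m))"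
    and "card (dead_rows m) = \<alpha> (Suc m) - strip_size (Suc n) (\<Lambda> m) (\<Lambda> (Suc m))"
  using someI_ex[OF dead_rows_exist[OF assms], folded dead_rows_def] by auto

definition live :: "square set" where
  "live = {(i, j). 1 \<le> i \<and> i \<le> n \<and> j \<in> {1..n} \<and> reach (i - 1) j < reach i j}"

text \<open>
  An additional entry in row \<open>k\<close> of the tableau belongs to the last box of this row, that is, to the
  column at position \<open>\<Lambda> m k\<close>.
\<close>

definition dead :: "square set" where
  "dead = {(i, j). 1 \<le> i \<and> i \<le> n \<and> j \<in> {1..n} \<and> (\<exists>k\<in>dead_rows (i - 1). pos j = \<Lambda> (i - 1) k)}"

definition rank :: "square \<Rightarrow> int" where
  "rank = (\<lambda>(i, j). int i - int (reach i j))"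

lemma thread_rank: "thread rank i j = int (reach i j)"
  by (simp add: thread_def rank_def)

lemma dead_row:
  assumes m: "m < n" and j: "j \<in> {1..n}" and k: "k \<in> dead_rows m" "pos j = \<Lambda> m k"
  shows "1 \<le> k" "reach m j = k" "reach (Suc m) j = k" "\<not> k \<le> column_height n w m j"
proof -
  have free: "\<Lambda> (Suc m) (Suc k) < \<Lambda> m k" "R m k < \<Lambda> m k"
    using dead_rows(1)[OF m] k by (auto simp: free_rows_def)
  show k1: "1 \<le> k"
  proof (rule ccontr)
    assume "\<not> 1 \<le> k"
    then have "k = 0" by simp
    then show False using free(2) row_0[of m] m by (simp add: column_flag_row_0)
  qed
  have "k \<le> reach m j" using le_reach[OF j, of m k] k1 k(2) m by simp
  moreover have "\<not> Suc k \<le> reach (Suc m) j"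
    using le_reach[OF j, of "Suc m" "Suc k"] free(1) k(2) m by simp
  ultimately show "reach m j = k" "reach (Suc m) j = k" using reach_Suc_ge[OF j m] by auto
  show "\<not> k \<le> column_height n w m j" using pos_le_flag[OF j, of m k] free(2) k(2) by simp
qed

lemma deadE:
  assumes "(i, j) \<in> dead"
  obtains m k where "i = Suc m" "m < n" "j \<in> {1..n}" "k \<in> dead_rows m" "pos j = \<Lambda> m k"
proof -
  have "i = Suc (i - 1)" "i - 1 < n" using assms by (auto simp: dead_def)
  then show ?thesis using that[of "i - 1"] assms by (auto simp: dead_def)
qed

lemma live_not_dead: "(i, j) \<in> live \<Longrightarrow> (i, j) \<notin> dead"
proof
  assume l: "(i, j) \<in> live" and d: "(i, j) \<in> dead"
  obtain m k where "i = Suc m" "m < n" "j \<in> {1..n}" "k \<in> dead_rows m" "pos j = \<Lambda> m k"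
    using d by (rule deadE)
  then show False using dead_row[of m j k] l by (simp add: live_def)
qed

lemma reach_le_column:
  assumes j: "j \<in> {1..n}" and m: "m \<le> n"
  shows "reach m j \<le> column_height n w n j"
proof (cases "reach m j = 0")
  case False
  then have "pos j \<le> \<Lambda> m (reach m j)" using le_reach[OF j m, of "reach m j"] by simp
  also have "\<dots> \<le> R n (reach m j)" using le_shape[OF m] .
  finally show ?thesis using pos_le_flag[OF j] by simp
qed simp

lemma column_le_reach:
  assumes j: "j \<in> {1..n}" and m: "m \<le> n"
  shows "column_height n w m j \<le> reach m j"
proof (cases "column_height n w m j = 0")
  case False
  have "pos j \<le> R m (column_height n w m j)" using pos_le_flag[OF j] by simp
  also have "\<dots> \<le> \<Lambda> m (column_height n w m j)" using flag_le[OF m] .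
  finally show ?thesis using le_reach[OF j m, of "column_height n w m j"] False by simp
qed simp

lemma live_exists:
  assumes j: "j \<in> {1..n}" and k: "1 \<le> k" "k \<le> reach m j" and m: "m \<le> n"
  shows "\<exists>i\<le>m. (i, j) \<in> live \<and> reach i j = k"
proof -
  have "\<not> k \<le> reach 0 j" using reach_0[OF j] k(1) by simp
  then obtain q where q: "q < m" "\<not> k \<le> reach q j" "k \<le> reach (Suc q) j"
    using first_entry[of 0 m "{m. k \<le> reach m j}"] k(2) by auto
  then have "reach (Suc q) j = k" using reach_Suc_le[OF j, of q] m by simp
  moreover have "(Suc q, j) \<in> live" using q m j by (simp add: live_def)
  ultimately show ?thesis using q(1) by (intro exI[of _ "Suc q"]) simp
qed

lemma squareE:
  assumes "(i, j) \<in> live \<union> dead"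
  shows "1 \<le> i" "i \<le> n" "j \<in> {1..n}" "column_height n w (i - 1) j < reach i j"
proof -
  show i: "1 \<le> i" "i \<le> n" and j: "j \<in> {1..n}" using assms by (auto simp: live_def dead_def)
  show "column_height n w (i - 1) j < reach i j"
  proof (cases "(i, j) \<in> live")
    case True
    moreover have "i - 1 \<le> n" using i by simp
    ultimately show ?thesis using column_le_reach[OF j, of "i - 1"] by (simp add: live_def)
  next
    case False
    then obtain m k where m: "i = Suc m" "m < n" "k \<in> dead_rows m" "pos j = \<Lambda> m k"
      using assms deadE by blast
    then show ?thesis using dead_row[OF m(2) j m(3,4)] by simp
  qed
qed

lemma threaded_filling: "threaded n w (live \<union> dead) rank dead"
proof
  show "live \<union> dead \<subseteq> {1..n} \<times> {1..n}" by (auto simp: live_def dead_def)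
  show "dead \<subseteq> live \<union> dead" by simp
  fix i j assume ij: "(i, j) \<in> live \<union> dead"
  note sq = squareE[OF ij]
  show "int (column_height n w (i - 1) j) < thread rank i j"
    unfolding thread_rank using sq(4) by simp
  show "thread rank i j \<le> int (column_height n w n j)"
    unfolding thread_rank using reach_le_column[OF sq(3,2)] by simp
  fix i'
  show "thread rank i j \<le> thread rank i' j" if *: "(i', j) \<in> live \<union> dead" "i < i'"
    unfolding thread_rank using reach_mono[OF sq(3), of i i'] squareE[OF *(1)] *(2) by simp
  show "thread rank i j < thread rank i' j" if *: "(i', j) \<in> live \<union> dead - dead" "i < i'"
  proof -
    have i': "(i', j) \<in> live" using * by auto
    have "i \<le> i' - 1" "i' - 1 \<le> n" using *(2) i' by (auto simp: live_def)
    then have "reach i j \<le> reach (i' - 1) j" by (rule reach_mono[OF sq(3)])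
    then show ?thesis unfolding thread_rank using i' by (simp add: live_def)
  qed
next
  fix j k assume j: "j \<in> {1..n}" and k: "1 \<le> k" "k \<le> column_height n w n j"
  have "k \<le> reach n j" using k(2) column_le_reach[OF j, of n] by simp
  then obtain i where "(i, j) \<in> live" "reach i j = k" using live_exists[OF j k(1), of n] by blast
  then show "\<exists>i. (i, j) \<in> live \<union> dead - dead \<and> thread rank i j = int k"
    using live_not_dead[of i j] by (auto simp: thread_rank)
next
  fix i j j' assume d: "(i, j) \<in> dead" "(i, j') \<in> dead" "j \<noteq> j'"
  obtain m k where m: "i = Suc m" "m < n" "j \<in> {1..n}" "k \<in> dead_rows m" "pos j = \<Lambda> m k"
    using d(1) by (rule deadE)
  obtain m' k' where m': "i = Suc m'" "m' < n" "j' \<in> {1..n}" "k' \<in> dead_rows m'" "pos j' = \<Lambda> m' k'"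
    using d(2) by (rule deadE)
  have "pos j \<noteq> pos j'" using pos_inj m(3) m'(3) d(3) by (auto dest: inj_onD)
  then have "k \<noteq> k'" using m(1,5) m'(1,5) by auto
  then show "thread rank i j \<noteq> thread rank i j'"
    unfolding thread_rank using dead_row[OF m(2-5)] dead_row[OF m'(2-5)] m(1) m'(1) by simp
qed

sublocale filling: threaded n w "live \<union> dead" rank dead
  by (rule threaded_filling)

lemma reached_count_eq: "m \<le> n \<Longrightarrow> filling.reached_count m = \<Lambda> m"
proof
  fix k assume m: "m \<le> n"
  show "filling.reached_count m k = \<Lambda> m k"
  proof (cases "k = 0")
    case True
    then show ?thesis using row_0[OF m] by (simp add: filling.reached_count_def filling.reached_0)
  next
    case False
    have "filling.reached m k = {j \<in> {1..n}. pos j \<le> \<Lambda> m k}"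
    proof (intro equalityI subsetI)
      fix j assume j: "j \<in> filling.reached m k"
      then obtain i where i: "j \<in> {1..n}" "i \<le> m" "thread rank i j = int k"
        using False by (auto simp: filling.reached_def)
      have "k \<le> reach m j" using reach_mono[OF i(1,2) m] i(3) by (simp add: thread_rank)
      then show "j \<in> {j \<in> {1..n}. pos j \<le> \<Lambda> m k}" using le_reach[OF i(1) m, of k] False i(1) by simp
    next
      fix j assume j: "j \<in> {j \<in> {1..n}. pos j \<le> \<Lambda> m k}"
      then have jn: "j \<in> {1..n}" by simp
      have "k \<le> reach m j" using j le_reach[OF jn m, of k] False by simp
      then obtain i where i: "i \<le> m" "(i, j) \<in> live" "reach i j = k"
        using live_exists[OF jn _ _ m, of k] False by auto
      then show "j \<in> filling.reached m k"
        using live_not_dead[OF i(2)] by (intro filling.reachedI[OF jn i(1)]) (auto simp: thread_rank)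
    qed
    then show ?thesis using card_pos_le[OF le_n[OF m]] by (simp add: filling.reached_count_def)
  qed
qed

lemma card_dead_row:
  assumes m: "m < n"
  shows "card {j. (Suc m, j) \<in> dead} = card (dead_rows m)"
proof -
  have eq: "(Suc m, j) \<in> dead \<longleftrightarrow> j \<in> {1..n} \<and> (\<exists>k\<in>dead_rows m. pos j = \<Lambda> m k)" for j
    using m by (simp add: dead_def)
  have "inj_on (reach (Suc m)) {j. (Suc m, j) \<in> dead}"
  proof (rule inj_onI)
    fix j j' assume j: "j \<in> {j. (Suc m, j) \<in> dead}" "j' \<in> {j. (Suc m, j) \<in> dead}"
      and same: "reach (Suc m) j = reach (Suc m) j'"
    then obtain k k' where k: "j \<in> {1..n}" "k \<in> dead_rows m" "pos j = \<Lambda> m k"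
      "j' \<in> {1..n}" "k' \<in> dead_rows m" "pos j' = \<Lambda> m k'"
      unfolding mem_Collect_eq eq by blast
    then have "pos j = pos j'"
      using dead_row(3)[OF m k(1-3)] dead_row(3)[OF m k(4-6)] same by simp
    then show "j = j'" using pos_inj k(1,4) by (auto dest: inj_onD)
  qed
  moreover have "reach (Suc m) ` {j. (Suc m, j) \<in> dead} = dead_rows m"
  proof (intro equalityI subsetI)
    fix k assume "k \<in> reach (Suc m) ` {j. (Suc m, j) \<in> dead}"
    then obtain j k' where "k = reach (Suc m) j" "j \<in> {1..n}" "k' \<in> dead_rows m" "pos j = \<Lambda> m k'"
      unfolding image_iff mem_Collect_eq eq by blast
    then show "k \<in> dead_rows m" using dead_row(3)[OF m, of j k'] by simp
  next
    fix k assume k: "k \<in> dead_rows m"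
    then have "R m k < \<Lambda> m k" using dead_rows(1)[OF m] by (auto simp: free_rows_def)
    then have "\<Lambda> m k \<in> {1..n}" using le_n[of m k] m by simp
    then obtain j where j: "j \<in> {1..n}" "\<Lambda> m k = pos j" using pos_image by (metis image_iff)
    then have "(Suc m, j) \<in> dead" unfolding eq using k j(2) by (intro conjI bexI[of _ k]) auto
    moreover have "reach (Suc m) j = k" using dead_row(3)[OF m j(1) k] j(2) by simp
    ultimately show "k \<in> reach (Suc m) ` {j. (Suc m, j) \<in> dead}" by blast
  qed
  ultimately show ?thesis using card_image by metis
qed

text \<open>
  Counting the columns of the filling returns the given chain, so \<open>strip_size_reached\<close>
  gives the number of live squares in a row.
\<close>

lemma card_row_filling:
  assumes m: "m < n"
  shows "card {j. (Suc m, j) \<in> live \<union> dead} = \<alpha> (Suc m)"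
proof -
  have "strip_size (Suc n) (\<Lambda> m) (\<Lambda> (Suc m)) \<le> \<alpha> (Suc m)"
    using chain m by (simp add: flagged_chain_def)
  then show ?thesis
    unfolding filling.card_row filling.strip_size_reached[symmetric]
    using reached_count_eq[of m] reached_count_eq[of "Suc m"] m card_dead_row[OF m] dead_rows(2)[OF m]
    by simp
qed

end

section \<open>Support and weights\<close>

lemma BD_threaded:
  assumes w: "w permutes {1..n}"
  shows "(D, r, F) \<in> BD n w \<Longrightarrow> threaded n w D r F"
    and "threaded n w D r F \<Longrightarrow> \<exists>r'. (D, r', F) \<in> BD n w"
proof -
  show "(D, r, F) \<in> BD n w \<Longrightarrow> threaded n w D r F"
    using threaded_reachable[OF w] by (simp add: BD_def)
  assume "threaded n w D r F"
  then obtain r' where "bubbling_step\<^sup>*\<^sup>* (rothe_bubbling n w) (D, r', F)"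
    using reachable_threaded[OF w] by blast
  then show "\<exists>r'. (D, r', F) \<in> BD n w"
    using threaded_reachable[OF w] threaded.is_bubbling_diagram unfolding BD_def by blast
qed

text \<open>
  Set-valued tableaux of the same weight occur with the same sign, so their weights are exactly the
  exponents that survive.
\<close>

lemma supp_grothendieck:
  assumes "w permutes {1..n}" "nested_columns n w"
  shows "supp (grothendieck n w) = {\<lambda>i. int (\<alpha> i) | \<alpha>. (\<forall>i. i = 0 \<or> n < i \<longrightarrow> \<alpha> i = 0) \<and>
    (\<exists>\<Lambda>. \<Lambda> n = column_flag n w n \<and> flagged_chain n (column_flag n w) n \<Lambda> \<alpha>)}"
proof -
  have keys: "a \<in> Poly_Mapping.keys (grothendieck n w) \<longleftrightarrow>
      (\<exists>\<Lambda>. \<Lambda> n = column_flag n w n \<and> flagged_chain n (column_flag n w) n \<Lambda> (Poly_Mapping.lookup a)) \<and>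
      (\<forall>i. i = 0 \<or> n < i \<longrightarrow> Poly_Mapping.lookup a i = 0)" for a
    unfolding grothendieck_eq_chain_sum[OF assms]
    by (rule keys_chain_sum[THEN conjunct2, THEN spec]) (rule column_flag_eq_0)
  show ?thesis
  proof (intro equalityI subsetI)
    fix f assume "f \<in> supp (grothendieck n w)"
    then obtain a where f: "f = (\<lambda>i. int (Poly_Mapping.lookup a i))"
      and a: "a \<in> Poly_Mapping.keys (grothendieck n w)" by (auto simp: supp_def)
    show "f \<in> {\<lambda>i. int (\<alpha> i) | \<alpha>. (\<forall>i. i = 0 \<or> n < i \<longrightarrow> \<alpha> i = 0) \<and>
      (\<exists>\<Lambda>. \<Lambda> n = column_flag n w n \<and> flagged_chain n (column_flag n w) n \<Lambda> \<alpha>)}"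
      using f a[unfolded keys] by (intro CollectI exI[of _ "Poly_Mapping.lookup a"] conjI) simp_all
  next
    fix f assume "f \<in> {\<lambda>i. int (\<alpha> i) | \<alpha>. (\<forall>i. i = 0 \<or> n < i \<longrightarrow> \<alpha> i = 0) \<and>
      (\<exists>\<Lambda>. \<Lambda> n = column_flag n w n \<and> flagged_chain n (column_flag n w) n \<Lambda> \<alpha>)}"
    then obtain \<alpha> where f: "f = (\<lambda>i. int (\<alpha> i))" and zero: "\<forall>i. i = 0 \<or> n < i \<longrightarrow> \<alpha> i = 0"
      and chain: "\<exists>\<Lambda>. \<Lambda> n = column_flag n w n \<and> flagged_chain n (column_flag n w) n \<Lambda> \<alpha>" by blast
    have "finite {i. \<alpha> i \<noteq> 0}"
    proof (rule finite_subset)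
      show "{i. \<alpha> i \<noteq> 0} \<subseteq> {..n}"
      proof
        fix i assume "i \<in> {i. \<alpha> i \<noteq> 0}"
        then have "\<not> n < i" using zero[rule_format, of i] by auto
        then show "i \<in> {..n}" by simp
      qed
    qed simp
    then have "Poly_Mapping.lookup (Abs_poly_mapping \<alpha>) = \<alpha>" by simp
    then have "Abs_poly_mapping \<alpha> \<in> Poly_Mapping.keys (grothendieck n w)"
      "f = (\<lambda>i. int (Poly_Mapping.lookup (Abs_poly_mapping \<alpha>) i))"
      unfolding keys f using zero chain by simp_all
    then show "f \<in> supp (grothendieck n w)" unfolding supp_def by blast
  qed
qed

theorem theorem1p1:
  fixes n :: nat and w :: "nat \<Rightarrow> nat"
  assumes "w permutes {1..n}" and "vexillary n w"
  shows "supp (grothendieck n w) = {wt \<D> | \<D>. \<D> \<in> BD n w}"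
proof -
  have nested: "nested_columns n w" by (rule vexillary_nested_columns[OF assms])
  show ?thesis
    unfolding supp_grothendieck[OF assms(1) nested]
  proof (intro equalityI subsetI)
    fix f assume "f \<in> {\<lambda>i. int (\<alpha> i) | \<alpha>. (\<forall>i. i = 0 \<or> n < i \<longrightarrow> \<alpha> i = 0) \<and>
      (\<exists>\<Lambda>. \<Lambda> n = column_flag n w n \<and> flagged_chain n (column_flag n w) n \<Lambda> \<alpha>)}"
    then obtain \<alpha> \<Lambda> where f: "f = (\<lambda>i. int (\<alpha> i))" and zero: "\<forall>i. i = 0 \<or> n < i \<longrightarrow> \<alpha> i = 0"
      and chain: "\<Lambda> n = column_flag n w n" "flagged_chain n (column_flag n w) n \<Lambda> \<alpha>" by blast
    interpret chain_filling n w \<Lambda> \<alpha> by unfold_locales (fact nested chain)+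
    obtain r where BD: "(live \<union> dead, r, dead) \<in> BD n w"
      using BD_threaded(2)[OF assms(1) threaded_filling] by blast
    have "wt (live \<union> dead, r, dead) i = int (\<alpha> i)" for i
    proof (cases "1 \<le> i \<and> i \<le> n")
      case True
      then obtain m where "i = Suc m" "m < n" by (cases i) auto
      then show ?thesis using card_row_filling[of m] by (simp add: wt_def)
    next
      case False
      have "(i, j) \<notin> live \<union> dead" for j using squareE(1,2)[of i j] False by blast
      moreover have "\<alpha> i = 0" using False by (intro zero[rule_format]) linarith
      ultimately show ?thesis by (simp add: wt_def)
    qed
    then have "f = wt (live \<union> dead, r, dead)" unfolding f by auto
    then show "f \<in> {wt \<D> | \<D>. \<D> \<in> BD n w}" using BD by blast
  next
    fix f assume "f \<in> {wt \<D> | \<D>. \<D> \<in> BD n w}"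
    then obtain D r F where f: "f = wt (D, r, F)" and BD: "(D, r, F) \<in> BD n w" by auto
    interpret threaded n w D r F by (rule BD_threaded(1)[OF assms(1) BD])
    let ?\<alpha> = "\<lambda>i. card {j. (i, j) \<in> D}"
    have "?\<alpha> i = 0" if "i = 0 \<or> n < i" for i
    proof -
      have "(i, j) \<notin> D" for j using that row_pos[of i j] by auto
      then show ?thesis by simp
    qed
    moreover have "f = (\<lambda>i. int (?\<alpha> i))" unfolding f by (simp add: wt_def fun_eq_iff)
    ultimately show "f \<in> {\<lambda>i. int (\<alpha> i) | \<alpha>. (\<forall>i. i = 0 \<or> n < i \<longrightarrow> \<alpha> i = 0) \<and>
      (\<exists>\<Lambda>. \<Lambda> n = column_flag n w n \<and> flagged_chain n (column_flag n w) n \<Lambda> \<alpha>)}"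
      using flagged_chain_reached_count[of ?\<alpha>] reached_count_end
      by (intro CollectI exI[of _ ?\<alpha>] conjI exI[of _ reached_count]) simp_all
  qed
qed

end
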